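(* Let $h\colon\mathbb{H}\to\mathbb{H}$ be a one component doubly parabolic inner function with Denjoy-Wolff point at $\infty$, and let $T\colon\mathbb{R}\to\mathbb{R}$ be its radial extension to $\mathbb{R}$. Then there exist constants $c>0$ and $W,K>1$, depending only on $h$, such that for every $x\in\mathbb{R}$ there is $r_0>0$ such that, for all $r\in(0,r_0)$, there exists a periodic point $p\in(x-r,x+r)$ of $T$ of period less than $$\Big(\frac{-\ln r}{\ln K}+1\Big)\cdot\frac{W}{cr^2}+\frac{x^2}{c}.$$
   Context: An inner function is a holomorphic map $g\colon\mathbb{D}\to\mathbb{D}$ whose radial limits lie in $\partial\mathbb{D}$ almost everywhere. Its Denjoy-Wolff point is the point to which all interior orbits converge. $g$ is one component if for some $0<r<1$ the set $\{z\in\mathbb{D}:|g(z)|<r\}$ is connected. $g$ is doubly parabolic if its Denjoy-Wolff point $q$ lies in $\partial\mathbb{D}$, $g$ is holomorphic in a neighbourhood of $q$, and near $q$, $g(z)=q+(z-q)+a(z-q)^3+\dots$ with $a\ne0$. A one component doubly parabolic inner function $h\colon\mathbb{H}\to\mathbb{H}$ with Denjoy-Wolff point at $\infty$ is a map $h=M\circ g\circ M^{-1}$, where $g$ is one component and doubly parabolic with Denjoy-Wolff point $q$ and $M\colon\mathbb{D}\to\mathbb{H}$ is a Möbius transformation onto the upper half-plane with $M(q)=\infty$. Its radial extension $T$ is defined almost everywhere on $\mathbb{R}$. *)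

theory Defs
  imports "HOL-Complex_Analysis.Complex_Analysis"
begin

definition inner_function :: "(complex \<Rightarrow> complex) \<Rightarrow> bool" where
  "inner_function g \<longleftrightarrow>
     g holomorphic_on ball 0 1 \<and> g ` ball 0 1 \<subseteq> ball 0 1 \<and>
     (AE t in lborel. \<exists>l\<in>sphere 0 1. ((\<lambda>r. g (of_real r * cis t)) \<longlongrightarrow> l) (at_left 1))"

definition denjoy_wolff_point :: "(complex \<Rightarrow> complex) \<Rightarrow> complex \<Rightarrow> bool" where
  "denjoy_wolff_point g q \<longleftrightarrow> (\<forall>z\<in>ball 0 1. (\<lambda>n. (g ^^ n) z) \<longlonglongrightarrow> q)"

definition one_component :: "(complex \<Rightarrow> complex) \<Rightarrow> bool" where
  "one_component g \<longleftrightarrow> (\<exists>r::real. 0 < r \<and> r < 1 \<and> connected {z\<in>ball 0 1. norm (g z) < r})"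

text \<open>Only the values of \<open>g\<close> on the open unit disc are meaningful, so ``holomorphic in a
  neighbourhood of \<open>q\<close>'' means that \<open>g\<close> has a holomorphic extension \<open>G\<close> there; \<open>F\<close> is the Taylor
  series of \<open>G\<close> at \<open>q\<close>.\<close>

definition doubly_parabolic_at :: "(complex \<Rightarrow> complex) \<Rightarrow> complex \<Rightarrow> bool" where
  "doubly_parabolic_at g q \<longleftrightarrow>
     denjoy_wolff_point g q \<and> q \<in> sphere 0 1 \<and>
     (\<exists>U G F. open U \<and> q \<in> U \<and> G holomorphic_on U \<and> (\<forall>z \<in> U \<inter> ball 0 1. G z = g z) \<and>
        (\<lambda>w. G (q + w)) has_fps_expansion F \<and>
        fps_nth F 0 = q \<and> fps_nth F 1 = 1 \<and> fps_nth F 2 = 0 \<and> fps_nth F 3 \<noteq> 0)"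

abbreviation upper_half_plane :: "complex set" where
  "upper_half_plane \<equiv> {z. Im z > 0}"

text \<open>The value \<open>M q = \<infinity>\<close> is expressed by the vanishing of the denominator of \<open>M\<close> at \<open>q\<close>.\<close>

definition moebius_disc_to_half_plane :: "(complex \<Rightarrow> complex) \<Rightarrow> complex \<Rightarrow> bool" where
  "moebius_disc_to_half_plane M q \<longleftrightarrow>
     (\<exists>\<alpha> \<beta> \<gamma> \<delta>. \<alpha> * \<delta> - \<beta> * \<gamma> \<noteq> 0 \<and> M = (\<lambda>z. (\<alpha> * z + \<beta>) / (\<gamma> * z + \<delta>)) \<and> \<gamma> * q + \<delta> = 0) \<and>
     M ` ball 0 1 = upper_half_plane"

text \<open>Maps of the upper half-plane are represented by functions whose values off the half-plane
  are irrelevant, so the conjugacy is only required there.\<close>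

definition one_component_doubly_parabolic_half_plane :: "(complex \<Rightarrow> complex) \<Rightarrow> bool" where
  "one_component_doubly_parabolic_half_plane h \<longleftrightarrow>
     (\<exists>g q M. inner_function g \<and> one_component g \<and> doubly_parabolic_at g q \<and>
        moebius_disc_to_half_plane M q \<and>
        (\<forall>w\<in>upper_half_plane. h w = M (g (inv_into (ball 0 1) M w))))"

text \<open>In the half-plane model, radial limits at \<open>x \<in> \<real>\<close> are limits along the vertical line over \<open>x\<close>;
  by Lindelof's theorem they are the images under \<open>M\<close> of the radial limits of \<open>g\<close>.
  The extension is a partial map, undefined where there is no limit in \<open>\<real>\<close>
  (in particular where the limit is \<open>\<infinity>\<close>).\<close>

definition radial_limit :: "(complex \<Rightarrow> complex) \<Rightarrow> real \<Rightarrow> real \<Rightarrow> bool" where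
  "radial_limit h x y \<longleftrightarrow> ((\<lambda>t. h (Complex x t)) \<longlongrightarrow> complex_of_real y) (at_right 0)"

definition radial_extension :: "(complex \<Rightarrow> complex) \<Rightarrow> (real \<rightharpoonup> real)" where
  "radial_extension h x = (if \<exists>y. radial_limit h x y then Some (THE y. radial_limit h x y) else None)"

text \<open>\<open>n\<close> need not be the least period; in particular all of \<open>p, T p, \<dots>, T\<^sup>n p\<close> are defined.\<close>

definition periodic_point :: "('a \<rightharpoonup> 'a) \<Rightarrow> nat \<Rightarrow> 'a \<Rightarrow> bool" where
  "periodic_point T n p \<longleftrightarrow> n > 0 \<and> ((\<lambda>y. Option.bind y T) ^^ n) (Some p) = Some p"

end

theory Submission
  imports Defs "HOL-Probability.Helly_Selection"
begin

text \<open>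
  Write \<open>N z = h z - z\<close>. The expansion of \<open>h\<close> at \<open>\<infinity>\<close> gives \<open>z * N z \<rightarrow> -m\<close> with \<open>m > 0\<close>, so that \<open>N\<close>
  maps the half-plane into itself, and the Schwarz-Pick inequality for \<open>N\<close> yields
  \<open>T' \<ge> 1 + (T x - x)\<^sup>2 / m\<close> and \<open>T' \<ge> 1 + c / (1 + x\<^sup>2)\<close> wherever \<open>h\<close> extends analytically to a real
  point \<open>x\<close> with a real value there. Let \<open>P\<close> be the compact set of the remaining real points (poles
  and singularities). An interval of length \<open>r\<close> whose iterates avoid \<open>P\<close> stays within distance \<open>O(1/r)\<close>
  of the origin by the first inequality, hence grows in each step by a factor \<open>1 + const * r\<^sup>2\<close>
  by the second one; once it is long, the parabolic drift pushes it into \<open>P\<close>. So some iterate with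
  \<open>n = O(r\<^sup>-\<^sup>2 ln (1/r))\<close> meets \<open>P\<close>.

  What happens at \<open>P\<close> is read off from \<open>f = -1 / (h\<^sup>n\<^sup>+\<^sup>1 - z)\<close>. Since \<open>T\<close> is real almost everywhere, \<open>Im f\<close>
  has vertical limit \<open>0\<close> at almost every point of the interval at which \<open>T\<^sup>n\<^sup>+\<^sup>1\<close> has no fixed point; the
  measure representing \<open>Im f\<close> is therefore singular on the interval, and it lives on points where \<open>f\<close> tends to
  \<open>\<infinity>\<close>, that is, on fixed points of \<open>T\<^sup>n\<^sup>+\<^sup>1\<close>. Without fixed points, \<open>f\<close> extends analytically and \<open>T\<^sup>n\<^sup>+\<^sup>1\<close> has
  just a simple pole. Its one-sided images are half-lines, which drift into \<open>P\<close> once more, and the next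
  pole makes an iterate surjective onto the line, hence produces a fixed point.
\<close>

section \<open>The Schwarz-Pick inequality and vertical limits\<close>

text \<open>The set \<open>P\<close> may be infinite, so no partition of the line into finitely many
  branches is available. This is why almost everywhere information on boundary limits, measures and
  a covering argument replace a direct study of \<open>h\<close> at \<open>P\<close>.

  The term \<open>(T x - x)\<^sup>2 / m\<close> arises from the Schwarz-Pick inequality for
  \<open>N\<close> when one of its two points is sent to infinity. A displacement satisfying this
  Riccati inequality blows up within distance m / |N|, forwards if N > 0 and backwards if N < 0.
  Hence on an interval of length r outside \<open>P\<close> the left end cannot jump right, nor the
  right end jump left, by more than m / r. The order r^-2 has the same source: at distance D of
  order 1/r the expansion exceeds 1 by about c / D^2 and the drift per step is about c / D.

  The inversion in -1 / (h^(n+1) - z) exchanges the roles of the singular points: poles of the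
  iterate become zeros, and the poles that remain are fixed points, excluded by contradiction.

  Boundary limits must be composed along orbits, but analytic maps bend vertical lines. The approach
  regions used here shrink in aperture and are respected by every map with a positive derivative at
  a real point.\<close>

definition half_plane_self_map :: "(complex \<Rightarrow> complex) \<Rightarrow> bool" where
  "half_plane_self_map f \<longleftrightarrow> f holomorphic_on upper_half_plane \<and> f ` upper_half_plane \<subseteq> upper_half_plane"

lemma half_plane_self_mapD:
  assumes "half_plane_self_map f"
  shows "f holomorphic_on upper_half_plane" "Im z > 0 \<Longrightarrow> Im (f z) > 0"
  using assms by (auto simp: half_plane_self_map_def)

lemma half_plane_self_map_compose:
  assumes "half_plane_self_map f" "half_plane_self_map g"
  shows "half_plane_self_map (\<lambda>z. g (f z))"
  using assms holomorphic_on_compose_gen[of f upper_half_plane g upper_half_plane]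
  by (auto simp: half_plane_self_map_def o_def)

lemma half_plane_self_map_funpow:
  assumes "half_plane_self_map f"
  shows "half_plane_self_map (f ^^ n)"
proof (induction n)
  case 0
  show ?case by (auto simp: half_plane_self_map_def id_def)
next
  case (Suc n)
  show ?case using half_plane_self_map_compose[OF Suc assms] by (simp add: o_def)
qed

text \<open>Reduces every comparison of \<open>cmod (a - b)\<close> with
  \<open>cmod (a - cnj b)\<close> to signs of imaginary parts; the two forms of the Schwarz-Pick
  inequality below differ exactly by this identity.\<close>

lemma norm_diff_cnj_square:
  "(cmod (a - cnj b))\<^sup>2 = (cmod (a - b))\<^sup>2 + 4 * Im a * Im b"
  unfolding cmod_power2 by (simp add: power2_eq_square algebra_simps)

text \<open>The Schwarz lemma for \<open>f\<close> read in the Cayley coordinates centred at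
  \<open>b\<close> and \<open>f b\<close>, with denominators cleared.\<close>

lemma schwarz_pick_quotient:
  assumes f: "half_plane_self_map f" and z: "Im z > 0" and b: "Im b > 0"
  shows "cmod (f z - f b) * cmod (z - cnj b) \<le> cmod (z - b) * cmod (f z - cnj (f b))"
proof -
  \<comment> \<open>\<open>\<psi>\<close> inverts the Cayley coordinate
    \<open>(z - b) / (z - cnj b)\<close>, so it carries the disc into the half-plane and 0 to
    \<open>b\<close>.\<close>
  define \<psi> where "\<psi> u = (b - cnj b * u) / (1 - u)" for u
  define g where "g u = (f (\<psi> u) - f b) / (f (\<psi> u) - cnj (f b))" for u
  have Im\<psi>: "Im (\<psi> u) > 0" if "cmod u < 1" for u
  proof -
    have "u \<noteq> 1" using that by auto
    have "Re u ^ 2 + Im u ^ 2 < 1"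
      using that by (metis cmod_power2 norm_ge_zero power_less_one_iff pos2 zero_less_numeral)
    then have "0 < Im b * (1 - (Re u ^ 2 + Im u ^ 2))" using b by simp
    also have "\<dots> = Im ((b - cnj b * u) * cnj (1 - u))"
      by (simp add: power2_eq_square algebra_simps)
    also have "(b - cnj b * u) * cnj (1 - u) = \<psi> u * of_real ((cmod (1 - u))\<^sup>2)"
      unfolding \<psi>_def using \<open>u \<noteq> 1\<close> by (simp add: complex_norm_square del: of_real_power)
    finally show ?thesis by (simp add: zero_less_mult_iff)
  qed
  have den: "w - cnj (f b) \<noteq> 0" if "Im w > 0" for w
  proof
    assume "w - cnj (f b) = 0"
    then have "Im w = - Im (f b)" by (simp add: complex_eq_iff)
    then show False using that half_plane_self_mapD(2)[OF f b] by simp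
  qed
  have "g holomorphic_on ball 0 1"
  proof -
    have "\<psi> holomorphic_on ball 0 1" unfolding \<psi>_def by (intro holomorphic_intros) auto
    moreover have "\<psi> ` ball 0 1 \<subseteq> upper_half_plane" using Im\<psi> by auto
    ultimately have "(\<lambda>u. f (\<psi> u)) holomorphic_on ball 0 1"
      using holomorphic_on_compose_gen[OF _ half_plane_self_mapD(1)[OF f]] by (auto simp: o_def)
    then show ?thesis unfolding g_def
      using den half_plane_self_mapD(2)[OF f] Im\<psi> by (intro holomorphic_intros) auto
  qed
  moreover have "g 0 = 0" by (simp add: g_def \<psi>_def)
  moreover have "cmod (g u) < 1" if "cmod u < 1" for u
  proof -
    have p: "Im (f (\<psi> u)) > 0" using half_plane_self_mapD(2)[OF f] Im\<psi>[OF that] by blast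
    have "(cmod (f (\<psi> u) - f b))\<^sup>2 < (cmod (f (\<psi> u) - cnj (f b)))\<^sup>2"
      using norm_diff_cnj_square[of "f (\<psi> u)" "f b"] p half_plane_self_mapD(2)[OF f b] by simp
    then have "cmod (f (\<psi> u) - f b) < cmod (f (\<psi> u) - cnj (f b))"
      by (rule power2_less_imp_less) simp
    then show ?thesis using den[OF p] by (simp add: g_def norm_divide)
  qed
  ultimately have S: "cmod (g u) \<le> cmod u" if "cmod u < 1" for u
    using Schwarz_Lemma(1)[of g u] that by blast
  define u where "u = (z - b) / (z - cnj b)"
  have zb: "z - cnj b \<noteq> 0" using z b by (auto simp: complex_eq_iff)
  have "(cmod (z - b))\<^sup>2 < (cmod (z - cnj b))\<^sup>2"
    using norm_diff_cnj_square[of z b] z b by simp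
  then have "cmod (z - b) < cmod (z - cnj b)" by (rule power2_less_imp_less) simp
  then have u1: "cmod u < 1" using zb by (simp add: u_def norm_divide)
  have bb: "b - cnj b \<noteq> 0" using b by (auto simp: complex_eq_iff)
  have "1 - u = (b - cnj b) / (z - cnj b)" unfolding u_def using zb by (simp add: field_simps)
  moreover have "b - cnj b * u = z * (b - cnj b) / (z - cnj b)"
    unfolding u_def using zb by (simp add: field_simps)
  ultimately have "\<psi> u = z" unfolding \<psi>_def using zb bb by simp
  then have "cmod (f z - f b) / cmod (f z - cnj (f b)) \<le> cmod (z - b) / cmod (z - cnj b)"
    using S[OF u1] by (simp add: g_def u_def norm_divide)
  then show ?thesis
    using zb den[OF half_plane_self_mapD(2)[OF f z]] by (simp add: divide_simps mult.commute)
qed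

lemma schwarz_pick:
  assumes f: "half_plane_self_map f" and z: "Im z > 0" and b: "Im b > 0"
  shows "(cmod (f z - f b))\<^sup>2 * (Im z * Im b) \<le> (cmod (z - b))\<^sup>2 * (Im (f z) * Im (f b))"
    and "(cmod (f z - cnj (f b)))\<^sup>2 * (Im z * Im b) \<le> (cmod (z - cnj b))\<^sup>2 * (Im (f z) * Im (f b))"
proof -
  have "(cmod (f z - f b) * cmod (z - cnj b))\<^sup>2 \<le> (cmod (z - b) * cmod (f z - cnj (f b)))\<^sup>2"
    by (intro power_mono schwarz_pick_quotient assms) simp
  then show *: "(cmod (f z - f b))\<^sup>2 * (Im z * Im b) \<le> (cmod (z - b))\<^sup>2 * (Im (f z) * Im (f b))"
    by (simp add: power_mult_distrib norm_diff_cnj_square algebra_simps)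
  then show "(cmod (f z - cnj (f b)))\<^sup>2 * (Im z * Im b) \<le> (cmod (z - cnj b))\<^sup>2 * (Im (f z) * Im (f b))"
    by (simp add: norm_diff_cnj_square algebra_simps)
qed

text \<open>Keeping only \<open>Im (f \<i>)\<close> from the left side of Schwarz-Pick at
  \<open>\<i>\<close> leaves a bound linear in \<open>Im z\<close>. Divided by the height, it
  becomes the positive lower bound for boundary derivatives.\<close>

lemma harnack_half_plane:
  assumes f: "half_plane_self_map f" and z: "Im z > 0"
  shows "Im z * Im (f \<i>) / (cmod (z + \<i>))\<^sup>2 \<le> Im (f z)"
proof -
  have i: "Im (f \<i>) > 0" "Im (f z) > 0" using half_plane_self_mapD(2)[OF f] z by auto
  have "z + \<i> \<noteq> 0" using z by (auto simp: complex_eq_iff)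
  have "(Im (f \<i>))\<^sup>2 \<le> (Im (f z - cnj (f \<i>)))\<^sup>2" using i by (intro power_mono) auto
  also have "\<dots> \<le> (cmod (f z - cnj (f \<i>)))\<^sup>2"
    by (intro abs_le_square_iff[THEN iffD1]) (use abs_Im_le_cmod[of "f z - cnj (f \<i>)"] in simp)
  finally have "(Im (f \<i>))\<^sup>2 * Im z \<le> (cmod (f z - cnj (f \<i>)))\<^sup>2 * (Im z * Im \<i>)"
    using z by (simp add: mult_right_mono)
  also have "\<dots> \<le> (cmod (z + \<i>))\<^sup>2 * (Im (f z) * Im (f \<i>))"
    using schwarz_pick(2)[OF f z, of \<i>] by simp
  finally have "Im (f \<i>) * (Im (f \<i>) * Im z) \<le> Im (f \<i>) * ((cmod (z + \<i>))\<^sup>2 * Im (f z))"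
    by (simp add: power2_eq_square algebra_simps)
  then have "Im (f \<i>) * Im z \<le> (cmod (z + \<i>))\<^sup>2 * Im (f z)"
    using i by (simp add: mult_le_cancel_left_pos)
  then show ?thesis using \<open>z + \<i> \<noteq> 0\<close> by (simp add: divide_simps mult.commute)
qed

text \<open>The filter \<open>vertical_filter x\<close> collects the approach regions at the real point \<open>x\<close> that are
  hyperbolically asymptotic to the vertical line over \<open>x\<close>.\<close>

definition vertical_region :: "real \<Rightarrow> real \<Rightarrow> complex set" where
  "vertical_region x \<delta> = {z. 0 < Im z \<and> Im z < \<delta> \<and> \<bar>Re z - x\<bar> \<le> \<delta> * Im z}"

definition vertical_filter :: "real \<Rightarrow> complex filter" where
  "vertical_filter x = (INF \<delta>\<in>{0<..}. principal (vertical_region x \<delta>))"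

lemma eventually_vertical_filter:
  "eventually P (vertical_filter x) \<longleftrightarrow> (\<exists>\<delta>>0. \<forall>z\<in>vertical_region x \<delta>. P z)"
  unfolding vertical_filter_def
proof (subst eventually_INF_base)
  fix a b :: real assume "a \<in> {0<..}" "b \<in> {0<..}"
  then have "principal (vertical_region x (min a b)) \<le>
      inf (principal (vertical_region x a)) (principal (vertical_region x b))"
    by (auto simp: vertical_region_def intro: order.trans[OF _ mult_right_mono])
  then show "\<exists>y\<in>{0<..}. principal (vertical_region x y) \<le>
      inf (principal (vertical_region x a)) (principal (vertical_region x b))"
    using \<open>a \<in> {0<..}\<close> \<open>b \<in> {0<..}\<close> by (intro bexI[of _ "min a b"]) auto
qed (auto simp: eventually_principal intro: zero_less_one)

lemma eventually_vertical_filterI: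
  assumes "\<delta> > 0" "\<And>z. z \<in> vertical_region x \<delta> \<Longrightarrow> P z"
  shows "eventually P (vertical_filter x)"
  using assms by (auto simp: eventually_vertical_filter)

lemma filterlim_vertical_line: "filterlim (\<lambda>t. Complex x t) (vertical_filter x) (at_right 0)"
  unfolding filterlim_iff
proof safe
  fix P assume "eventually P (vertical_filter x)"
  then obtain \<delta> where \<delta>: "\<delta> > 0" "\<And>z. z \<in> vertical_region x \<delta> \<Longrightarrow> P z"
    by (auto simp: eventually_vertical_filter)
  show "eventually (\<lambda>t. P (Complex x t)) (at_right 0)"
    unfolding eventually_at_right_field
    using \<delta> by (intro exI[of _ \<delta>]) (auto simp: vertical_region_def)
qed

lemma vertical_filter_neq_bot [simp]: "vertical_filter x \<noteq> bot"
proof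
  assume "vertical_filter x = bot"
  then have "eventually (\<lambda>t. False) (at_right (0::real))"
    using filterlim_vertical_line[of x, unfolded filterlim_iff, rule_format, of "\<lambda>_. False"] by simp
  then show False by simp
qed

lemma eventually_vertical_Im_pos: "eventually (\<lambda>z. Im z > 0) (vertical_filter x)"
  by (rule eventually_vertical_filterI[of 1]) (auto simp: vertical_region_def)

lemma filterlim_vertical_filter_Im: "filterlim Im (at_right 0) (vertical_filter x)"
proof -
  have "(Im \<longlongrightarrow> 0) (vertical_filter x)"
  proof (rule tendstoI)
    fix e :: real assume "e > 0"
    then show "eventually (\<lambda>z. dist (Im z) 0 < e) (vertical_filter x)"
      by (intro eventually_vertical_filterI[of e]) (auto simp: vertical_region_def)
  qed
  then show ?thesis
    unfolding filterlim_at using eventually_vertical_Im_pos[of x]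
    by (auto elim: eventually_mono)
qed

lemma vertical_region_dist:
  assumes "z \<in> vertical_region x \<delta>"
  shows "cmod (z - complex_of_real x) \<le> (1 + \<delta>) * Im z"
  using assms cmod_le[of "z - complex_of_real x"] by (auto simp: vertical_region_def algebra_simps)

lemma tendsto_vertical_filter: "((\<lambda>z. z) \<longlongrightarrow> complex_of_real x) (vertical_filter x)"
proof (rule tendstoI)
  fix e :: real assume e: "e > 0"
  show "eventually (\<lambda>z. dist z (complex_of_real x) < e) (vertical_filter x)"
  proof (rule eventually_vertical_filterI[of "min 1 (e/2)"])
    fix z assume z: "z \<in> vertical_region x (min 1 (e/2))"
    have "dist z (complex_of_real x) \<le> (1 + min 1 (e/2)) * Im z"
      using vertical_region_dist[OF z] by (simp add: dist_norm)
    also have "\<dots> \<le> 2 * Im z" using z by (intro mult_right_mono) (auto simp: vertical_region_def)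
    also have "\<dots> < e" using z by (auto simp: vertical_region_def)
    finally show "dist z (complex_of_real x) < e" .
  qed (use e in auto)
qed

text \<open>The point \<open>w\<close> has hyperbolic distance of order \<delta> from the point
  above \<open>x\<close> at the same height, and \<open>f\<close> does not increase that distance.
  The Euclidean error is therefore small relative to the height of the image, which is what lets
  limits along a line spread to a whole region.\<close>

lemma vertical_close:
  assumes f: "half_plane_self_map f" and \<delta>: "\<delta> > 0" "\<delta> \<le> 1/2" and w: "w \<in> vertical_region x \<delta>"
  shows "cmod (f w - f (Complex x (Im w))) \<le> 2 * \<delta> * Im (f (Complex x (Im w)))"
proof (rule ccontr)
  define z where "z = Complex x (Im w)"
  define d where "d = cmod (f w - f z)"
  define a where "a = Im (f z)"
  assume "\<not> cmod (f w - f (Complex x (Im w))) \<le> 2 * \<delta> * Im (f (Complex x (Im w)))"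
  then have big: "2 * \<delta> * a < d" by (simp add: z_def d_def a_def)
  have y: "Im w > 0" "Im z = Im w" using w by (auto simp: vertical_region_def z_def)
  have a: "a > 0" using half_plane_self_mapD(2)[OF f, of z] y by (simp add: a_def)
  then have d: "d > 0" using big \<delta> by (smt (verit) mult_pos_pos)
  have "cmod (w - z) \<le> \<delta> * Im w"
    using w by (auto simp: vertical_region_def z_def cmod_def)
  then have "(cmod (w - z))\<^sup>2 \<le> (\<delta> * Im w)\<^sup>2" by (intro power_mono) auto
  moreover have "d\<^sup>2 * (Im w * Im w) \<le> (cmod (w - z))\<^sup>2 * (Im (f w) * a)"
    using schwarz_pick(1)[OF f, of w z] y by (simp add: d_def a_def)
  moreover have fw: "0 < Im (f w)" "Im (f w) \<le> a + d"
    using half_plane_self_mapD(2)[OF f, of w] y abs_Im_le_cmod[of "f w - f z"]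
    by (auto simp: d_def a_def)
  ultimately have "d\<^sup>2 * (Im w * Im w) \<le> (\<delta> * Im w)\<^sup>2 * (Im (f w) * a)"
    using a by (smt (verit) mult_right_mono mult_pos_pos)
  then have "d\<^sup>2 \<le> \<delta>\<^sup>2 * (Im (f w) * a)"
    using y by (simp add: power2_eq_square algebra_simps)
  also have "\<dots> \<le> \<delta>\<^sup>2 * ((a + d) * a)"
    using fw a by (intro mult_left_mono mult_right_mono) auto
  also have "\<dots> = (\<delta> * a) * (\<delta> * a) + \<delta> * (\<delta> * a) * d"
    by (simp add: power2_eq_square algebra_simps)
  \<comment> \<open>Since \<open>2 * \<delta> * a < d\<close> and \<open>\<delta> \<le> 1/2\<close>,
    each summand is at most a quarter of the square of \<open>d\<close>.\<close>
  also have "\<dots> \<le> (d / 2) * (d / 2) + (1/2) * (d / 2) * d"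
    using big \<delta> a d by (intro add_mono mult_mono) auto
  also have "\<dots> < d\<^sup>2" using d by (simp add: power2_eq_square)
  finally show False by simp
qed

lemma tendsto_vertical_of_radial:
  assumes f: "half_plane_self_map f" and lim: "((\<lambda>t. f (Complex x t)) \<longlongrightarrow> L) (at_right 0)"
  shows "(f \<longlongrightarrow> L) (vertical_filter x)"
proof -
  have l: "((\<lambda>w. f (Complex x (Im w))) \<longlongrightarrow> L) (vertical_filter x)"
    using filterlim_compose[OF lim filterlim_vertical_filter_Im] .
  have "((\<lambda>w. f w - f (Complex x (Im w))) \<longlongrightarrow> 0) (vertical_filter x)"
  proof (rule tendstoI)
    fix e :: real assume e: "e > 0"
    define C where "C = cmod L + 1"
    have C: "C > 0" by (simp add: C_def add_nonneg_pos)
    have "eventually (\<lambda>w. cmod (f (Complex x (Im w))) < C) (vertical_filter x)"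
      using order_tendstoD(2)[OF tendsto_norm[OF l], of C] by (simp add: C_def)
    moreover have "eventually (\<lambda>w. w \<in> vertical_region x (min (1/2) (e / (4 * C)))) (vertical_filter x)"
      using e C by (intro eventually_vertical_filterI) auto
    ultimately show "eventually (\<lambda>w. dist (f w - f (Complex x (Im w))) 0 < e) (vertical_filter x)"
    proof eventually_elim
      case (elim w)
      define \<delta> where "\<delta> = min (1/2) (e / (4 * C))"
      have \<delta>: "\<delta> > 0" "\<delta> \<le> 1/2" "\<delta> \<le> e / (4 * C)" using e C by (auto simp: \<delta>_def)
      have "cmod (f w - f (Complex x (Im w))) \<le> 2 * \<delta> * Im (f (Complex x (Im w)))"
        using vertical_close[OF f \<delta>(1,2)] elim(2) by (simp add: \<delta>_def)
      also have "\<dots> \<le> 2 * \<delta> * C"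
        using \<delta> elim(1) abs_Im_le_cmod[of "f (Complex x (Im w))"] by (intro mult_left_mono) linarith+
      also have "\<dots> \<le> 2 * (e / (4 * C)) * C" using \<delta> C by (intro mult_right_mono) auto
      also have "\<dots> < e" using e C by simp
      finally show ?case by simp
    qed
  qed
  from tendsto_add[OF this l] show ?thesis by simp
qed

lemma at_infinity_vertical_of_radial:
  assumes f: "half_plane_self_map f" and lim: "filterlim (\<lambda>t. f (Complex x t)) at_infinity (at_right 0)"
  shows "filterlim f at_infinity (vertical_filter x)"
proof -
  have l: "filterlim (\<lambda>w. f (Complex x (Im w))) at_infinity (vertical_filter x)"
    using filterlim_compose[OF lim filterlim_vertical_filter_Im] .
  have ev: "eventually (\<lambda>w. w \<in> vertical_region x (1/4)) (vertical_filter x)"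
    by (intro eventually_vertical_filterI) auto
  show ?thesis
    unfolding filterlim_at_infinity[OF order.refl]
  proof safe
    fix r :: real assume "r > 0"
    then have "eventually (\<lambda>w. 2 * r \<le> cmod (f (Complex x (Im w)))) (vertical_filter x)"
      using l unfolding filterlim_at_infinity[OF order.refl] by auto
    with ev show "eventually (\<lambda>w. r \<le> cmod (f w)) (vertical_filter x)"
    proof eventually_elim
      case (elim w)
      define v where "v = f (Complex x (Im w))"
      have "cmod (f w - v) \<le> 2 * (1/4) * Im v"
        using vertical_close[OF f _ _ elim(1)] by (simp add: v_def)
      moreover have "Im v \<le> cmod v" using abs_Im_le_cmod[of v] by linarith
      moreover have "cmod v \<le> cmod (f w) + cmod (f w - v)"
        using norm_triangle_ineq4[of "f w" "f w - v"] by simp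
      ultimately show ?case using elim(2) by (simp add: v_def)
    qed
  qed
qed

section \<open>Regular boundary points\<close>

text \<open>Symmetry under conjugation encodes that the extension is real on the real axis without
  naming its boundary values.\<close>

definition regular_at :: "(complex \<Rightarrow> complex) \<Rightarrow> real \<Rightarrow> bool" where
  "regular_at f x \<longleftrightarrow> (\<exists>e>0. \<exists>\<phi>. \<phi> holomorphic_on ball (of_real x) e \<and>
     (\<forall>z\<in>ball (of_real x) e. \<phi> (cnj z) = cnj (\<phi> z)) \<and>
     (\<forall>z\<in>ball (of_real x) e. Im z > 0 \<longrightarrow> \<phi> z = f z))"

definition boundary_value :: "(complex \<Rightarrow> complex) \<Rightarrow> real \<Rightarrow> real" where
  "boundary_value f x = Re (Lim (at_right 0) (\<lambda>t. f (Complex x t)))"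

lemma boundary_value_eqI:
  assumes "(f \<longlongrightarrow> complex_of_real y) (vertical_filter x)"
  shows "boundary_value f x = y"
proof -
  have "((\<lambda>t. f (Complex x t)) \<longlongrightarrow> complex_of_real y) (at_right 0)"
    using filterlim_compose[OF assms filterlim_vertical_line] .
  then show ?thesis by (simp add: boundary_value_def tendsto_Lim)
qed

lemma cnj_in_real_ball: "cnj z \<in> ball (complex_of_real x) e \<longleftrightarrow> z \<in> ball (complex_of_real x) e"
  by (simp add: dist_norm) (metis complex_cnj_complex_of_real complex_cnj_diff complex_mod_cnj)

text \<open>Schwarz reflection: a continuous extension that is real on the axis is already an
  analytic one.\<close>

lemma regular_atI:
  assumes e: "e > 0" and hol: "f holomorphic_on upper_half_plane"
    and cont: "continuous_on (ball (of_real x) e \<inter> {z. 0 \<le> Im z}) g"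
    and agree: "\<And>z. z \<in> ball (of_real x) e \<Longrightarrow> Im z > 0 \<Longrightarrow> g z = f z"
    and real: "\<And>y. \<bar>y - x\<bar> < e \<Longrightarrow> Im (g (of_real y)) = 0"
  shows "regular_at f x"
proof -
  let ?S = "ball (complex_of_real x) e"
  let ?\<phi> = "\<lambda>z. if 0 \<le> Im z then g z else cnj (g (cnj z))"
  have real': "g z \<in> \<real>" if "z \<in> ?S" "z \<in> \<real>" for z
  proof -
    from that obtain y where y: "z = of_real y" by (auto elim: Reals_cases)
    then have "\<bar>y - x\<bar> < e"
      using that(1) by (simp add: dist_norm abs_minus_commute flip: of_real_diff)
    then show ?thesis using real y by (simp add: complex_is_Real_iff)
  qed
  have "?\<phi> holomorphic_on ?S"
  proof (rule Schwarz_reflection)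
    show "cnj ` ?S \<subseteq> ?S" using cnj_in_real_ball[of _ x e] by blast
    have "f holomorphic_on ?S \<inter> {z. 0 < Im z}" using hol by (rule holomorphic_on_subset) auto
    then show "g holomorphic_on ?S \<inter> {z. 0 < Im z}"
      by (rule holomorphic_transform) (use agree in auto)
  qed (use cont real' in auto)
  moreover have "?\<phi> (cnj z) = cnj (?\<phi> z)" if "z \<in> ?S" for z
  proof (cases "Im z = 0")
    case True
    then have "cnj z = z" "z \<in> \<real>" by (simp_all add: complex_eq_iff complex_is_Real_iff)
    then show ?thesis using real'[OF that] True by (simp add: Reals_cnj_iff)
  qed auto
  ultimately show ?thesis
    unfolding regular_at_def using e agree by (intro exI[of _ e] conjI exI[of _ ?\<phi>]) auto
qed

lemma tendsto_vertical_continuous: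
  assumes "e > 0" "\<phi> holomorphic_on ball (of_real x) e"
    and "\<And>z. z \<in> ball (of_real x) e \<Longrightarrow> Im z > 0 \<Longrightarrow> \<phi> z = f z"
  shows "(f \<longlongrightarrow> \<phi> (of_real x)) (vertical_filter x)" and "\<forall>\<^sub>F z in vertical_filter x. \<phi> z = f z"
proof -
  have ev: "\<forall>\<^sub>F z in vertical_filter x. z \<in> ball (of_real x) e"
    using tendstoD[OF tendsto_vertical_filter[of x] assms(1)] by (simp add: dist_commute)
  then show ev': "\<forall>\<^sub>F z in vertical_filter x. \<phi> z = f z"
    using eventually_vertical_Im_pos[of x] by eventually_elim (use assms(3) in auto)
  have "isCont \<phi> (of_real x)"
    using assms(1,2) holomorphic_on_imp_continuous_on continuous_on_eq_continuous_at
    by (metis centre_in_ball open_ball)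
  then have "(\<phi> \<longlongrightarrow> \<phi> (of_real x)) (vertical_filter x)"
    using isCont_tendsto_compose tendsto_vertical_filter by blast
  then show "(f \<longlongrightarrow> \<phi> (of_real x)) (vertical_filter x)"
    using ev' by (rule Lim_transform_eventually)
qed

text \<open>One extension \<open>\<phi>\<close> serves all real points of the disc at once. This
  makes regularity an open condition and turns \<open>boundary_value f\<close> into the restriction
  of a holomorphic function, so that it can be differentiated.\<close>

lemma regular_atE:
  assumes "regular_at f x"
  obtains e \<phi> where "e > 0" "\<phi> holomorphic_on ball (of_real x) e"
    "\<And>z. z \<in> ball (of_real x) e \<Longrightarrow> \<phi> (cnj z) = cnj (\<phi> z)"
    "\<And>z. z \<in> ball (of_real x) e \<Longrightarrow> Im z > 0 \<Longrightarrow> \<phi> z = f z"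
    "\<And>y. \<bar>y - x\<bar> < e \<Longrightarrow> regular_at f y"
    "\<And>y. \<bar>y - x\<bar> < e \<Longrightarrow> \<phi> (of_real y) = of_real (boundary_value f y)"
proof -
  obtain e \<phi> where *: "e > 0" "\<phi> holomorphic_on ball (of_real x) e"
    "\<And>z. z \<in> ball (of_real x) e \<Longrightarrow> \<phi> (cnj z) = cnj (\<phi> z)"
    "\<And>z. z \<in> ball (of_real x) e \<Longrightarrow> Im z > 0 \<Longrightarrow> \<phi> z = f z"
    using assms unfolding regular_at_def by blast
  have sub: "ball (complex_of_real y) (e - \<bar>y - x\<bar>) \<subseteq> ball (of_real x) e" for y
  proof
    fix z assume "z \<in> ball (complex_of_real y) (e - \<bar>y - x\<bar>)"
    then have "dist z (of_real y) < e - \<bar>y - x\<bar>" by (simp add: dist_commute)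
    moreover have "dist (complex_of_real y) (of_real x) = \<bar>y - x\<bar>"
      by (simp add: dist_norm flip: of_real_diff)
    ultimately show "z \<in> ball (of_real x) e"
      using dist_triangle[of z "of_real x" "of_real y"] by (simp add: dist_commute)
  qed
  have reg: "regular_at f y" if "\<bar>y - x\<bar> < e" for y
    unfolding regular_at_def using that sub[of y] *
    by (intro exI[of _ "e - \<bar>y - x\<bar>"] conjI exI[of _ \<phi>]) (auto intro: holomorphic_on_subset)
  have bv: "\<phi> (of_real y) = of_real (boundary_value f y)" if y: "\<bar>y - x\<bar> < e" for y
  proof -
    have yb: "complex_of_real y \<in> ball (of_real x) e"
      using y by (simp add: dist_norm abs_minus_commute flip: of_real_diff)
    have lim: "(f \<longlongrightarrow> \<phi> (of_real y)) (vertical_filter y)"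
      using y sub[of y] * by (intro tendsto_vertical_continuous(1)[of "e - \<bar>y - x\<bar>"])
        (auto intro: holomorphic_on_subset)
    have "\<phi> (of_real y) \<in> \<real>" using *(3)[OF yb] by (simp add: Reals_cnj_iff)
    then obtain r where r: "\<phi> (of_real y) = of_real r" by (auto elim: Reals_cases)
    with lim have "boundary_value f y = r" by (intro boundary_value_eqI) simp
    with r show ?thesis by simp
  qed
  show thesis using that[OF * reg bv] .
qed

lemma open_regular_at: "open {x. regular_at f x}"
  unfolding open_dist
proof safe
  fix x assume "regular_at f x"
  then show "\<exists>e>0. \<forall>y. dist y x < e \<longrightarrow> y \<in> {x. regular_at f x}"
    by (rule regular_atE) (auto simp: dist_real_def)
qed

lemma tendsto_boundary_value:
  assumes "regular_at f x"
  shows "(f \<longlongrightarrow> of_real (boundary_value f x)) (vertical_filter x)"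
  using assms
proof (rule regular_atE)
  fix e \<phi> assume *: "e > 0" "\<phi> holomorphic_on ball (of_real x) e"
    "\<And>z. z \<in> ball (of_real x) e \<Longrightarrow> Im z > 0 \<Longrightarrow> \<phi> z = f z"
    "\<And>y. \<bar>y - x\<bar> < e \<Longrightarrow> \<phi> (of_real y) = of_real (boundary_value f y)"
  show ?thesis using tendsto_vertical_continuous(1)[OF *(1-3)] *(1) *(4)[of x] by simp
qed

text \<open>Near \<open>x\<close> the map is a dilation by \<open>d\<close> up to an error small
  against the distance to \<open>x\<close>, hence small against the height inside a vertical region.
  Ratios of horizontal offset to height are thus asymptotically preserved.\<close>

lemma filterlim_vertical_conformal:
  assumes der: "(\<phi> has_field_derivative of_real d) (at (of_real x))" and d: "d > 0"
    and y: "\<phi> (of_real x) = of_real y"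
  shows "filterlim \<phi> (vertical_filter y) (vertical_filter x)"
  unfolding filterlim_iff
proof safe
  fix P assume "eventually P (vertical_filter y)"
  then obtain \<delta> where \<delta>: "\<delta> > 0" "\<And>z. z \<in> vertical_region y \<delta> \<Longrightarrow> P z"
    by (auto simp: eventually_vertical_filter)
  \<comment> \<open>The bound \<open>d / 4\<close> keeps the height of the image above half of its
    linear part; the bound \<open>\<delta> * d / 8\<close> leaves the horizontal error half of the
    permitted offset, the other half going to the offset of \<open>z\<close> itself.\<close>
  define \<eta> where "\<eta> = min (d / 4) (\<delta> * d / 8)"
  have \<eta>: "\<eta> > 0" "\<eta> \<le> d / 4" "\<eta> \<le> \<delta> * d / 8" using \<delta> d by (auto simp: \<eta>_def)
  have "(\<phi> has_derivative (\<lambda>h. of_real d * h)) (at (of_real x))"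
    using der by (simp add: has_field_derivative_def)
  then obtain s where s: "s > 0" "\<And>z. cmod (z - of_real x) < s \<Longrightarrow>
      cmod (\<phi> z - of_real y - of_real d * (z - of_real x)) \<le> \<eta> * cmod (z - of_real x)"
    using \<eta>(1) unfolding has_derivative_at_alt by (metis y)
  define \<kappa> where "\<kappa> = min (min 1 (s / 2)) (min (\<delta> / 4) (\<delta> / (2 * d)))"
  have \<kappa>: "\<kappa> > 0" "\<kappa> \<le> 1" "\<kappa> \<le> s / 2" "\<kappa> \<le> \<delta> / 4" "\<kappa> \<le> \<delta> / (2 * d)"
    using s(1) \<delta> d by (auto simp: \<kappa>_def)
  show "eventually (\<lambda>z. P (\<phi> z)) (vertical_filter x)"
  proof (rule eventually_vertical_filterI[OF \<kappa>(1)])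
    fix z assume z: "z \<in> vertical_region x \<kappa>"
    define t where "t = Im z"
    have t: "0 < t" "t < \<kappa>" "\<bar>Re z - x\<bar> \<le> \<kappa> * t" using z by (auto simp: vertical_region_def t_def)
    have "cmod (z - of_real x) \<le> (1 + \<kappa>) * t" using vertical_region_dist[OF z] by (simp add: t_def)
    also have "\<dots> \<le> 2 * t" using t \<kappa> by (intro mult_right_mono) auto
    finally have zt: "cmod (z - of_real x) \<le> 2 * t" .
    define E where "E = \<phi> z - of_real y - of_real d * (z - of_real x)"
    have "cmod E \<le> \<eta> * cmod (z - of_real x)"
      unfolding E_def using zt t \<kappa> by (intro s(2)) auto
    also have "\<dots> \<le> \<eta> * (2 * t)" using zt \<eta> by (intro mult_left_mono) auto
    finally have E: "cmod E \<le> 2 * \<eta> * t" by simp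
    have "Im (\<phi> z) = d * t + Im E" "Re (\<phi> z) - y = d * (Re z - x) + Re E"
      by (simp_all add: E_def t_def algebra_simps)
    moreover have "\<bar>Im E\<bar> \<le> 2 * \<eta> * t" "\<bar>Re E\<bar> \<le> 2 * \<eta> * t"
      using E abs_Im_le_cmod[of E] abs_Re_le_cmod[of E] by linarith+
    moreover have "2 * \<eta> * t \<le> d * t / 2" using mult_right_mono[OF \<eta>(2), of t] t by simp
    moreover have "0 < d * t" using d t by simp
    moreover have "\<bar>d * (Re z - x)\<bar> = d * \<bar>Re z - x\<bar>" using d by (simp add: abs_mult)
    ultimately have im: "d / 2 * t \<le> Im (\<phi> z)" "Im (\<phi> z) \<le> 2 * d * t"
      and re: "\<bar>Re (\<phi> z) - y\<bar> \<le> d * \<bar>Re z - x\<bar> + 2 * \<eta> * t"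
      by linarith+
    have "2 * d * t < 2 * d * (\<delta> / (2 * d))" using t \<kappa> d by (intro mult_strict_left_mono) auto
    then have "Im (\<phi> z) < \<delta>" using im d by simp
    moreover have "0 < Im (\<phi> z)" using im t d by (smt (verit) mult_pos_pos half_gt_zero)
    moreover have "\<bar>Re (\<phi> z) - y\<bar> \<le> \<delta> * Im (\<phi> z)"
    proof -
      have "\<bar>Re z - x\<bar> \<le> \<delta> / 4 * t"
        using t(3) mult_right_mono[OF \<kappa>(4), of t] t(1) by linarith
      then have "d * \<bar>Re z - x\<bar> + 2 * \<eta> * t \<le> d * (\<delta> / 4 * t) + 2 * (\<delta> * d / 8) * t"
        using t \<eta> d by (intro add_mono mult_left_mono mult_right_mono) auto
      also have "\<dots> = \<delta> * (d / 2 * t)" by simp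
      also have "\<dots> \<le> \<delta> * Im (\<phi> z)" using im \<delta> by (intro mult_left_mono) auto
      finally show ?thesis using re by simp
    qed
    ultimately show "P (\<phi> z)" by (intro \<delta>(2)) (auto simp: vertical_region_def)
  qed
qed

text \<open>Differentiating along the axis, where the extension is real, shows that the derivative
  is real. Differentiating along the vertical identifies it as the limit of height ratios, and
  Harnack's inequality bounds these below by a positive number.\<close>

lemma regular_at_deriv:
  assumes f: "half_plane_self_map f" and reg: "regular_at f x"
    and ext: "e > 0" "\<phi> holomorphic_on ball (of_real x) e"
      "\<And>z. z \<in> ball (of_real x) e \<Longrightarrow> Im z > 0 \<Longrightarrow> \<phi> z = f z"
      "\<And>y. \<bar>y - x\<bar> < e \<Longrightarrow> \<phi> (of_real y) = of_real (boundary_value f y)"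
  obtains d where "d > 0" "(boundary_value f has_real_derivative d) (at x)"
    "(\<phi> has_field_derivative of_real d) (at (of_real x))"
    "((\<lambda>t. Im (f (Complex x t)) / t) \<longlongrightarrow> d) (at_right 0)"
    "d \<ge> Im (f \<i>) / (1 + x\<^sup>2)"
proof -
  obtain D where D: "(\<phi> has_field_derivative D) (at (of_real x))"
    using ext(1,2) holomorphic_on_imp_differentiable_at field_differentiable_def
    by (metis centre_in_ball open_ball)
  have "(complex_of_real has_vector_derivative 1) (at x)"
    using has_vector_derivative_of_real[OF DERIV_ident] by simp
  from field_vector_diff_chain_at[OF this D]
  have "((\<lambda>y. \<phi> (of_real y)) has_vector_derivative D) (at x)" by (simp add: o_def)
  then have bv: "((\<lambda>y. complex_of_real (boundary_value f y)) has_vector_derivative D) (at x)"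
    by (rule has_vector_derivative_transform_within_open[where S = "ball x e"])
      (use ext(1,4) in \<open>auto simp: dist_real_def abs_minus_commute\<close>)
  have "((\<lambda>y. Re (complex_of_real (boundary_value f y))) has_vector_derivative Re D) (at x)"
    by (rule bounded_linear.has_vector_derivative[OF bounded_linear_Re bv])
  then have bvd: "(boundary_value f has_real_derivative Re D) (at x)"
    by (simp add: has_real_derivative_iff_has_vector_derivative)
  have "((\<lambda>y. Im (complex_of_real (boundary_value f y))) has_vector_derivative Im D) (at x)"
    by (rule bounded_linear.has_vector_derivative[OF bounded_linear_Im bv])
  then have "((\<lambda>y. 0::real) has_vector_derivative Im D) (at x)" by simp
  then have ImD: "Im D = 0"
    using vector_derivative_unique_at[OF _ has_vector_derivative_const] by blast
  then have Dr: "D = of_real (Re D)" by (simp add: complex_eq_iff)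
  have lim: "((\<lambda>t. Im (f (Complex x t)) / t) \<longlongrightarrow> Re D) (at_right 0)"
  proof -
    have "((\<lambda>k. (\<phi> (of_real x + k) - \<phi> (of_real x)) / k) \<longlongrightarrow> D) (at 0)"
      using D by (simp add: DERIV_def)
    moreover have "filterlim (\<lambda>t. \<i> * complex_of_real t) (at 0) (at_right 0)"
      unfolding filterlim_at
      by (auto intro!: tendsto_eq_intros simp: eventually_at_right_field intro: exI[of _ 1])
    ultimately have "((\<lambda>t. (\<phi> (of_real x + \<i> * complex_of_real t) - \<phi> (of_real x)) / (\<i> * of_real t)) \<longlongrightarrow> D) (at_right 0)"
      by (rule filterlim_compose)
    then have "((\<lambda>t. Re ((\<phi> (of_real x + \<i> * complex_of_real t) - \<phi> (of_real x)) / (\<i> * of_real t))) \<longlongrightarrow> Re D) (at_right 0)"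
      by (rule tendsto_Re)
    then show ?thesis
    proof (rule Lim_transform_eventually)
      show "\<forall>\<^sub>F t in at_right 0. Re ((\<phi> (of_real x + \<i> * complex_of_real t) - \<phi> (of_real x)) / (\<i> * of_real t))
          = Im (f (Complex x t)) / t"
        unfolding eventually_at_right_field
      proof (intro exI[of _ e] conjI allI impI)
        fix t :: real assume t: "t > 0" "t < e"
        have eq: "of_real x + \<i> * complex_of_real t = Complex x t" by (simp add: complex_eq_iff)
        have R: "Re (w / (\<i> * complex_of_real t)) = Im w / t" for w
          by (simp add: Re_divide power2_eq_square)
        have "\<phi> (Complex x t) = f (Complex x t)"
          using t by (intro ext(3)) (auto simp: dist_norm cmod_def)
        then show "Re ((\<phi> (of_real x + \<i> * complex_of_real t) - \<phi> (of_real x)) / (\<i> * of_real t)) = Im (f (Complex x t)) / t"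
          unfolding eq R using ext(1) ext(4)[of x] by simp
      qed (use ext in auto)
    qed
  qed
  have low: "Re D \<ge> Im (f \<i>) / (1 + x\<^sup>2)"
  proof (rule tendsto_le[OF trivial_limit_at_right_real lim])
    show "((\<lambda>t. Im (f \<i>) / (cmod (Complex x t + \<i>))\<^sup>2) \<longlongrightarrow> Im (f \<i>) / (1 + x\<^sup>2)) (at_right 0)"
    proof -
      have "x\<^sup>2 + (0 + 1)\<^sup>2 \<noteq> 0" by (simp add: add_nonneg_eq_0_iff)
      then have "((\<lambda>t. Im (f \<i>) / (x\<^sup>2 + (t + 1)\<^sup>2)) \<longlongrightarrow> Im (f \<i>) / (x\<^sup>2 + (0 + 1)\<^sup>2)) (at_right 0)"
        by (intro tendsto_intros)
      then show ?thesis by (simp add: cmod_power2 add.commute)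
    qed
    show "\<forall>\<^sub>F t in at_right 0. Im (f \<i>) / (cmod (Complex x t + \<i>))\<^sup>2 \<le> Im (f (Complex x t)) / t"
      unfolding eventually_at_right_field
    proof (intro exI[of _ 1] conjI allI impI)
      fix t :: real assume "0 < t"
      then show "Im (f \<i>) / (cmod (Complex x t + \<i>))\<^sup>2 \<le> Im (f (Complex x t)) / t"
        using divide_right_mono[OF harnack_half_plane[OF f, of "Complex x t"], of t] by simp
    qed simp
  qed
  moreover have "0 < Im (f \<i>) / (1 + x\<^sup>2)"
    using half_plane_self_mapD(2)[OF f, of \<i>]
    by (intro divide_pos_pos) (auto simp: add_pos_nonneg)
  ultimately have "Re D > 0" by linarith
  moreover have "(\<phi> has_field_derivative of_real (Re D)) (at (of_real x))"
    by (rule ssubst[OF Dr[symmetric]]) (rule D)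
  ultimately show thesis by (intro that[of "Re D"] bvd lim low)
qed

lemma regular_has_real_derivative:
  assumes f: "half_plane_self_map f" and reg: "regular_at f x"
  obtains d where "d \<ge> Im (f \<i>) / (1 + x\<^sup>2)" "(boundary_value f has_real_derivative d) (at x)"
    "((\<lambda>t. Im (f (Complex x t)) / t) \<longlongrightarrow> d) (at_right 0)"
  using reg
proof (rule regular_atE)
  fix e \<phi> assume *: "e > 0" "\<phi> holomorphic_on ball (of_real x) e"
    "\<And>z. z \<in> ball (of_real x) e \<Longrightarrow> Im z > 0 \<Longrightarrow> \<phi> z = f z"
    "\<And>y. \<bar>y - x\<bar> < e \<Longrightarrow> \<phi> (of_real y) = of_real (boundary_value f y)"
  obtain d where "(boundary_value f has_real_derivative d) (at x)"
    "((\<lambda>t. Im (f (Complex x t)) / t) \<longlongrightarrow> d) (at_right 0)" "d \<ge> Im (f \<i>) / (1 + x\<^sup>2)"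
    by (rule regular_at_deriv[OF f reg *])
  then show thesis by (intro that)
qed

lemma filterlim_vertical_regular:
  assumes f: "half_plane_self_map f" and reg: "regular_at f x"
  shows "filterlim f (vertical_filter (boundary_value f x)) (vertical_filter x)"
  using reg
proof (rule regular_atE)
  fix e \<phi> assume *: "e > 0" "\<phi> holomorphic_on ball (of_real x) e"
    "\<And>z. z \<in> ball (of_real x) e \<Longrightarrow> Im z > 0 \<Longrightarrow> \<phi> z = f z"
    "\<And>y. \<bar>y - x\<bar> < e \<Longrightarrow> \<phi> (of_real y) = of_real (boundary_value f y)"
  obtain d where d: "d > 0" "(\<phi> has_field_derivative of_real d) (at (of_real x))"
    by (rule regular_at_deriv[OF f reg *])
  have "filterlim \<phi> (vertical_filter (boundary_value f x)) (vertical_filter x)"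
    using filterlim_vertical_conformal[OF d(2,1)] *(1) *(4)[of x] by simp
  then show ?thesis
    using filterlim_cong[OF refl refl tendsto_vertical_continuous(2)[OF *(1-3)]] by simp
qed

lemma boundary_value_compose:
  assumes f: "half_plane_self_map f" and "regular_at f x" and "regular_at g (boundary_value f x)"
  shows "boundary_value (\<lambda>z. g (f z)) x = boundary_value g (boundary_value f x)"
  using filterlim_compose[OF tendsto_boundary_value[OF assms(3)] filterlim_vertical_regular[OF assms(1,2)]]
  by (rule boundary_value_eqI)

lemma regular_at_compose:
  assumes f: "half_plane_self_map f" and rf: "regular_at f x" and rg: "regular_at g (boundary_value f x)"
  shows "regular_at (\<lambda>z. g (f z)) x"
  using rf
proof (rule regular_atE)
  fix e \<phi> assume *: "e > 0" "\<phi> holomorphic_on ball (of_real x) e"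
    "\<And>z. z \<in> ball (of_real x) e \<Longrightarrow> \<phi> (cnj z) = cnj (\<phi> z)"
    "\<And>z. z \<in> ball (of_real x) e \<Longrightarrow> Im z > 0 \<Longrightarrow> \<phi> z = f z"
    "\<And>y. \<bar>y - x\<bar> < e \<Longrightarrow> \<phi> (of_real y) = of_real (boundary_value f y)"
  obtain e' \<psi> where **: "e' > 0" "\<psi> holomorphic_on ball (of_real (boundary_value f x)) e'"
    "\<And>z. z \<in> ball (of_real (boundary_value f x)) e' \<Longrightarrow> \<psi> (cnj z) = cnj (\<psi> z)"
    "\<And>z. z \<in> ball (of_real (boundary_value f x)) e' \<Longrightarrow> Im z > 0 \<Longrightarrow> \<psi> z = g z"
    using rg unfolding regular_at_def by blast
  have bv: "\<phi> (of_real x) = of_real (boundary_value f x)" using *(1) *(5)[of x] by simp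
  have "isCont \<phi> (of_real x)"
    using *(1,2) holomorphic_on_imp_continuous_on continuous_on_eq_continuous_at
    by (metis centre_in_ball open_ball)
  then obtain s where s: "s > 0" "\<And>z. dist z (of_real x) < s \<Longrightarrow> dist (\<phi> z) (\<phi> (of_real x)) < e'"
    using **(1) unfolding continuous_at_eps_delta by blast
  define r where "r = min e s"
  have r: "r > 0" "ball (complex_of_real x) r \<subseteq> ball (of_real x) e"
    "\<phi> ` ball (of_real x) r \<subseteq> ball (of_real (boundary_value f x)) e'"
    using s *(1) bv by (auto simp: r_def dist_commute)
  show ?thesis
    unfolding regular_at_def
  proof (intro exI[of _ r] conjI exI[of _ "\<lambda>z. \<psi> (\<phi> z)"] ballI impI)
    have "\<psi> \<circ> \<phi> holomorphic_on ball (of_real x) r"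
      using r * ** by (intro holomorphic_on_compose_gen[OF _ **(2)] holomorphic_on_subset[OF *(2)]) auto
    then show "(\<lambda>z. \<psi> (\<phi> z)) holomorphic_on ball (of_real x) r" by (simp add: o_def)
    fix z assume z: "z \<in> ball (complex_of_real x) r"
    then have "z \<in> ball (of_real x) e" "\<phi> z \<in> ball (of_real (boundary_value f x)) e'" using r by blast+
    then show "\<psi> (\<phi> (cnj z)) = cnj (\<psi> (\<phi> z))"
      and "Im z > 0 \<Longrightarrow> \<psi> (\<phi> z) = g (f z)"
      using *(3,4)[of z] **(3,4)[of "\<phi> z"] half_plane_self_mapD(2)[OF f, of z] by auto
  qed (use r in auto)
qed

text \<open>A nonzero derivative gives a holomorphic inverse; symmetry under conjugation makes it
  respect the half-plane. It serves to pull vertical limits back through a regular map.\<close>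

lemma regular_at_local_inverse:
  assumes f: "half_plane_self_map f" and reg: "regular_at f x"
  obtains e \<psi> where "e > 0" "\<psi> holomorphic_on ball (of_real (boundary_value f x)) e"
    "\<And>w. w \<in> ball (of_real (boundary_value f x)) e \<Longrightarrow> \<psi> (cnj w) = cnj (\<psi> w)"
    "\<And>w. w \<in> ball (of_real (boundary_value f x)) e \<Longrightarrow> Im w > 0 \<Longrightarrow> Im (\<psi> w) > 0 \<and> f (\<psi> w) = w"
    "\<psi> (of_real (boundary_value f x)) = of_real x"
    "filterlim \<psi> (vertical_filter x) (vertical_filter (boundary_value f x))"
  using reg
proof (rule regular_atE)
  fix e \<phi> assume *: "e > 0" "\<phi> holomorphic_on ball (of_real x) e"
    "\<And>z. z \<in> ball (of_real x) e \<Longrightarrow> \<phi> (cnj z) = cnj (\<phi> z)"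
    "\<And>z. z \<in> ball (of_real x) e \<Longrightarrow> Im z > 0 \<Longrightarrow> \<phi> z = f z"
    "\<And>y. \<bar>y - x\<bar> < e \<Longrightarrow> \<phi> (of_real y) = of_real (boundary_value f y)"
  let ?y = "complex_of_real (boundary_value f x)"
  have bv: "\<phi> (of_real x) = ?y" using *(1) *(5)[of x] by simp
  obtain d where d: "d > 0" "(\<phi> has_field_derivative of_real d) (at (of_real x))"
    by (rule regular_at_deriv[OF f reg *(1,2,4,5)])
  have xe: "complex_of_real x \<in> ball (of_real x) e" using *(1) by simp
  have "deriv \<phi> (of_real x) \<noteq> 0" using d DERIV_imp_deriv[OF d(2)] by simp
  then obtain r where r: "r > 0" "ball (complex_of_real x) r \<subseteq> ball (of_real x) e"
      "inj_on \<phi> (ball (of_real x) r)"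
    using has_complex_derivative_locally_injective[OF *(2) xe] by (metis open_ball)
  let ?S = "ball (complex_of_real x) r"
  have hol: "\<phi> holomorphic_on ?S" using *(2) r(2) by (rule holomorphic_on_subset)
  obtain \<psi> where \<psi>: "\<psi> holomorphic_on (\<phi> ` ?S)"
      "\<And>z. z \<in> ?S \<Longrightarrow> deriv \<phi> z * deriv \<psi> (\<phi> z) = 1" "\<And>z. z \<in> ?S \<Longrightarrow> \<psi> (\<phi> z) = z"
    using holomorphic_has_inverse[OF hol open_ball r(3)] by metis
  have "open (\<phi> ` ?S)" using open_mapping_thm3[OF hol open_ball r(3)] .
  moreover have "?y \<in> \<phi> ` ?S" using bv r(1) by (metis centre_in_ball imageI)
  ultimately obtain s where s: "s > 0" "ball ?y s \<subseteq> \<phi> ` ?S" by (meson open_contains_ball)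
  have xS: "complex_of_real x \<in> ?S" using r(1) by simp
  have yx: "\<psi> ?y = of_real x" using \<psi>(3)[OF xS] bv by simp
  have d': "(\<psi> has_field_derivative of_real (1 / d)) (at ?y)"
  proof -
    have "(\<psi> has_field_derivative deriv \<psi> ?y) (at ?y)"
      using \<psi>(1) s by (intro holomorphic_derivI[of _ "\<phi> ` ?S"])
        (use \<open>open (\<phi> ` ?S)\<close> \<open>?y \<in> \<phi> ` ?S\<close> in auto)
    moreover have "deriv \<psi> ?y = of_real (1 / d)"
      using \<psi>(2)[OF xS] bv DERIV_imp_deriv[OF d(2)] d(1) by (simp add: field_simps)
    ultimately show ?thesis by simp
  qed
  have sym: "\<psi> (cnj w) = cnj (\<psi> w)" and up: "Im w > 0 \<Longrightarrow> Im (\<psi> w) > 0 \<and> f (\<psi> w) = w"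
    if w: "w \<in> ball ?y s" for w
  proof -
    obtain z where z: "z \<in> ?S" "w = \<phi> z" using w s by blast
    have z': "cnj z \<in> ?S" using z(1) cnj_in_real_ball by blast
    have zz: "z \<in> ball (of_real x) e" "cnj z \<in> ball (of_real x) e" using z z' r by auto
    have c: "\<phi> (cnj z) = cnj (\<phi> z)" using *(3)[OF zz(1)] .
    show "\<psi> (cnj w) = cnj (\<psi> w)" using \<psi>(3)[OF z(1)] \<psi>(3)[OF z'] z(2) c by simp
    show "Im (\<psi> w) > 0 \<and> f (\<psi> w) = w" if "Im w > 0"
    proof -
      \<comment> \<open>A real \<open>z\<close> would have a real image, and a \<open>z\<close>
        below the axis an image below it.\<close>
      have "Im z > 0"
      proof (rule ccontr)
        assume "\<not> Im z > 0"
        then consider "Im z = 0" | "Im (cnj z) > 0" by force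
        then show False
        proof cases
          case 1
          then have "cnj z = z" by (simp add: complex_eq_iff)
          then have "cnj w = w" using c z(2) by simp
          then show False using that by (simp add: complex_eq_iff)
        next
          case 2
          then have "Im (\<phi> (cnj z)) > 0" using *(4)[OF zz(2)] half_plane_self_mapD(2)[OF f] by simp
          then show False using that z(2) c by simp
        qed
      qed
      then show ?thesis using *(4)[OF zz(1)] \<psi>(3)[OF z(1)] z(2) by simp
    qed
  qed
  show thesis
  proof (rule that[of s \<psi>])
    show "\<psi> holomorphic_on ball ?y s" using \<psi>(1) s(2) by (rule holomorphic_on_subset)
    show "filterlim \<psi> (vertical_filter x) (vertical_filter (boundary_value f x))"
      using filterlim_vertical_conformal[OF d' _ yx] d(1) by simp
  qed (use s sym up yx in auto)
qed

text \<open>Composition with the local inverse of \<open>f\<close> cancels \<open>f\<close>. In this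
  way regularity of an iterate is passed on to \<open>h\<close> at the end of the orbit.\<close>

lemma regular_at_factor:
  assumes f: "half_plane_self_map f" and rf: "regular_at f x" and rgf: "regular_at (\<lambda>z. g (f z)) x"
  shows "regular_at g (boundary_value f x)"
proof (rule regular_at_local_inverse[OF f rf])
  fix e \<psi> assume *: "e > 0" "\<psi> holomorphic_on ball (of_real (boundary_value f x)) e"
    "\<And>w. w \<in> ball (of_real (boundary_value f x)) e \<Longrightarrow> \<psi> (cnj w) = cnj (\<psi> w)"
    "\<And>w. w \<in> ball (of_real (boundary_value f x)) e \<Longrightarrow> Im w > 0 \<Longrightarrow> Im (\<psi> w) > 0 \<and> f (\<psi> w) = w"
    "\<psi> (of_real (boundary_value f x)) = of_real x"
  obtain e' \<phi> where **: "e' > 0" "\<phi> holomorphic_on ball (of_real x) e'"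
    "\<And>z. z \<in> ball (of_real x) e' \<Longrightarrow> \<phi> (cnj z) = cnj (\<phi> z)"
    "\<And>z. z \<in> ball (of_real x) e' \<Longrightarrow> Im z > 0 \<Longrightarrow> \<phi> z = g (f z)"
    using rgf unfolding regular_at_def by blast
  let ?y = "complex_of_real (boundary_value f x)"
  have "isCont \<psi> ?y"
    using *(1,2) holomorphic_on_imp_continuous_on continuous_on_eq_continuous_at
    by (metis centre_in_ball open_ball)
  then obtain s where s: "s > 0" "\<And>z. dist z ?y < s \<Longrightarrow> dist (\<psi> z) (\<psi> ?y) < e'"
    using **(1) unfolding continuous_at_eps_delta by blast
  define r where "r = min e s"
  have r: "r > 0" "ball ?y r \<subseteq> ball ?y e" "\<psi> ` ball ?y r \<subseteq> ball (of_real x) e'"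
    using s *(1,5) by (auto simp: r_def dist_commute)
  show ?thesis
    unfolding regular_at_def
  proof (intro exI[of _ r] conjI exI[of _ "\<lambda>z. \<phi> (\<psi> z)"] ballI impI)
    have "\<phi> \<circ> \<psi> holomorphic_on ball ?y r"
      using r * ** by (intro holomorphic_on_compose_gen[OF _ **(2)] holomorphic_on_subset[OF *(2)]) auto
    then show "(\<lambda>z. \<phi> (\<psi> z)) holomorphic_on ball ?y r" by (simp add: o_def)
    fix z assume z: "z \<in> ball ?y r"
    then have "z \<in> ball ?y e" "\<psi> z \<in> ball (of_real x) e'" using r by blast+
    then show "\<phi> (\<psi> (cnj z)) = cnj (\<phi> (\<psi> z))"
      and "Im z > 0 \<Longrightarrow> \<phi> (\<psi> z) = g z"
      using *(3,4)[of z] **(3,4)[of "\<psi> z"] by auto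
  qed (use r in auto)
qed

text \<open>The map \<open>z - 1 / f z\<close> recovers \<open>k\<close> from
  \<open>f = -1 / (k - z)\<close>; only zeros of \<open>f\<close> obstruct the extension.\<close>

lemma regular_at_diff_inverse:
  assumes reg: "regular_at f x" and nz: "boundary_value f x \<noteq> 0"
  shows "regular_at (\<lambda>z. z - 1 / f z) x"
  using reg
proof (rule regular_atE)
  fix e \<phi> assume *: "e > 0" "\<phi> holomorphic_on ball (of_real x) e"
    "\<And>z. z \<in> ball (of_real x) e \<Longrightarrow> \<phi> (cnj z) = cnj (\<phi> z)"
    "\<And>z. z \<in> ball (of_real x) e \<Longrightarrow> Im z > 0 \<Longrightarrow> \<phi> z = f z"
    "\<And>y. \<bar>y - x\<bar> < e \<Longrightarrow> \<phi> (of_real y) = of_real (boundary_value f y)"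
  have "isCont \<phi> (of_real x)"
    using *(1,2) holomorphic_on_imp_continuous_on continuous_on_eq_continuous_at
    by (metis centre_in_ball open_ball)
  moreover have "\<phi> (of_real x) \<noteq> 0" using *(1) *(5)[of x] nz by simp
  ultimately obtain s where s: "s > 0" "\<And>z. dist (of_real x) z < s \<Longrightarrow> \<phi> z \<noteq> 0"
    using continuous_at_avoid by blast
  define r where "r = min e s"
  have r: "r > 0" "ball (complex_of_real x) r \<subseteq> ball (of_real x) e"
    "\<And>z. z \<in> ball (complex_of_real x) r \<Longrightarrow> \<phi> z \<noteq> 0"
    using s *(1) by (auto simp: r_def)
  show ?thesis
    unfolding regular_at_def
  proof (intro exI[of _ r] conjI exI[of _ "\<lambda>z. z - 1 / \<phi> z"] ballI impI)
    show "(\<lambda>z. z - 1 / \<phi> z) holomorphic_on ball (of_real x) r"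
      using r by (intro holomorphic_intros holomorphic_on_subset[OF *(2)]) auto
  qed (use r *(3,4) in auto)
qed

section \<open>The representing measure of a positive harmonic function\<close>

definition disc_poisson_kernel :: "complex \<Rightarrow> real \<Rightarrow> real" where
  "disc_poisson_kernel w t = (1 - (cmod w)\<^sup>2) / (cmod (cis t - w))\<^sup>2"

lemma cis_neq_of_norm_less_1: "cmod w < 1 \<Longrightarrow> cis t - w \<noteq> 0"
  by (metis eq_iff_diff_eq_0 less_irrefl norm_cis)

lemma continuous_disc_poisson_kernel:
  assumes "cmod w < 1"
  shows "isCont (disc_poisson_kernel w) t"
  unfolding disc_poisson_kernel_def using cis_neq_of_norm_less_1[OF assms]
  unfolding isCont_def by (intro tendsto_intros) auto

lemma disc_poisson_kernel_nonneg: "cmod w < 1 \<Longrightarrow> disc_poisson_kernel w t \<ge> 0"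
  unfolding disc_poisson_kernel_def by (simp add: power_le_one)

lemma disc_poisson_kernel_bound:
  assumes "cmod w < 1"
  shows "\<bar>disc_poisson_kernel w t\<bar> \<le> 1 / (1 - cmod w)\<^sup>2"
proof -
  have "1 - cmod w \<le> cmod (cis t - w)" using norm_triangle_ineq2[of "cis t" w] by simp
  then have "(1 - cmod w)\<^sup>2 \<le> (cmod (cis t - w))\<^sup>2" using assms by (intro power_mono) auto
  moreover have "0 < (1 - cmod w)\<^sup>2" using assms by simp
  moreover have "1 - (cmod w)\<^sup>2 \<ge> 0" "1 - (cmod w)\<^sup>2 \<le> 1" using assms by (auto simp: power_le_one)
  ultimately show ?thesis unfolding disc_poisson_kernel_def by (auto intro!: frac_le)
qed

text \<open>The Poisson kernel is the Cauchy kernel at \<open>w\<close> plus a term with its pole at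
  the reflected point \<open>1 / cnj w\<close>. That pole lies outside the circle, so the second
  term contributes nothing to the contour integral.\<close>

lemma cis_kernel_identity:
  assumes "cmod w < 1"
  shows "(1 / (cis t - w) + cnj w / (1 - cnj w * cis t)) * cis t = of_real (disc_poisson_kernel w t)"
proof -
  have nz: "cis t - w \<noteq> 0" using cis_neq_of_norm_less_1[OF assms] .
  then have nz': "cnj (cis t) - cnj w \<noteq> 0" by (metis complex_cnj_diff complex_cnj_zero_iff)
  have unit: "cis t * cnj (cis t) = 1" by (simp add: cis_cnj cis_mult)
  have "1 - cnj w * cis t = cis t * (cnj (cis t) - cnj w)" using unit by (simp add: algebra_simps)
  then have "(1 / (cis t - w) + cnj w / (1 - cnj w * cis t)) * cis t
      = cis t / (cis t - w) + cnj w / (cnj (cis t) - cnj w)"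
    by (simp add: distrib_right cis_neq_zero)
  also have "\<dots> = (cis t * (cnj (cis t) - cnj w) + cnj w * (cis t - w)) / ((cis t - w) * (cnj (cis t) - cnj w))"
    using nz nz' by (simp add: add_frac_eq)
  also have "cis t * (cnj (cis t) - cnj w) + cnj w * (cis t - w) = of_real (1 - (cmod w)\<^sup>2)"
    using unit complex_norm_square[of w] by (simp add: algebra_simps)
  also have "(cis t - w) * (cnj (cis t) - cnj w) = of_real ((cmod (cis t - w))\<^sup>2)"
    using complex_norm_square[of "cis t - w"] by simp
  finally show ?thesis by (simp add: disc_poisson_kernel_def)
qed

lemma poisson_disc:
  assumes hol: "F holomorphic_on ball 0 R" and R: "R > 1" and w: "cmod w < 1"
  shows "((\<lambda>t. of_real (disc_poisson_kernel w t) * F (cis t)) has_integral (2 * of_real pi * F w)) {0..2*pi}"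
proof -
  \<comment> \<open>The disc of radius \<open>S\<close> still contains the unit circle but excludes
    the reflected pole \<open>1 / cnj w\<close>.\<close>
  define S where "S = min R (2 / (1 + cmod w))"
  have w1: "1 + cmod w > 0" using norm_ge_zero[of w] by linarith
  have "2 / (1 + cmod w) > 1" using w w1 by (simp add: pos_less_divide_eq)
  then have S: "S > 1" "S \<le> R" "S \<le> 2 / (1 + cmod w)"
    using R by (auto simp: S_def)
  have den: "1 - cnj w * u \<noteq> 0" if "u \<in> ball 0 S" for u
  proof
    assume "1 - cnj w * u = 0"
    then have "cmod (cnj w * u) = 1" by simp
    then have 1: "cmod w * cmod u = 1" by (simp add: norm_mult)
    have "cmod u < 2 / (1 + cmod w)" using that S by simp
    then have "cmod w * cmod u \<le> cmod w * (2 / (1 + cmod w))" by (intro mult_left_mono) auto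
    also have "\<dots> < 1" using w w1 by (simp add: pos_divide_less_eq)
    finally show False using 1 by simp
  qed
  have path: "circlepath 0 1 = part_circlepath 0 1 0 (2*pi)" by (simp add: circlepath_def)
  have hS: "F holomorphic_on ball 0 S" using hol S by (auto intro: holomorphic_on_subset)
  have 1: "((\<lambda>u. F u / (u - w)) has_contour_integral (2 * of_real pi * \<i> * F w)) (circlepath 0 1)"
    using hol R w by (intro Cauchy_integral_circlepath_simple) (auto intro: holomorphic_on_subset)
  have 2: "((\<lambda>u. F u * (cnj w / (1 - cnj w * u))) has_contour_integral 0) (circlepath 0 1)"
  proof (rule Cauchy_theorem_convex_simple)
    show "(\<lambda>u. F u * (cnj w / (1 - cnj w * u))) holomorphic_on ball 0 S"
      using den hS by (intro holomorphic_intros) auto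
    show "path_image (circlepath 0 1) \<subseteq> ball 0 S" using S by auto
  qed auto
  have "((\<lambda>u. F u / (u - w) + F u * (cnj w / (1 - cnj w * u))) has_contour_integral (2 * of_real pi * \<i> * F w)) (circlepath 0 1)"
    using has_contour_integral_add[OF 1 2] by simp
  then have *: "((\<lambda>t. (F (cis t) / (cis t - w) + F (cis t) * (cnj w / (1 - cnj w * cis t))) * \<i> * cis t)
      has_integral (2 * of_real pi * \<i> * F w)) {0..2*pi}"
    unfolding path by (subst (asm) has_contour_integral_part_circlepath_iff) auto
  have rot: "- \<i> * (a * \<i> * b) = a * b" "- \<i> * (2 * of_real pi * \<i> * b) = 2 * of_real pi * b" for a b
    by (simp_all add: complex_eq_iff)
  from has_integral_mult_right[OF *, of "- \<i>", unfolded rot]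
  have "((\<lambda>t. (F (cis t) / (cis t - w) + F (cis t) * (cnj w / (1 - cnj w * cis t))) * cis t)
      has_integral (2 * of_real pi * F w)) {0..2*pi}"
    .
  moreover have "(F (cis t) / (cis t - w) + F (cis t) * (cnj w / (1 - cnj w * cis t))) * cis t
      = of_real (disc_poisson_kernel w t) * F (cis t)" for t
    unfolding cis_kernel_identity[OF w, of t, symmetric] by (simp add: divide_inverse algebra_simps)
  ultimately show ?thesis by simp
qed

lemma poisson_disc_Im:
  assumes hol: "F holomorphic_on ball 0 R" and R: "R > 1" and w: "cmod w < 1"
  shows "((\<lambda>t. disc_poisson_kernel w t * Im (F (cis t))) has_integral (2 * pi * Im (F w))) {0..2*pi}"
  using has_integral_linear[OF poisson_disc[OF assms] bounded_linear_Im] by (simp add: o_def)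

text \<open>\<open>F\<close> need not extend to the circle, so Poisson's formula is applied to the
  dilations \<open>F (\<rho> n * w)\<close>. Their normalised boundary densities are probability
  measures supported in one bounded interval, hence tight, and Helly selection supplies the limit
  measure. Boundedness and continuity of the kernel for fixed \<open>w\<close> allow passage to the
  limit.\<close>

lemma herglotz_disc:
  assumes hol: "F holomorphic_on ball 0 1" and pos: "\<And>w. cmod w < 1 \<Longrightarrow> Im (F w) > 0"
  obtains M where "real_distribution M"
    "\<And>w. cmod w < 1 \<Longrightarrow> Im (F w) = Im (F 0) * (\<integral>t. disc_poisson_kernel w t \<partial>M)"
proof -
  define \<rho> where "\<rho> n = 1 - 1 / real (n + 2)" for n
  have \<rho>: "0 < \<rho> n" "\<rho> n < 1" for n by (auto simp: \<rho>_def)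
  have \<rho>lim: "\<rho> \<longlonglongrightarrow> 1"
  proof -
    have "(\<lambda>n. 1 - 1 / real (n + 2)) \<longlonglongrightarrow> 1 - 0"
      by (intro tendsto_intros LIMSEQ_ignore_initial_segment[OF lim_1_over_n, of 2])
    then show ?thesis by (simp add: \<rho>_def[abs_def])
  qed
  define c where "c = 2 * pi * Im (F 0)"
  have c: "c > 0" using pos[of 0] by (simp add: c_def)
  define u where "u n t = Im (F (of_real (\<rho> n) * cis t))" for n t
  have u_pos: "u n t > 0" for n t unfolding u_def using \<rho>[of n] by (intro pos) (simp add: norm_mult)
  have u_cont: "continuous_on A (u n)" for n A
  proof -
    have "continuous_on UNIV (\<lambda>t. F (of_real (\<rho> n) * cis t))"
      using \<rho>[of n] by (intro continuous_on_compose2[OF holomorphic_on_imp_continuous_on[OF hol]])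
        (auto intro!: continuous_intros continuous_on_cis simp: norm_mult)
    then show ?thesis unfolding u_def by (intro continuous_intros) (auto intro: continuous_on_subset)
  qed
  have P: "((\<lambda>t. disc_poisson_kernel w t * u n t) has_integral (2 * pi * Im (F (of_real (\<rho> n) * w)))) {0..2*pi}"
    if "cmod w < 1" for w n
  proof -
    have "(\<lambda>w. F (of_real (\<rho> n) * w)) holomorphic_on ball 0 (1 / \<rho> n)"
      using \<rho>[of n] by (intro holomorphic_on_compose_gen[OF _ hol, unfolded o_def] holomorphic_intros)
        (auto simp: norm_mult field_simps)
    from poisson_disc_Im[OF this _ that] show ?thesis using \<rho>[of n] by (simp add: u_def)
  qed
  have k0: "disc_poisson_kernel 0 t = 1" for t by (simp add: disc_poisson_kernel_def)
  define g where "g n t = indicator {0..2*pi} t * u n t / c" for n t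
  define \<mu> where "\<mu> n = density lborel (\<lambda>t. ennreal (g n t))" for n
  have g_meas [measurable]: "g n \<in> borel_measurable lborel" for n
  proof -
    have [measurable]: "u n \<in> borel_measurable borel" by (intro borel_measurable_continuous_onI u_cont)
    show ?thesis unfolding g_def by measurable
  qed
  have g_nonneg: "g n t \<ge> 0" for n t
    unfolding g_def using u_pos[of n t] c by (auto simp: indicator_def)
  have integ: "integrable lborel (\<lambda>t. g n t * k t) \<and> (\<integral>t. g n t * k t \<partial>lborel) = integral {0..2*pi} (\<lambda>t. k t * u n t) / c"
    if k: "continuous_on UNIV k" for n and k :: "real \<Rightarrow> real"
  proof -
    have "set_integrable lborel {0..2*pi} (\<lambda>t. k t * u n t)"
      using k by (intro borel_integrable_atLeastAtMost' continuous_intros u_cont)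
        (auto intro: continuous_on_subset)
    note s = this set_borel_integral_eq_integral(2)[OF this]
    have eq: "g n t * k t = (indicator {0..2*pi} t *\<^sub>R (k t * u n t)) / c" for t by (simp add: g_def)
    show ?thesis unfolding eq using s unfolding set_integrable_def set_lebesgue_integral_def by simp
  qed
  have int1: "integral {0..2*pi} (u n) = c" for n
    using integral_unique[OF P[of 0 n]] by (simp add: k0 c_def)
  have tot: "(\<integral>\<^sup>+t. ennreal (g n t) \<partial>lborel) = 1" for n
    using integ[of "\<lambda>_. 1" n] int1[of n] c nn_integral_eq_integral[of lborel "g n"] g_nonneg by simp
  have rd: "real_distribution (\<mu> n)" for n
  proof -
    have "emeasure (\<mu> n) (space (\<mu> n)) = 1"
      using tot[of n] unfolding \<mu>_def by (subst emeasure_density) auto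
    then show ?thesis unfolding real_distribution_def real_distribution_axioms_def
      by (auto intro: prob_spaceI simp: \<mu>_def)
  qed
  have tight: "tight \<mu>"
    unfolding tight_def
  proof (intro conjI allI impI rd)
    fix \<epsilon> :: real assume "\<epsilon> > 0"
    have "measure (\<mu> n) {-1<..7} = 1" for n
    proof -
      have "emeasure (\<mu> n) {-1<..7} = (\<integral>\<^sup>+t. ennreal (g n t) * indicator {-1<..7} t \<partial>lborel)"
        unfolding \<mu>_def by (subst emeasure_density) auto
      also have "\<dots> = (\<integral>\<^sup>+t. ennreal (g n t) \<partial>lborel)"
        using pi_less_4 pi_approx by (intro nn_integral_cong) (auto simp: g_def indicator_def)
      finally show ?thesis using tot[of n] by (simp add: measure_def)
    qed
    then show "\<exists>a b. a < b \<and> (\<forall>n. 1 - \<epsilon> < measure (\<mu> n) {a<..b})"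
      using \<open>\<epsilon> > 0\<close> by (intro exI[of _ "-1"] exI[of _ 7]) auto
  qed
  obtain r M where r: "strict_mono r" and M: "real_distribution M" and wc: "weak_conv_m (\<mu> \<circ> id \<circ> r) M"
    using tight_imp_convergent_subsubsequence[OF tight strict_mono_id] by blast
  show thesis
  proof (rule that[OF M])
    fix w assume w: "cmod w < 1"
    let ?k = "disc_poisson_kernel w"
    have kc: "continuous_on UNIV ?k"
      using continuous_disc_poisson_kernel[OF w] by (simp add: continuous_at_imp_continuous_on)
    have int: "(\<integral>t. ?k t \<partial>\<mu> n) = Im (F (of_real (\<rho> n) * w)) / Im (F 0)" for n
    proof -
      have "(\<integral>t. ?k t \<partial>\<mu> n) = (\<integral>t. g n t *\<^sub>R ?k t \<partial>lborel)"
        unfolding \<mu>_def using kc g_nonneg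
        by (intro integral_density) (auto intro: borel_measurable_continuous_onI)
      also have "\<dots> = integral {0..2*pi} (\<lambda>t. ?k t * u n t) / c" using integ[OF kc] by simp
      also have "\<dots> = Im (F (of_real (\<rho> n) * w)) / Im (F 0)"
        using integral_unique[OF P[OF w, of n]] by (simp add: c_def)
      finally show ?thesis .
    qed
    have "(\<lambda>n. \<integral>t. ?k t \<partial>(\<mu> \<circ> id \<circ> r) n) \<longlonglongrightarrow> (\<integral>t. ?k t \<partial>M)"
      by (rule weak_conv_imp_integral_bdd_continuous_conv[OF _ M wc])
        (use rd continuous_disc_poisson_kernel[OF w] disc_poisson_kernel_bound[OF w] in auto)
    then have 1: "(\<lambda>n. Im (F (of_real (\<rho> (r n)) * w)) / Im (F 0)) \<longlonglongrightarrow> (\<integral>t. ?k t \<partial>M)"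
      by (simp add: int)
    have "isCont F w" using hol w holomorphic_on_imp_continuous_on continuous_on_eq_continuous_at
      by (metis mem_ball_0 open_ball)
    moreover have "(\<lambda>n. of_real (\<rho> (r n)) * w) \<longlonglongrightarrow> of_real 1 * w"
      using LIMSEQ_subseq_LIMSEQ[OF \<rho>lim r] by (intro tendsto_intros) (simp add: o_def)
    ultimately have "(\<lambda>n. F (of_real (\<rho> (r n)) * w)) \<longlonglongrightarrow> F w"
      using isCont_tendsto_compose by fastforce
    then have "(\<lambda>n. Im (F (of_real (\<rho> (r n)) * w)) / Im (F 0)) \<longlonglongrightarrow> Im (F w) / Im (F 0)"
      using pos[of 0] by (intro tendsto_intros) auto
    then show "Im (F w) = Im (F 0) * (\<integral>t. ?k t \<partial>M)"
      using LIMSEQ_unique[OF 1] pos[of 0] by (simp add: field_simps)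
  qed
qed

section \<open>Transfer of the representing measure from the circle to the line\<close>

definition real_line_point :: "real \<Rightarrow> real" where
  "real_line_point t = Re (\<i> * (1 + cis t) / (1 - cis t))"

lemma cis_real_line_point:
  assumes "cis t \<noteq> 1"
  shows "cis t = (of_real (real_line_point t) - \<i>) / (of_real (real_line_point t) + \<i>)"
proof -
  define \<zeta> where "\<zeta> = \<i> * (1 + cis t) / (1 - cis t)"
  have nz: "1 - cis t \<noteq> 0" using assms by auto
  have inv: "cnj (cis t) = 1 / cis t" by (simp add: cis_cnj cis_inverse divide_inverse)
  have nz': "cis t - 1 \<noteq> 0" using assms by auto
  have "1 - 1 / cis t = (cis t - 1) / cis t" "1 + 1 / cis t = (cis t + 1) / cis t"
    by (simp_all add: diff_divide_distrib add_divide_distrib)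
  then have "cnj \<zeta> = - \<i> * (cis t + 1) / (cis t - 1)"
    unfolding \<zeta>_def using nz' by (simp add: inv)
  also have "\<dots> = \<zeta>" unfolding \<zeta>_def using nz nz' by (simp add: field_simps)
  finally have "\<zeta> \<in> \<real>" by (simp add: Reals_cnj_iff)
  then have real: "of_real (real_line_point t) = \<zeta>" by (simp add: real_line_point_def \<zeta>_def)
  have "\<zeta> - \<i> = 2 * \<i> * cis t / (1 - cis t)" "\<zeta> + \<i> = 2 * \<i> / (1 - cis t)"
    unfolding \<zeta>_def using nz by (simp_all add: field_simps)
  then show ?thesis unfolding real using nz by simp
qed

definition half_plane_kernel :: "complex \<Rightarrow> real \<Rightarrow> real" where
  "half_plane_kernel z t = disc_poisson_kernel ((z - \<i>) / (z + \<i>)) t"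

text \<open>The factor \<open>1 + (real_line_point t)\<^sup>2\<close> is the change of density
  between circle and line. The point \<open>cis t = 1\<close> corresponds to infinity, and mass
  there adds a multiple of \<open>Im z\<close>.\<close>

lemma half_plane_kernel_eq:
  assumes z: "Im z > 0"
  shows "cis t = 1 \<Longrightarrow> half_plane_kernel z t = Im z"
    and "cis t \<noteq> 1 \<Longrightarrow> half_plane_kernel z t =
      Im z * (1 + (real_line_point t)\<^sup>2) / ((real_line_point t - Re z)\<^sup>2 + (Im z)\<^sup>2)"
proof -
  have nz: "z + \<i> \<noteq> 0" using z by (auto simp: complex_eq_iff)
  then have nzc: "(cmod (z + \<i>))\<^sup>2 \<noteq> 0" by simp
  have top: "1 - (cmod ((z - \<i>) / (z + \<i>)))\<^sup>2 = 4 * Im z / (cmod (z + \<i>))\<^sup>2"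
  proof -
    have "(cmod (z + \<i>))\<^sup>2 - (cmod (z - \<i>))\<^sup>2 = 4 * Im z"
      using norm_diff_cnj_square[of z \<i>] by simp
    then show ?thesis using nzc by (simp add: norm_divide power_divide diff_divide_eq_iff)
  qed
  show "half_plane_kernel z t = Im z" if "cis t = 1"
  proof -
    have "1 - (z - \<i>) / (z + \<i>) = 2 * \<i> / (z + \<i>)" using nz by (simp add: field_simps)
    then have "(cmod (1 - (z - \<i>) / (z + \<i>)))\<^sup>2 = 4 / (cmod (z + \<i>))\<^sup>2"
      by (simp add: norm_divide norm_mult power_divide)
    then show ?thesis
      unfolding half_plane_kernel_def disc_poisson_kernel_def top that using nzc by simp
  qed
  show "half_plane_kernel z t =
      Im z * (1 + (real_line_point t)\<^sup>2) / ((real_line_point t - Re z)\<^sup>2 + (Im z)\<^sup>2)" if "cis t \<noteq> 1"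
  proof -
    define X where "X = complex_of_real (real_line_point t)"
    have nX: "X + \<i> \<noteq> 0" by (auto simp: X_def complex_eq_iff)
    have "cis t - (z - \<i>) / (z + \<i>) = 2 * \<i> * (X - z) / ((X + \<i>) * (z + \<i>))"
      unfolding cis_real_line_point[OF that] X_def[symmetric] using nX nz
      by (simp add: field_simps)
    then have "(cmod (cis t - (z - \<i>) / (z + \<i>)))\<^sup>2
        = 4 * (cmod (X - z))\<^sup>2 / ((cmod (X + \<i>))\<^sup>2 * (cmod (z + \<i>))\<^sup>2)"
      by (simp add: norm_divide norm_mult power_divide power_mult_distrib)
    moreover define N where "N = (cmod (X - z))\<^sup>2"
    moreover have "(cmod (X + \<i>))\<^sup>2 = 1 + (real_line_point t)\<^sup>2"
      "N = (real_line_point t - Re z)\<^sup>2 + (Im z)\<^sup>2"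
      by (simp_all add: X_def N_def cmod_power2)
    ultimately have "half_plane_kernel z t =
      (4 * Im z / (cmod (z + \<i>))\<^sup>2) / (4 * N / ((1 + (real_line_point t)\<^sup>2) * (cmod (z + \<i>))\<^sup>2))"
      unfolding half_plane_kernel_def disc_poisson_kernel_def top by simp
    also have "\<dots> = Im z * (1 + (real_line_point t)\<^sup>2) / N" using nzc by simp
    finally show ?thesis by (simp add: N_def X_def cmod_power2)
  qed
qed

lemma half_plane_disc_norm:
  assumes "Im z > 0"
  shows "cmod ((z - \<i>) / (z + \<i>)) < 1"
proof -
  have "(cmod (z - \<i>))\<^sup>2 < (cmod (z + \<i>))\<^sup>2" using norm_diff_cnj_square[of z \<i>] assms by simp
  then have "cmod (z - \<i>) < cmod (z + \<i>)" by (rule power2_less_imp_less) simp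
  then show ?thesis by (simp add: norm_divide divide_less_eq)
qed

lemma herglotz_half_plane:
  assumes f: "half_plane_self_map f"
  obtains M where "real_distribution M"
    "\<And>z. Im z > 0 \<Longrightarrow> Im (f z) = Im (f \<i>) * (\<integral>t. half_plane_kernel z t \<partial>M)"
proof -
  define C where "C w = \<i> * (1 + w) / (1 - w)" for w
  have ImC: "Im (C w) > 0" if "cmod w < 1" for w
  proof -
    have "w \<noteq> 1" using that by auto
    have "Re w ^ 2 + Im w ^ 2 < 1"
      using that by (metis cmod_power2 norm_ge_zero power_less_one_iff pos2 zero_less_numeral)
    also have "1 - (Re w ^ 2 + Im w ^ 2) = Im (\<i> * (1 + w) * cnj (1 - w))"
      by (simp add: power2_eq_square algebra_simps)
    finally have "0 < Im (\<i> * (1 + w) * cnj (1 - w))"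
      by (simp add: power2_eq_square algebra_simps)
    also have "\<i> * (1 + w) * cnj (1 - w) = C w * of_real ((cmod (1 - w))\<^sup>2)"
      unfolding C_def using \<open>w \<noteq> 1\<close> by (simp add: complex_norm_square del: of_real_power)
    finally show ?thesis by (simp add: zero_less_mult_iff)
  qed
  have "(\<lambda>w. f (C w)) holomorphic_on ball 0 1"
  proof -
    have "C holomorphic_on ball 0 1" unfolding C_def by (intro holomorphic_intros) auto
    moreover have "C ` ball 0 1 \<subseteq> upper_half_plane" using ImC by auto
    ultimately show ?thesis
      using holomorphic_on_compose_gen[OF _ half_plane_self_mapD(1)[OF f]] by (simp add: o_def)
  qed
  then obtain M where M: "real_distribution M"
    and eq: "\<And>w. cmod w < 1 \<Longrightarrow> Im (f (C w)) = Im (f (C 0)) * (\<integral>t. disc_poisson_kernel w t \<partial>M)"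
    using herglotz_disc[of "\<lambda>w. f (C w)"] half_plane_self_mapD(2)[OF f ImC] by metis
  show thesis
  proof (rule that[OF M])
    fix z assume z: "Im z > 0"
    have nz: "z + \<i> \<noteq> 0" using z by (auto simp: complex_eq_iff)
    have "1 - (z - \<i>) / (z + \<i>) = 2 * \<i> / (z + \<i>)" "1 + (z - \<i>) / (z + \<i>) = 2 * z / (z + \<i>)"
      using nz by (simp_all add: field_simps)
    then have "C ((z - \<i>) / (z + \<i>)) = z" unfolding C_def using nz by simp
    moreover have "C 0 = \<i>" by (simp add: C_def)
    ultimately show "Im (f z) = Im (f \<i>) * (\<integral>t. half_plane_kernel z t \<partial>M)"
      using eq[OF half_plane_disc_norm[OF z]] by (simp add: half_plane_kernel_def)
  qed
qed

text \<open>\<open>\<nu>\<close> is the representing measure of \<open>Im f\<close> on the real line without its atom at \<open>\<infinity>\<close>.\<close>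

lemma boundary_measure:
  assumes f: "half_plane_self_map f"
  obtains \<nu> :: "real measure" and C where "sets \<nu> = sets borel" "finite_measure \<nu>" "C > 0"
    "\<And>x \<epsilon>. \<epsilon> > 0 \<Longrightarrow> measure \<nu> (cball x (5 * \<epsilon>)) \<le> C * \<epsilon> * Im (f (Complex x \<epsilon>))"
    "\<And>a a' b' b. a < a' \<Longrightarrow> a' < b' \<Longrightarrow> b' < b \<Longrightarrow> emeasure \<nu> {a<..<b} = 0 \<Longrightarrow>
       \<exists>K. \<forall>z. a' \<le> Re z \<and> Re z \<le> b' \<and> Im z > 0 \<longrightarrow> Im (f z) \<le> K * Im z"
proof -
  obtain M where M: "real_distribution M"
    and eq: "\<And>z. Im z > 0 \<Longrightarrow> Im (f z) = Im (f \<i>) * (\<integral>t. half_plane_kernel z t \<partial>M)"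
    using herglotz_half_plane[OF f] by blast
  interpret real_distribution M by fact
  have fi: "Im (f \<i>) > 0" using half_plane_self_mapD(2)[OF f] by simp
  have [measurable]: "cis \<in> borel_measurable borel"
    by (intro borel_measurable_continuous_onI continuous_intros)
  have X[measurable]: "real_line_point \<in> borel_measurable borel"
    unfolding real_line_point_def by measurable
  \<comment> \<open>At \<open>cis t = 1\<close> division by zero gives
    \<open>real_line_point\<close> the value 0; without the restriction to \<open>E\<close> the mass
    at infinity would reappear as an atom at 0.\<close>
  define E where "E = {t. cis t \<noteq> 1}"
  have E[measurable]: "E \<in> sets borel" unfolding E_def by measurable
  define \<nu> where "\<nu> = distr (density M (indicator E)) borel real_line_point"
  have em: "emeasure \<nu> S = emeasure M (E \<inter> real_line_point -` S)" if [measurable]: "S \<in> sets borel" for S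
  proof -
    have "emeasure \<nu> S = emeasure (density M (indicator E)) (real_line_point -` S)"
      unfolding \<nu>_def by (subst emeasure_distr) auto
    also have "\<dots> = (\<integral>\<^sup>+t. indicator E t * indicator (real_line_point -` S) t \<partial>M)"
      by (subst emeasure_density) (auto simp: measurable_sets_borel[OF X that])
    also have "\<dots> = (\<integral>\<^sup>+t. indicator (E \<inter> real_line_point -` S) t \<partial>M)"
      by (intro nn_integral_cong) (auto simp: indicator_def)
    also have "\<dots> = emeasure M (E \<inter> real_line_point -` S)"
      using measurable_sets_borel[OF X that] by (intro nn_integral_indicator) auto
    finally show ?thesis .
  qed
  have k_int: "integrable M (half_plane_kernel z)" if "Im z > 0" for z
  proof (rule integrable_const_bound)
    have "continuous_on UNIV (half_plane_kernel z)"
      unfolding half_plane_kernel_def[abs_def]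
      using continuous_disc_poisson_kernel[OF half_plane_disc_norm[OF that]]
      by (intro continuous_at_imp_continuous_on) auto
    then show "half_plane_kernel z \<in> borel_measurable M"
      by (subst measurable_cong_sets[OF events_eq_borel refl]) (rule borel_measurable_continuous_onI)
    show "AE t in M. norm (half_plane_kernel z t) \<le> 1 / (1 - cmod ((z - \<i>) / (z + \<i>)))\<^sup>2"
      unfolding half_plane_kernel_def using disc_poisson_kernel_bound[OF half_plane_disc_norm[OF that]] by simp
  qed
  have k_nonneg: "half_plane_kernel z t \<ge> 0" if "Im z > 0" for z t
    unfolding half_plane_kernel_def by (rule disc_poisson_kernel_nonneg[OF half_plane_disc_norm[OF that]])
  show thesis
  proof (rule that[of \<nu> "26 / Im (f \<i>)"])
    show "sets \<nu> = sets borel" by (simp add: \<nu>_def)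
    show "finite_measure \<nu>"
      by (rule finite_measureI) (use em[of UNIV] in \<open>simp add: \<nu>_def emeasure_eq_measure\<close>)
    show "26 / Im (f \<i>) > 0" using fi by simp
  next
    fix x \<epsilon> :: real assume \<epsilon>: "\<epsilon> > 0"
    define S where "S = E \<inter> real_line_point -` cball x (5 * \<epsilon>)"
    have S[measurable]: "S \<in> sets borel" unfolding S_def using measurable_sets_borel[OF X] by auto
    \<comment> \<open>Within distance \<open>5 * \<epsilon>\<close> of \<open>x\<close> the
      denominator of the kernel is at most (25 + 1) times the square of \<epsilon>, whence 26. The 5
      anticipates the enlargement factor in Vitali's covering lemma.\<close>
    have low: "indicator S t * (1 / (26 * \<epsilon>)) \<le> half_plane_kernel (Complex x \<epsilon>) t" for t
    proof (cases "t \<in> S")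
      case True
      define v where "v = real_line_point t"
      have t: "cis t \<noteq> 1" "\<bar>v - x\<bar> \<le> 5 * \<epsilon>"
        using True by (auto simp: S_def E_def dist_real_def v_def)
      have "(v - x)\<^sup>2 \<le> (5 * \<epsilon>)\<^sup>2" using power_mono[OF t(2), of 2] by simp
      then have le: "(v - x)\<^sup>2 + \<epsilon>\<^sup>2 \<le> 26 * \<epsilon>\<^sup>2" by (simp add: power_mult_distrib)
      have p: "0 < (v - x)\<^sup>2 + \<epsilon>\<^sup>2" using \<epsilon> by (simp add: add_nonneg_pos)
      have "1 / (26 * \<epsilon>) = \<epsilon> / (26 * \<epsilon>\<^sup>2)" using \<epsilon> by (simp add: power2_eq_square)
      also have "\<dots> \<le> \<epsilon> * (1 + v\<^sup>2) / ((v - x)\<^sup>2 + \<epsilon>\<^sup>2)"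
        using \<epsilon> le p by (intro frac_le) (auto simp: algebra_simps)
      also have "\<dots> = half_plane_kernel (Complex x \<epsilon>) t"
        using half_plane_kernel_eq(2)[of "Complex x \<epsilon>" t] t \<epsilon> by (simp add: v_def)
      finally show ?thesis using True by simp
    qed (use k_nonneg \<epsilon> in auto)
    have "measure M S * (1 / (26 * \<epsilon>)) = (\<integral>t. indicator S t * (1 / (26 * \<epsilon>)) \<partial>M)" by simp
    also have "\<dots> \<le> (\<integral>t. half_plane_kernel (Complex x \<epsilon>) t \<partial>M)"
      using low \<epsilon> by (intro integral_mono k_int integrable_mult_left) (auto simp: emeasure_eq_measure)
    also have "\<dots> = Im (f (Complex x \<epsilon>)) / Im (f \<i>)" using eq[of "Complex x \<epsilon>"] \<epsilon> fi by simp
    finally have "measure M S \<le> 26 / Im (f \<i>) * \<epsilon> * Im (f (Complex x \<epsilon>))"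
      using \<epsilon> fi by (simp add: field_simps)
    moreover have "measure \<nu> (cball x (5 * \<epsilon>)) = measure M S"
      using em[of "cball x (5 * \<epsilon>)"] by (simp add: measure_def S_def)
    ultimately show "measure \<nu> (cball x (5 * \<epsilon>)) \<le> 26 / Im (f \<i>) * \<epsilon> * Im (f (Complex x \<epsilon>))"
      by simp
  next
    fix a a' b' b :: real assume ab: "a < a'" "a' < b'" "b' < b" and null: "emeasure \<nu> {a<..<b} = 0"
    \<comment> \<open>For \<open>z\<close> above \<open>{a'..b'}\<close> only points at distance at
      least \<delta> from \<open>Re z\<close> carry mass; there the weight
      \<open>1 + v\<^sup>2\<close> is at most \<open>K\<close> times the squared distance, so the
      kernel is at most \<open>K * Im z\<close>.\<close>
    define \<delta> where "\<delta> = min (a' - a) (b - b')"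
    define B where "B = max \<bar>a'\<bar> \<bar>b'\<bar>"
    define K where "K = (1 + 2 * B\<^sup>2) / \<delta>\<^sup>2 + 2"
    have \<delta>: "\<delta> > 0" using ab by (simp add: \<delta>_def)
    have K1: "K \<ge> 1" using \<delta> by (simp add: K_def)
    have "E \<inter> real_line_point -` {a<..<b} \<in> null_sets M"
      using em[of "{a<..<b}"] null measurable_sets_borel[OF X, of "{a<..<b}"] by (auto simp: null_sets_def)
    then have ae: "AE t in M. cis t = 1 \<or> real_line_point t \<notin> {a<..<b}"
      by (rule AE_I') (auto simp: E_def)
    have "Im (f z) \<le> (Im (f \<i>) * K) * Im z" if z: "a' \<le> Re z" "Re z \<le> b'" "Im z > 0" for z
    proof -
      have "half_plane_kernel z t \<le> K * Im z" if t: "cis t = 1 \<or> real_line_point t \<notin> {a<..<b}" for t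
      proof (cases "cis t = 1")
        case True
        then show ?thesis using half_plane_kernel_eq(1)[OF z(3) True] K1 z(3) by simp
      next
        case False
        define v where "v = real_line_point t"
        define d where "d = v - Re z"
        have d: "\<delta> \<le> \<bar>d\<bar>" using t False z by (auto simp: \<delta>_def v_def d_def)
        then have d2: "\<delta>\<^sup>2 \<le> d\<^sup>2" using \<delta> by (simp add: abs_le_square_iff[symmetric])
        have "\<bar>Re z\<bar> \<le> B" using z by (auto simp: B_def)
        then have rz: "(Re z)\<^sup>2 \<le> B\<^sup>2" by (simp add: abs_le_square_iff[symmetric])
        have "v\<^sup>2 \<le> 2 * d\<^sup>2 + 2 * (Re z)\<^sup>2"
          using sum_squares_bound[of d "Re z"] by (simp add: d_def power2_eq_square algebra_simps)
        then have "1 + v\<^sup>2 \<le> (1 + 2 * B\<^sup>2) + 2 * d\<^sup>2" using rz by simp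
        also have "\<dots> \<le> (1 + 2 * B\<^sup>2) * (d\<^sup>2 / \<delta>\<^sup>2) + 2 * d\<^sup>2"
          using mult_left_mono[of 1 "d\<^sup>2 / \<delta>\<^sup>2" "1 + 2 * B\<^sup>2"] d2 \<delta> by (simp add: pos_le_divide_eq)
        also have "\<dots> = K * d\<^sup>2" by (simp add: K_def algebra_simps)
        also have "\<dots> \<le> K * (d\<^sup>2 + (Im z)\<^sup>2)" using K1 by (intro mult_left_mono) auto
        finally have "(1 + v\<^sup>2) / (d\<^sup>2 + (Im z)\<^sup>2) \<le> K"
          using z(3) by (subst pos_divide_le_eq) (auto simp: add_nonneg_pos)
        then have "Im z * ((1 + v\<^sup>2) / (d\<^sup>2 + (Im z)\<^sup>2)) \<le> Im z * K" using z(3) by (intro mult_left_mono) auto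
        then show ?thesis
          using half_plane_kernel_eq(2)[OF z(3) False] by (simp add: v_def d_def mult.commute)
      qed
      then have "AE t in M. half_plane_kernel z t \<le> K * Im z" using ae by (auto elim: AE_mp)
      then have "(\<integral>t. half_plane_kernel z t \<partial>M) \<le> (\<integral>t. K * Im z \<partial>M)"
        by (intro integral_mono_AE k_int z) auto
      also have "\<dots> = K * Im z" using prob_space by simp
      finally show ?thesis using eq[OF z(3)] fi by (simp add: mult.assoc)
    qed
    then show "\<exists>K. \<forall>z. a' \<le> Re z \<and> Re z \<le> b' \<and> Im z > 0 \<longrightarrow> Im (f z) \<le> K * Im z" by blast
  qed
qed

section \<open>Covering estimates and singular boundary measures\<close>

lemma emeasure_UN_countable_le:
  assumes [measurable]: "\<And>i. i \<in> I \<Longrightarrow> X i \<in> sets M" and I: "countable I"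
  shows "emeasure M (\<Union>i\<in>I. X i) \<le> (\<integral>\<^sup>+i. emeasure M (X i) \<partial>count_space I)"
proof -
  have [measurable]: "(\<Union>i\<in>I. X i) \<in> sets M" using assms by (intro sets.countable_UN'') auto
  have "emeasure M (\<Union>i\<in>I. X i) = (\<integral>\<^sup>+x. indicator (\<Union>i\<in>I. X i) x \<partial>M)" by simp
  also have "\<dots> \<le> (\<integral>\<^sup>+x. (\<integral>\<^sup>+i. indicator (X i) x \<partial>count_space I) \<partial>M)"
  proof (intro nn_integral_mono)
    fix x
    show "indicator (\<Union>i\<in>I. X i) x \<le> (\<integral>\<^sup>+i. indicator (X i) x \<partial>count_space I)"
    proof (cases "\<exists>i\<in>I. x \<in> X i")
      case True
      then obtain i where i: "i \<in> I" "x \<in> X i" by blast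
      have "(\<integral>\<^sup>+j. indicator {i} j \<partial>count_space I) \<le> (\<integral>\<^sup>+j. indicator (X j) x \<partial>count_space I)"
        using i by (intro nn_integral_mono) (auto simp: indicator_def)
      moreover have "(\<integral>\<^sup>+j. indicator {i} j \<partial>count_space I) = 1" using i by (simp add: one_ennreal_def)
      ultimately show ?thesis using True by simp
    qed auto
  qed
  also have "\<dots> = (\<integral>\<^sup>+i. (\<integral>\<^sup>+x. indicator (X i) x \<partial>M) \<partial>count_space I)"
    by (rule nn_integral_count_space_nn_integral) (auto simp: I)
  also have "\<dots> = (\<integral>\<^sup>+i. emeasure M (X i) \<partial>count_space I)"
    by (intro nn_integral_cong) auto
  finally show ?thesis .
qed

text \<open>A differentiation estimate by Vitali's lemma: disjoint small balls inside
  \<open>G\<close> are chosen whose fivefold enlargements cover \<open>S\<close>. At each point a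
  single good radius below every scale suffices, which fits the weak information available on
  \<open>Im f\<close>.\<close>

lemma emeasure_le_of_small_balls:
  fixes \<nu> :: "real measure"
  assumes sets: "sets \<nu> = sets borel" and fin: "finite_measure \<nu>"
    and G: "open G" "S \<subseteq> G" and c: "c \<ge> 0"
    and small: "\<And>x \<eta>. x \<in> S \<Longrightarrow> \<eta> > 0 \<Longrightarrow> \<exists>r>0. r < \<eta> \<and> measure \<nu> (cball x (5 * r)) \<le> c * r"
  shows "emeasure \<nu> S \<le> ennreal c * emeasure lborel G"
proof -
  interpret finite_measure \<nu> by fact
  define K where "K = {(x, r). x \<in> S \<and> 0 < r \<and> r \<le> 1 \<and> cball x r \<subseteq> G \<and> measure \<nu> (cball x (5 * r)) \<le> c * r}"
  have "S \<subseteq> (\<Union>i\<in>K. cball (fst i) (snd i))"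
  proof
    fix x assume x: "x \<in> S"
    then obtain \<eta> where \<eta>: "\<eta> > 0" "cball x \<eta> \<subseteq> G" using G open_contains_cball by blast
    obtain r where r: "r > 0" "r < min 1 \<eta>" "measure \<nu> (cball x (5 * r)) \<le> c * r"
      using small[OF x, of "min 1 \<eta>"] \<eta>(1) by auto
    then have "cball x r \<subseteq> G" using \<eta>(2) by (meson min_less_iff_conj less_imp_le subset_cball subset_trans)
    then have "(x, r) \<in> K" using x r by (auto simp: K_def)
    then show "x \<in> (\<Union>i\<in>K. cball (fst i) (snd i))" using r(1) by force
  qed
  moreover have "0 < snd i \<and> snd i \<le> 1" if "i \<in> K" for i using that by (auto simp: K_def)
  ultimately obtain D where D: "countable D" "D \<subseteq> K"
      "pairwise (\<lambda>i j. disjnt (cball (fst i) (snd i)) (cball (fst j) (snd j))) D"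
      "S \<subseteq> (\<Union>i\<in>D. cball (fst i) (5 * snd i))"
    by (rule Vitali_covering_lemma_cballs)
  have "emeasure \<nu> S \<le> emeasure \<nu> (\<Union>i\<in>D. cball (fst i) (5 * snd i))"
    using D(1,4) sets by (intro emeasure_mono) (auto intro!: sets.countable_UN'')
  also have "\<dots> \<le> (\<integral>\<^sup>+i. emeasure \<nu> (cball (fst i) (5 * snd i)) \<partial>count_space D)"
    using D(1) sets by (intro emeasure_UN_countable_le) auto
  also have "\<dots> \<le> (\<integral>\<^sup>+i. ennreal c * emeasure lborel (cball (fst i) (snd i)) \<partial>count_space D)"
  proof (intro nn_integral_mono)
    fix i assume "i \<in> space (count_space D)"
    then have i: "i \<in> K" using D(2) by auto
    then have pos: "snd i > 0" by (auto simp: K_def)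
    have "emeasure \<nu> (cball (fst i) (5 * snd i)) \<le> ennreal (c * snd i)"
      using i by (auto simp: K_def emeasure_eq_measure intro!: ennreal_leI)
    also have "\<dots> \<le> ennreal (c * (2 * snd i))" using pos c by (intro ennreal_leI mult_left_mono) auto
    also have "\<dots> = ennreal c * emeasure lborel (cball (fst i) (snd i))"
      using pos c by (simp add: cball_eq_atLeastAtMost ennreal_mult)
    finally show "emeasure \<nu> (cball (fst i) (5 * snd i)) \<le> ennreal c * emeasure lborel (cball (fst i) (snd i))" .
  qed
  also have "\<dots> = ennreal c * (\<integral>\<^sup>+i. emeasure lborel (cball (fst i) (snd i)) \<partial>count_space D)"
    by (rule nn_integral_cmult) auto
  also have "(\<integral>\<^sup>+i. emeasure lborel (cball (fst i) (snd i)) \<partial>count_space D) = emeasure lborel (\<Union>i\<in>D. cball (fst i) (snd i))"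
    using D(1,3) by (intro emeasure_UN_countable[symmetric])
      (auto simp: disjoint_family_on_def pairwise_def disjnt_def)
  also have "\<dots> \<le> emeasure lborel G"
  proof (rule emeasure_mono)
    have "cball (fst i) (snd i) \<subseteq> G" if "i \<in> D" for i
      using subsetD[OF D(2) that] by (simp add: K_def case_prod_unfold)
    then show "(\<Union>i\<in>D. cball (fst i) (snd i)) \<subseteq> G" by blast
  qed (use G(1) in simp)
  finally show ?thesis by (simp add: mult_left_mono)
qed

text \<open>In the Schwarz-Pick inequality the heights \<open>Im z\<close> and \<open>Im w\<close>
  cancel against the assumed bound, so \<open>f\<close> is Lipschitz near \<open>x\<close>. It
  therefore extends continuously to the axis, where the same bound makes it real, and reflection
  applies.\<close>

lemma regular_at_of_linear_bound:
  assumes f: "half_plane_self_map f" and ab: "a < x" "x < b"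
    and bound: "\<And>z. a \<le> Re z \<Longrightarrow> Re z \<le> b \<Longrightarrow> Im z > 0 \<Longrightarrow> Im (f z) \<le> K * Im z"
  shows "regular_at f x"
proof -
  define e where "e = min (x - a) (b - x)"
  have e: "e > 0" using ab by (simp add: e_def)
  define U where "U = ball (complex_of_real x) e \<inter> {z. Im z > 0}"
  have U: "a \<le> Re z" "Re z \<le> b" "Im z > 0" if "z \<in> U" for z
  proof -
    have "\<bar>Re (of_real x - z)\<bar> < e"
      using that abs_Re_le_cmod[of "of_real x - z"] by (auto simp: U_def dist_norm)
    then show "a \<le> Re z" "Re z \<le> b" by (auto simp: e_def)
    show "Im z > 0" using that by (simp add: U_def)
  qed
  have K: "K \<ge> 0"
  proof -
    have "0 < Im (f (Complex x 1))" using half_plane_self_mapD(2)[OF f] by simp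
    also have "\<dots> \<le> K" using bound[of "Complex x 1"] ab by simp
    finally show ?thesis by simp
  qed
  have "K-lipschitz_on U f"
  proof (rule lipschitz_onI)
    fix z w assume zw: "z \<in> U" "w \<in> U"
    note z = U[OF zw(1)] and w = U[OF zw(2)]
    have "(cmod (f z - f w))\<^sup>2 * (Im z * Im w) \<le> (cmod (z - w))\<^sup>2 * (Im (f z) * Im (f w))"
      using schwarz_pick(1)[OF f z(3) w(3)] .
    also have "\<dots> \<le> (cmod (z - w))\<^sup>2 * ((K * Im z) * (K * Im w))"
      using bound[OF z] bound[OF w] half_plane_self_mapD(2)[OF f] z(3) w(3) K
      by (intro mult_left_mono mult_mono) (auto simp: less_imp_le)
    also have "\<dots> = (K * cmod (z - w))\<^sup>2 * (Im z * Im w)" by (simp add: power2_eq_square)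
    finally have "(cmod (f z - f w))\<^sup>2 \<le> (K * cmod (z - w))\<^sup>2"
      using z(3) w(3) by (simp add: mult_le_cancel_right_pos)
    then have "cmod (f z - f w) \<le> K * cmod (z - w)" by (rule power2_le_imp_le) (use K in simp)
    then show "dist (f z) (f w) \<le> K * dist z w" by (simp add: dist_norm)
  qed (rule K)
  then obtain g where g: "K-lipschitz_on (closure U) g" "\<And>z. z \<in> U \<Longrightarrow> g z = f z"
    using lipschitz_extend_closure by blast
  have cont: "continuous_on (closure U) g" using g(1) by (rule lipschitz_on_continuous_on)
  have up: "\<forall>\<^sub>F t in at_right 0. z + \<i> * of_real t \<in> U" if "z \<in> ball (complex_of_real x) e" "Im z \<ge> 0" for z
  proof -
    have "((\<lambda>t. z + \<i> * of_real t) \<longlongrightarrow> z + \<i> * of_real 0) (at_right 0)" by (intro tendsto_intros)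
    then have "\<forall>\<^sub>F t in at_right 0. z + \<i> * of_real t \<in> ball (complex_of_real x) e"
      using that(1) by (intro topological_tendstoD) auto
    then show ?thesis
      using eventually_at_right_less[of 0] by eventually_elim (use that(2) in \<open>auto simp: U_def\<close>)
  qed
  have cl: "ball (complex_of_real x) e \<inter> {z. 0 \<le> Im z} \<subseteq> closure U"
  proof
    fix z assume z: "z \<in> ball (complex_of_real x) e \<inter> {z. 0 \<le> Im z}"
    have "((\<lambda>t. z + \<i> * of_real t) \<longlongrightarrow> z + \<i> * of_real 0) (at_right 0)" by (intro tendsto_intros)
    then show "z \<in> closure U"
      using z up[of z] by (intro Lim_in_closed_set[of "closure U" "\<lambda>t. z + \<i> * of_real t" "at_right 0"])
        (auto elim: eventually_mono intro: subsetD[OF closure_subset])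
  qed
  show ?thesis
  proof (rule regular_atI[OF e half_plane_self_mapD(1)[OF f]])
    show "continuous_on (ball (of_real x) e \<inter> {z. 0 \<le> Im z}) g"
      using cont cl by (rule continuous_on_subset)
    show "g z = f z" if "z \<in> ball (complex_of_real x) e" "Im z > 0" for z
      using that by (intro g) (auto simp: U_def)
  next
    fix y assume "\<bar>y - x\<bar> < e"
    then have y: "complex_of_real y \<in> ball (of_real x) e"
      by (simp add: dist_norm abs_minus_commute flip: of_real_diff)
    have lim0: "((\<lambda>t. of_real y + \<i> * of_real t) \<longlongrightarrow> complex_of_real y + \<i> * of_real 0) (at_right 0)"
      by (intro tendsto_intros)
    have evU: "\<forall>\<^sub>F t in at_right 0. complex_of_real y + \<i> * of_real t \<in> U" using up[OF y] by simp
    have "((\<lambda>t. g (of_real y + \<i> * of_real t)) \<longlongrightarrow> g (of_real y)) (at_right 0)"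
      using cont lim0 y cl evU
      by (intro continuous_on_tendsto_compose[of "closure U" g])
        (auto elim: eventually_mono intro: subsetD[OF closure_subset])
    then have "((\<lambda>t. Im (g (of_real y + \<i> * of_real t))) \<longlongrightarrow> Im (g (of_real y))) (at_right 0)"
      by (rule tendsto_Im)
    moreover have "((\<lambda>t. Im (g (of_real y + \<i> * of_real t))) \<longlongrightarrow> 0) (at_right 0)"
    proof (rule tendsto_sandwich[of "\<lambda>_. 0" _ _ "\<lambda>t. K * t"])
      show "\<forall>\<^sub>F t in at_right 0. 0 \<le> Im (g (of_real y + \<i> * of_real t))"
        using evU
      proof eventually_elim
        case (elim t)
        then show ?case
          using g(2)[OF elim] half_plane_self_mapD(2)[OF f U(3)[OF elim]] by (simp only: less_imp_le)
      qed
      show "\<forall>\<^sub>F t in at_right 0. Im (g (of_real y + \<i> * of_real t)) \<le> K * t"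
        using evU
      proof eventually_elim
        case (elim t)
        then show ?case using g(2)[OF elim] bound[OF U[OF elim]] by simp
      qed
      have "((\<lambda>t. K * t) \<longlongrightarrow> K * 0) (at_right 0)" by (intro tendsto_intros)
      then show "((\<lambda>t. K * t) \<longlongrightarrow> 0) (at_right 0)" by simp
    qed simp
    ultimately show "Im (g (of_real y)) = 0"
      using tendsto_unique trivial_limit_at_right_real by blast
  qed
qed

text \<open>If \<open>Im f\<close> has vanishing vertical limits almost everywhere on an interval, then the representing
  measure is singular there, and it charges only points at which \<open>f\<close> tends vertically to \<open>\<infinity>\<close>.\<close>

lemma regular_at_of_boundary_limits:
  assumes f: "half_plane_self_map f"
    and zero: "AE x in lborel. a < x \<and> x < b \<longrightarrow> ((\<lambda>t. Im (f (Complex x t))) \<longlongrightarrow> 0) (at_right 0)"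
    and no_pole: "\<And>x. a < x \<Longrightarrow> x < b \<Longrightarrow> \<not> filterlim (\<lambda>t. f (Complex x t)) at_infinity (at_right 0)"
    and x: "a < x" "x < b"
  shows "regular_at f x"
proof -
  obtain \<nu> :: "real measure" and C where \<nu>: "sets \<nu> = sets borel" "finite_measure \<nu>" "C > 0"
    and ball: "\<And>x \<epsilon>. \<epsilon> > 0 \<Longrightarrow> measure \<nu> (cball x (5 * \<epsilon>)) \<le> C * \<epsilon> * Im (f (Complex x \<epsilon>))"
    and lin: "\<And>a a' b' b. a < a' \<Longrightarrow> a' < b' \<Longrightarrow> b' < b \<Longrightarrow> emeasure \<nu> {a<..<b} = 0 \<Longrightarrow>
       \<exists>K. \<forall>z. a' \<le> Re z \<and> Re z \<le> b' \<and> Im z > 0 \<longrightarrow> Im (f z) \<le> K * Im z"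
    using boundary_measure[OF f] by blast
  interpret finite_measure \<nu> by fact
  note [measurable_cong] = \<nu>(1)
  define J where "J = {a<..<b}"
  obtain N where N: "N \<in> null_sets lborel"
      "\<And>x. x \<in> J - N \<Longrightarrow> ((\<lambda>t. Im (f (Complex x t))) \<longlongrightarrow> 0) (at_right 0)"
  proof -
    from AE_E[OF zero] obtain N where N: "{x \<in> space lborel. \<not> (a < x \<and> x < b \<longrightarrow> ((\<lambda>t. Im (f (Complex x t))) \<longlongrightarrow> 0) (at_right 0))} \<subseteq> N"
      "emeasure lborel N = 0" "N \<in> sets lborel" by blast
    show thesis by (rule that[of N]) (use N in \<open>auto simp: J_def null_sets_def\<close>)
  qed
  have Nb: "N \<in> sets borel" using N(1) by auto
  have ball': "measure \<nu> (cball x (5 * r)) \<le> C * k * r" if "r > 0" "Im (f (Complex x r)) \<le> k" for x r k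
  proof -
    have "C * r * Im (f (Complex x r)) \<le> C * r * k" using that \<nu>(3) by (intro mult_left_mono) auto
    then show ?thesis using ball[OF that(1), of x] by (simp add: mult_ac)
  qed
  \<comment> \<open>Off \<open>N\<close> the heights tend to 0, so the covering estimate holds with
    an arbitrarily small constant on an interval of finite length.\<close>
  have Z: "emeasure \<nu> (J - N) = 0"
  proof -
    have "emeasure \<nu> (J - N) \<le> ennreal e" if e: "e > 0" for e
    proof -
      define k where "k = e / (C * (b - a))"
      have k: "k > 0" using e \<nu>(3) x by (simp add: k_def)
      have "emeasure \<nu> (J - N) \<le> ennreal (C * k) * emeasure lborel J"
      proof (rule emeasure_le_of_small_balls[OF \<nu>(1,2)])
        fix x \<eta> :: real assume x: "x \<in> J - N" "\<eta> > 0"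
        have "\<forall>\<^sub>F t in at_right 0. Im (f (Complex x t)) < k"
          using order_tendstoD(2)[OF N(2)[OF x(1)] k] .
        moreover have "\<forall>\<^sub>F t in at_right 0. 0 < t \<and> t < \<eta>"
          using x(2) by (auto simp: eventually_at_right_field)
        ultimately have "\<forall>\<^sub>F t in at_right (0::real). 0 < t \<and> t < \<eta> \<and> Im (f (Complex x t)) < k"
          by eventually_elim auto
        then obtain r where "0 < r" "r < \<eta>" "Im (f (Complex x r)) < k"
          using eventually_happens trivial_limit_at_right_real by blast
        then show "\<exists>r>0. r < \<eta> \<and> measure \<nu> (cball x (5 * r)) \<le> C * k * r"
          using ball'[of r x k] by (intro exI[of _ r]) auto
      qed (use k \<nu>(3) in \<open>auto simp: J_def\<close>)
      also have "\<dots> = ennreal e" using x e \<nu>(3) k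
        by (simp add: J_def k_def flip: ennreal_mult)
      finally show ?thesis .
    qed
    then have "emeasure \<nu> (J - N) \<le> 0" by - (rule ennreal_le_epsilon, simp)
    then show ?thesis by simp
  qed
  \<comment> \<open>The points of \<open>N\<close> at which \<open>Im f\<close> falls below
    \<open>k\<close> at arbitrarily small heights. Here the constant in the covering estimate is
    fixed, but \<open>N\<close> lies in open sets of arbitrarily small length. The scales
    \<open>inverse (real (Suc n))\<close> make \<open>S k\<close> Borel as a countable
    intersection.\<close>
  define S where "S k = {x \<in> J \<inter> N. \<forall>n. \<exists>r>0. r < inverse (real (Suc n)) \<and> Im (f (Complex x r)) < k}" for k :: real
  have S_meas: "S k \<in> sets borel" for k
  proof -
    have op: "open {x. \<exists>r>0. r < d \<and> Im (f (Complex x r)) < k}" for d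
    proof -
      have "open {x. Im (f (Complex x r)) < k}" if "r > 0" for r
      proof (rule open_Collect_less)
        have "continuous_on UNIV (\<lambda>x. complex_of_real x + \<i> * of_real r)"
          by (intro continuous_intros)
        moreover have "(\<lambda>x. complex_of_real x + \<i> * of_real r) ` UNIV \<subseteq> upper_half_plane"
          using that by auto
        ultimately have "continuous_on UNIV (\<lambda>x. f (complex_of_real x + \<i> * of_real r))"
          by (rule continuous_on_compose2[OF holomorphic_on_imp_continuous_on[OF half_plane_self_mapD(1)[OF f]]])
        then have "continuous_on UNIV (\<lambda>x. f (Complex x r))" by (simp add: Complex_eq)
        then show "continuous_on UNIV (\<lambda>x. Im (f (Complex x r)))" by (intro continuous_intros)
      qed auto
      then have "open (\<Union>r\<in>{0<..<d}. {x. Im (f (Complex x r)) < k})" by auto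
      moreover have "(\<Union>r\<in>{0<..<d}. {x. Im (f (Complex x r)) < k}) = {x. \<exists>r>0. r < d \<and> Im (f (Complex x r)) < k}"
        by auto
      ultimately show ?thesis by simp
    qed
    have "S k = (J \<inter> N) \<inter> (\<Inter>n. {x. \<exists>r>0. r < inverse (real (Suc n)) \<and> Im (f (Complex x r)) < k})"
      by (auto simp: S_def)
    moreover have "\<dots> \<in> sets borel" using Nb op by (intro sets.Int sets.countable_INT) (auto simp: J_def)
    ultimately show ?thesis by simp
  qed
  have S0: "emeasure \<nu> (S k) = 0" if k: "k > 0" for k
  proof -
    have "emeasure \<nu> (S k) \<le> ennreal e" if e: "e > 0" for e
    proof -
      define d where "d = e / (C * k)"
      have d: "d > 0" using e \<nu>(3) k by (simp add: d_def)
      obtain U where U: "open U" "N \<subseteq> U" "emeasure lborel (U - N) \<le> d"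
        using outer_regular_lborel_le[OF Nb d] by blast
      have "emeasure lborel U \<le> emeasure lborel (U - N) + emeasure lborel N"
        using U(1) Nb by (intro order.trans[OF emeasure_mono emeasure_subadditive]) auto
      then have Ud: "emeasure lborel U \<le> d" using U(3) N(1) by (simp add: null_sets_def)
      have "emeasure \<nu> (S k) \<le> ennreal (C * k) * emeasure lborel U"
      proof (rule emeasure_le_of_small_balls[OF \<nu>(1,2) U(1)])
        show "S k \<subseteq> U" using U(2) by (auto simp: S_def)
        fix x \<eta> :: real assume x: "x \<in> S k" "\<eta> > 0"
        obtain n where "inverse (real (Suc n)) < \<eta>" using reals_Archimedean[OF x(2)] by blast
        moreover obtain r where "r > 0" "r < inverse (real (Suc n))" "Im (f (Complex x r)) < k"
          using x(1) unfolding S_def by blast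
        ultimately show "\<exists>r>0. r < \<eta> \<and> measure \<nu> (cball x (5 * r)) \<le> C * k * r"
          using ball'[of r x k] by (intro exI[of _ r]) auto
      qed (use k \<nu>(3) in auto)
      also have "\<dots> \<le> ennreal (C * k) * ennreal d" using Ud by (intro mult_left_mono) auto
      also have "\<dots> = ennreal e" using e \<nu>(3) k d by (simp add: d_def flip: ennreal_mult)
      finally show ?thesis .
    qed
    then have "emeasure \<nu> (S k) \<le> 0" by - (rule ennreal_le_epsilon, simp)
    then show ?thesis by simp
  qed
  \<comment> \<open>A point of \<open>N\<close> outside every \<open>S k\<close> has
    \<open>Im f\<close> eventually above each bound, so \<open>f\<close> tends to infinity there,
    contrary to \<open>no_pole\<close>.\<close>
  have "J \<subseteq> (J - N) \<union> (\<Union>k::nat. S (real (Suc k)))"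
  proof
    fix x assume x: "x \<in> J"
    show "x \<in> (J - N) \<union> (\<Union>k::nat. S (real (Suc k)))"
    proof (rule ccontr)
      assume "x \<notin> (J - N) \<union> (\<Union>k::nat. S (real (Suc k)))"
      then have xN: "x \<in> J \<inter> N" and xS: "x \<notin> S (real (Suc k))" for k using x by blast+
      have n: "\<exists>n. \<forall>r>0. r < inverse (real (Suc n)) \<longrightarrow> real (Suc k) \<le> Im (f (Complex x r))" for k
      proof -
        have "\<not> (\<forall>n. \<exists>r>0. r < inverse (real (Suc n)) \<and> Im (f (Complex x r)) < real (Suc k))"
          using xN xS[of k] unfolding S_def by blast
        then show ?thesis by (meson not_less)
      qed
      have "filterlim (\<lambda>t. f (Complex x t)) at_infinity (at_right 0)"
        unfolding filterlim_at_infinity[OF order.refl]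
      proof safe
        fix R :: real
        obtain k where "R \<le> real k" using real_arch_simple by blast
        then have k: "R \<le> real (Suc k)" by simp
        from n[of k] obtain m where m: "\<And>r. r > 0 \<Longrightarrow> r < inverse (real (Suc m)) \<Longrightarrow> Im (f (Complex x r)) \<ge> real (Suc k)"
          by blast
        show "\<forall>\<^sub>F t in at_right 0. R \<le> cmod (f (Complex x t))"
          unfolding eventually_at_right_field
        proof (intro exI[of _ "inverse (real (Suc m))"] conjI allI impI)
          fix t :: real assume "0 < t" "t < inverse (real (Suc m))"
          from m[OF this] show "R \<le> cmod (f (Complex x t))"
            using k abs_Im_le_cmod[of "f (Complex x t)"] by linarith
        qed simp
      qed
      then show False using no_pole[of x] x by (auto simp: J_def)
    qed
  qed
  moreover have "(J - N) \<union> (\<Union>k::nat. S (real (Suc k))) \<in> null_sets \<nu>"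
    using Z S0 S_meas Nb by (intro null_sets.Un null_sets_UN) (auto simp: null_sets_def \<nu>(1) J_def)
  ultimately have "emeasure \<nu> {a<..<b} = 0"
    using \<nu>(1) null_sets_subset[of _ \<nu> J] by (auto simp: J_def null_sets_def)
  then obtain K where "\<And>z. (a + x) / 2 \<le> Re z \<Longrightarrow> Re z \<le> (x + b) / 2 \<Longrightarrow> Im z > 0 \<Longrightarrow> Im (f z) \<le> K * Im z"
    using lin[of a "(a + x) / 2" "(x + b) / 2" b] x by force
  then show ?thesis using x by (intro regular_at_of_linear_bound[OF f, of "(a + x) / 2" x "(x + b) / 2" K]) auto
qed

section \<open>The map at infinity and its boundary limits\<close>

definition boundary_limit_exists :: "(complex \<Rightarrow> complex) \<Rightarrow> real \<Rightarrow> bool" where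
  "boundary_limit_exists f x \<longleftrightarrow>
     (\<exists>L. (f \<longlongrightarrow> complex_of_real L) (vertical_filter x)) \<or> filterlim f at_infinity (vertical_filter x)"

text \<open>Approach to infinity without angular restriction. Holomorphy of \<open>g\<close> around
  \<open>q\<close> yields limits in this strong sense, and they still control the map at points
  arbitrarily close to the real line.\<close>

definition half_plane_infinity :: "complex filter" where
  "half_plane_infinity = inf at_infinity (principal upper_half_plane)"

lemma eventually_half_plane_infinity:
  "eventually P half_plane_infinity \<longleftrightarrow> (\<exists>R. \<forall>z. R \<le> cmod z \<and> Im z > 0 \<longrightarrow> P z)"
  unfolding half_plane_infinity_def eventually_inf_principal eventually_at_infinity by auto

section \<open>The disc model and its boundary limits\<close>

locale doubly_parabolic_model =
  fixes g h :: "complex \<Rightarrow> complex" and q A B :: complex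
  assumes inner: "inner_function g" and dp: "doubly_parabolic_at g q" and A: "A \<noteq> 0"
    and image: "(\<lambda>z. A / (z - q) + B) ` ball 0 1 = upper_half_plane"
    and conj: "\<And>z. z \<in> ball 0 1 \<Longrightarrow> h (A / (z - q) + B) = A / (g z - q) + B"
begin

definition moeb :: "complex \<Rightarrow> complex" where "moeb z = A / (z - q) + B"
definition moeb_inv :: "complex \<Rightarrow> complex" where "moeb_inv \<zeta> = q + A / (\<zeta> - B)"

lemma q: "cmod q = 1" using dp by (simp add: doubly_parabolic_at_def)

lemma ball_neq_q: "z \<in> ball 0 1 \<Longrightarrow> z \<noteq> q" using q by auto

lemma g_ball: "z \<in> ball 0 1 \<Longrightarrow> g z \<in> ball 0 1"
  using inner unfolding inner_function_def by blast

lemma moeb_Im: "z \<in> ball 0 1 \<Longrightarrow> Im (moeb z) > 0"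
  using image unfolding moeb_def by blast

lemma moeb_inv_moeb: "z \<noteq> q \<Longrightarrow> moeb_inv (moeb z) = z"
  using A by (simp add: moeb_def moeb_inv_def)

lemma moeb_inv:
  assumes "Im \<zeta> > 0"
  shows "moeb_inv \<zeta> \<in> ball 0 1" "moeb (moeb_inv \<zeta>) = \<zeta>" "\<zeta> \<noteq> B"
proof -
  obtain z where z: "z \<in> ball 0 1" "\<zeta> = moeb z" using image assms by (force simp: moeb_def)
  have "moeb_inv \<zeta> = z" using z moeb_inv_moeb ball_neq_q by simp
  then show "moeb_inv \<zeta> \<in> ball 0 1" "moeb (moeb_inv \<zeta>) = \<zeta>" using z by simp_all
  show "\<zeta> \<noteq> B" using z A ball_neq_q[OF z(1)] by (auto simp: moeb_def)
qed

lemma h_eq: "Im \<zeta> > 0 \<Longrightarrow> h \<zeta> = moeb (g (moeb_inv \<zeta>))"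
  using conj[OF moeb_inv(1), of \<zeta>] moeb_inv(2)[of \<zeta>] by (simp add: moeb_def)

lemma holomorphic_moeb: "q \<notin> S \<Longrightarrow> moeb holomorphic_on S"
  unfolding moeb_def by (intro holomorphic_intros) auto

lemma moeb_comp_self_map:
  assumes "k holomorphic_on upper_half_plane" "k ` upper_half_plane \<subseteq> ball 0 1"
  shows "half_plane_self_map (\<lambda>z. moeb (k z))"
proof -
  have "(moeb \<circ> k) holomorphic_on upper_half_plane"
    using assms ball_neq_q by (intro holomorphic_on_compose_gen[OF _ holomorphic_moeb[of "ball 0 1"]]) blast+
  then show ?thesis using assms moeb_Im by (auto simp: half_plane_self_map_def o_def)
qed

lemma h_self_map: "half_plane_self_map h"
proof -
  have "moeb_inv holomorphic_on upper_half_plane"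
    unfolding moeb_inv_def using moeb_inv(3) by (intro holomorphic_intros) auto
  then have "(g \<circ> moeb_inv) holomorphic_on upper_half_plane"
    using inner moeb_inv(1) unfolding inner_function_def
    by (intro holomorphic_on_compose_gen[of _ _ g "ball 0 1"]) auto
  then have "half_plane_self_map (\<lambda>z. moeb (g (moeb_inv z)))"
    using g_ball moeb_inv(1) by (intro moeb_comp_self_map) (auto simp: o_def)
  moreover have "(\<lambda>z. moeb (g (moeb_inv z))) holomorphic_on upper_half_plane \<longleftrightarrow> h holomorphic_on upper_half_plane"
    using h_eq by (intro holomorphic_cong) auto
  ultimately show ?thesis using h_eq by (auto simp: half_plane_self_map_def)
qed

text \<open>As a limit of points of the half-plane the value has nonnegative imaginary part; were it
  positive, \<open>moeb_inv\<close> would place \<open>z\<close> inside the open disc.\<close>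

lemma moeb_real:
  assumes z: "cmod z = 1" "z \<noteq> q"
  shows "Im (moeb z) = 0"
proof -
  have "((\<lambda>r. moeb (of_real r * z)) \<longlongrightarrow> moeb (of_real 1 * z)) (at_left 1)"
    unfolding moeb_def using z by (intro tendsto_intros) auto
  then have lim: "((\<lambda>r. Im (moeb (of_real r * z))) \<longlongrightarrow> Im (moeb z)) (at_left 1)"
    using tendsto_Im by fastforce
  have "\<forall>\<^sub>F r in at_left 1. 0 \<le> Im (moeb (of_real r * z))"
    unfolding eventually_at_left_field
    using z by (intro exI[of _ 0]) (auto intro!: less_imp_le moeb_Im simp: norm_mult)
  then have "Im (moeb z) \<ge> 0"
    using tendsto_lowerbound[OF lim] by simp
  moreover have "\<not> Im (moeb z) > 0"
  proof
    assume *: "Im (moeb z) > 0"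
    have "moeb_inv (moeb z) = z" using moeb_inv_moeb z by simp
    then show False using moeb_inv(1)[OF *] z by simp
  qed
  ultimately show ?thesis by simp
qed

lemma moeb_surj_circle:
  assumes B: "complex_of_real x \<noteq> B"
  obtains \<theta> where "cis \<theta> \<noteq> q" "moeb (cis \<theta>) = complex_of_real x"
proof -
  define z where "z = moeb_inv (of_real x)"
  have zq: "z \<noteq> q" using A B by (simp add: z_def moeb_inv_def)
  have mz: "moeb z = of_real x" using A B by (simp add: z_def moeb_inv_def moeb_def)
  have "((\<lambda>t. moeb_inv (of_real x + \<i> * of_real t)) \<longlongrightarrow> moeb_inv (of_real x + \<i> * of_real 0)) (at_right 0)"
    unfolding moeb_inv_def using B by (intro tendsto_intros) auto
  then have lim: "((\<lambda>t. cmod (moeb_inv (of_real x + \<i> * of_real t))) \<longlongrightarrow> cmod z) (at_right 0)"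
    unfolding z_def using tendsto_norm by fastforce
  have "\<forall>\<^sub>F t in at_right 0. cmod (moeb_inv (of_real x + \<i> * of_real t)) \<le> 1"
    using eventually_at_right_less[of 0]
  proof eventually_elim
    case (elim t)
    then show ?case using moeb_inv(1)[of "of_real x + \<i> * of_real t"] by simp
  qed
  then have "cmod z \<le> 1" using tendsto_upperbound[OF lim] by simp
  moreover have "\<not> cmod z < 1" using moeb_Im[of z] mz by auto
  ultimately have z1: "cmod z = 1" by simp
  then have "cis (Arg z) = z" using cis_Arg[of z] by (cases "z = 0") (auto simp: sgn_eq)
  then show thesis using that[of "Arg z"] zq mz by simp
qed

text \<open>The exponential unrolls the circle: radii of the disc become vertical lines and angles
  become real boundary points, so the half-plane results apply to radial limits of
  \<open>g\<close>.\<close>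

definition circle_map :: "complex \<Rightarrow> complex" where "circle_map u = moeb (exp (\<i> * u))"

lemma exp_ball: "Im u > 0 \<Longrightarrow> exp (\<i> * u) \<in> ball 0 1"
  by (simp add: norm_exp_eq_Re)

lemma circle_map_self_map: "half_plane_self_map circle_map"
  unfolding circle_map_def using exp_ball by (intro moeb_comp_self_map holomorphic_intros) auto

lemma g_circle_map_self_map: "half_plane_self_map (\<lambda>u. moeb (g (exp (\<i> * u))))"
proof (rule moeb_comp_self_map)
  have "(g \<circ> (\<lambda>u. exp (\<i> * u))) holomorphic_on upper_half_plane"
    using inner exp_ball unfolding inner_function_def
    by (intro holomorphic_on_compose_gen[of _ _ g "ball 0 1"] holomorphic_intros) auto
  then show "(\<lambda>u. g (exp (\<i> * u))) holomorphic_on upper_half_plane" by (simp add: o_def)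
qed (use exp_ball g_ball in auto)

lemma h_circle_map: "Im u > 0 \<Longrightarrow> h (circle_map u) = moeb (g (exp (\<i> * u)))"
  using conj[OF exp_ball] by (simp add: circle_map_def moeb_def)

lemma exp_i_of_real: "exp (\<i> * complex_of_real \<theta>) = cis \<theta>"
  by (simp add: cis_conv_exp)

lemma circle_map_regular:
  assumes \<theta>: "cis \<theta> \<noteq> q"
  shows "regular_at circle_map \<theta>" "boundary_value circle_map \<theta> = Re (moeb (cis \<theta>))"
proof -
  have "open {u. exp (\<i> * u) \<noteq> q}"
    by (intro open_Collect_neq continuous_intros)
  moreover have "complex_of_real \<theta> \<in> {u. exp (\<i> * u) \<noteq> q}" using \<theta> by (simp add: exp_i_of_real)
  ultimately obtain e where e: "e > 0" "ball (complex_of_real \<theta>) e \<subseteq> {u. exp (\<i> * u) \<noteq> q}"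
    by (meson open_contains_ball)
  have hol: "circle_map holomorphic_on ball (of_real \<theta>) e"
    unfolding circle_map_def moeb_def using e by (intro holomorphic_intros) auto
  show "regular_at circle_map \<theta>"
  proof (rule regular_atI[OF e(1) half_plane_self_mapD(1)[OF circle_map_self_map]])
    show "continuous_on (ball (of_real \<theta>) e \<inter> {z. 0 \<le> Im z}) circle_map"
      using holomorphic_on_imp_continuous_on[OF hol] by (rule continuous_on_subset) auto
    fix y assume "\<bar>y - \<theta>\<bar> < e"
    then have "complex_of_real y \<in> ball (of_real \<theta>) e"
      by (simp add: dist_norm abs_minus_commute flip: of_real_diff)
    then have "exp (\<i> * of_real y) \<noteq> q" using e by blast
    then have "cis y \<noteq> q" by (simp add: exp_i_of_real)
    then show "Im (circle_map (of_real y)) = 0"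
      unfolding circle_map_def exp_i_of_real by (intro moeb_real) auto
  qed auto
  have "(circle_map \<longlongrightarrow> circle_map (of_real \<theta>)) (vertical_filter \<theta>)"
    using tendsto_vertical_continuous(1)[OF e(1) hol] by simp
  moreover have "circle_map (of_real \<theta>) = of_real (Re (moeb (cis \<theta>)))"
    unfolding circle_map_def exp_i_of_real using moeb_real[of "cis \<theta>"] \<theta> by (simp add: complex_eq_iff)
  ultimately show "boundary_value circle_map \<theta> = Re (moeb (cis \<theta>))"
    by (intro boundary_value_eqI) simp
qed

text \<open>The radial limit of \<open>g\<close> is first upgraded to a limit along the vertical
  filter, in the angular coordinate. Only then is it carried to \<open>h\<close> by the local
  inverse of \<open>circle_map\<close>, which preserves vertical filters but not vertical
  lines.\<close>

lemma boundary_limit_at_circle_point: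
  assumes \<theta>: "cis \<theta> \<noteq> q" and l: "cmod l = 1" "((\<lambda>r. g (of_real r * cis \<theta>)) \<longlongrightarrow> l) (at_left 1)"
  shows "boundary_limit_exists h (Re (moeb (cis \<theta>)))"
proof -
  let ?f = "\<lambda>u. moeb (g (exp (\<i> * u)))"
  define x where "x = boundary_value circle_map \<theta>"
  have x: "x = Re (moeb (cis \<theta>))" using circle_map_regular(2)[OF \<theta>] by (simp add: x_def)
  have ex: "exp (\<i> * Complex \<theta> t) = of_real (exp (- t)) * cis \<theta>" for t
    by (simp add: Complex_eq algebra_simps exp_add exp_diff exp_minus exp_of_real cis_conv_exp flip: exp_of_real)
      (simp add: exp_diff exp_minus field_simps)
  have "filterlim (\<lambda>t::real. exp (- t)) (at_left 1) (at_right 0)"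
    unfolding filterlim_at
    by (auto intro!: tendsto_eq_intros simp: eventually_at_right_field intro: exI[of _ 1])
  from filterlim_compose[OF l(2) this]
  have glim: "((\<lambda>t. g (exp (\<i> * Complex \<theta> t))) \<longlongrightarrow> l) (at_right 0)"
    unfolding ex by simp
  have gball: "\<forall>\<^sub>F t in at_right 0. g (exp (\<i> * Complex \<theta> t)) \<in> ball 0 1"
    using eventually_at_right_less[of 0]
  proof eventually_elim
    case (elim t)
    then show ?case by (intro g_ball exp_ball) simp
  qed
  have lim: "boundary_limit_exists ?f \<theta>"
  proof (cases "l = q")
    case False
    then have "((\<lambda>t. ?f (Complex \<theta> t)) \<longlongrightarrow> moeb l) (at_right 0)"
      unfolding moeb_def using glim by (intro tendsto_intros) auto
    from tendsto_vertical_of_radial[OF g_circle_map_self_map this]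
    have "(?f \<longlongrightarrow> moeb l) (vertical_filter \<theta>)" .
    moreover have "moeb l = of_real (Re (moeb l))"
      using moeb_real[OF l(1) False] by (simp add: complex_eq_iff)
    ultimately show ?thesis unfolding boundary_limit_exists_def by metis
  next
    case True
    have "filterlim (\<lambda>t. g (exp (\<i> * Complex \<theta> t)) - q) (at 0) (at_right 0)"
      unfolding filterlim_at
    proof
      show "\<forall>\<^sub>F t in at_right 0. g (exp (\<i> * Complex \<theta> t)) - q \<in> UNIV \<and> g (exp (\<i> * Complex \<theta> t)) - q \<noteq> 0"
        using gball by eventually_elim (use ball_neq_q in auto)
      show "((\<lambda>t. g (exp (\<i> * Complex \<theta> t)) - q) \<longlongrightarrow> 0) (at_right 0)"
        using tendsto_diff[OF glim tendsto_const[of q]] True by simp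
    qed
    moreover have "filterlim (\<lambda>d. A / d) at_infinity (at 0)"
      by (rule filterlim_divide_at_infinity[OF tendsto_const filterlim_ident A])
    ultimately have "filterlim (\<lambda>t. A / (g (exp (\<i> * Complex \<theta> t)) - q)) at_infinity (at_right 0)"
      by (rule filterlim_compose[rotated])
    then have "filterlim (\<lambda>t. ?f (Complex \<theta> t)) at_infinity (at_right 0)"
      unfolding moeb_def using tendsto_add_filterlim_at_infinity'[OF _ tendsto_const] by blast
    from at_infinity_vertical_of_radial[OF g_circle_map_self_map this]
    show ?thesis unfolding boundary_limit_exists_def by blast
  qed
  show ?thesis
  proof (rule regular_at_local_inverse[OF circle_map_self_map circle_map_regular(1)[OF \<theta>]])
    fix e \<psi>
    assume \<psi>: "e > 0" "\<And>w. w \<in> ball (of_real (boundary_value circle_map \<theta>)) e \<Longrightarrow> Im w > 0 \<Longrightarrow>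
        Im (\<psi> w) > 0 \<and> circle_map (\<psi> w) = w"
      and fl: "filterlim \<psi> (vertical_filter \<theta>) (vertical_filter (boundary_value circle_map \<theta>))"
    have "\<forall>\<^sub>F w in vertical_filter x. w \<in> ball (of_real x) e"
      using tendstoD[OF tendsto_vertical_filter \<psi>(1)] by (simp add: dist_commute)
    then have ev: "\<forall>\<^sub>F w in vertical_filter x. ?f (\<psi> w) = h w"
      using eventually_vertical_Im_pos
    proof eventually_elim
      case (elim w)
      then have "Im (\<psi> w) > 0" "circle_map (\<psi> w) = w" using \<psi>(2)[of w] by (auto simp: x_def)
      then show ?case using h_circle_map[of "\<psi> w"] by simp
    qed
    have fl': "filterlim \<psi> (vertical_filter \<theta>) (vertical_filter x)" using fl by (simp add: x_def)
    have "boundary_limit_exists h x"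
      using lim unfolding boundary_limit_exists_def
    proof (elim disjE exE)
      fix L assume "(?f \<longlongrightarrow> complex_of_real L) (vertical_filter \<theta>)"
      from Lim_transform_eventually[OF filterlim_compose[OF this fl'] ev]
      show "(\<exists>L. (h \<longlongrightarrow> complex_of_real L) (vertical_filter x)) \<or> filterlim h at_infinity (vertical_filter x)"
        by blast
    next
      assume "filterlim ?f at_infinity (vertical_filter \<theta>)"
      from filterlim_compose[OF this fl'] 
      show "(\<exists>L. (h \<longlongrightarrow> complex_of_real L) (vertical_filter x)) \<or> filterlim h at_infinity (vertical_filter x)"
        using filterlim_cong[OF refl refl ev] by simp
    qed
    then show ?thesis by (simp add: x)
  qed
qed

text \<open>Bad boundary points are images of a null set of angles under a differentiable function,
  and such images are null. The single point \<open>Re B\<close> is added because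
  \<open>moeb_surj_circle\<close> excludes the value \<open>B\<close>.\<close>

lemma negligible_no_boundary_limit: "negligible {x. \<not> boundary_limit_exists h x}"
proof -
  have "AE t in lborel. \<exists>l\<in>sphere 0 1. ((\<lambda>r. g (of_real r * cis t)) \<longlongrightarrow> l) (at_left 1)"
    using inner by (simp add: inner_function_def)
  note AE = this
  obtain N where N: "emeasure lborel N = 0" "N \<in> sets lborel"
      "\<And>t. t \<notin> N \<Longrightarrow> \<exists>l\<in>sphere 0 1. ((\<lambda>r. g (of_real r * cis t)) \<longlongrightarrow> l) (at_left 1)"
  proof -
    from AE_E[OF AE] obtain N where N: "{t \<in> space lborel. \<not> (\<exists>l\<in>sphere 0 1. ((\<lambda>r. g (of_real r * cis t)) \<longlongrightarrow> l) (at_left 1))} \<subseteq> N"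
      "emeasure lborel N = 0" "N \<in> sets lborel" by blast
    show thesis using that[OF N(2,3)] N(1) by auto
  qed
  have "N \<in> null_sets lebesgue" using N by (intro null_sets_completionI) (auto simp: null_sets_def)
  then have negN: "negligible (N \<inter> {\<theta>. cis \<theta> \<noteq> q})"
    using negligible_iff_null_sets negligible_Int by blast
  have "boundary_value circle_map differentiable_on (N \<inter> {\<theta>. cis \<theta> \<noteq> q})"
    unfolding differentiable_on_def
  proof
    fix \<theta> assume "\<theta> \<in> N \<inter> {\<theta>. cis \<theta> \<noteq> q}"
    then have "regular_at circle_map \<theta>" by (intro circle_map_regular(1)) simp
    then obtain d where "(boundary_value circle_map has_real_derivative d) (at \<theta>)"
      using regular_has_real_derivative[OF circle_map_self_map] by metis
    then have "boundary_value circle_map differentiable (at \<theta>)" unfolding real_differentiable_def by blast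
    then show "boundary_value circle_map differentiable at \<theta> within N \<inter> {\<theta>. cis \<theta> \<noteq> q}"
      by (rule differentiable_at_withinI)
  qed
  from negligible_differentiable_image_negligible[OF order.refl negN this]
  have "negligible (boundary_value circle_map ` (N \<inter> {\<theta>. cis \<theta> \<noteq> q}) \<union> {Re B})"
    by (intro negligible_Un) auto
  moreover have "{x. \<not> boundary_limit_exists h x} \<subseteq> boundary_value circle_map ` (N \<inter> {\<theta>. cis \<theta> \<noteq> q}) \<union> {Re B}"
  proof safe
    fix x assume bad: "\<not> boundary_limit_exists h x" and nb: "x \<notin> boundary_value circle_map ` (N \<inter> {\<theta>. cis \<theta> \<noteq> q})"
    show "x = Re B"
    proof (rule ccontr)
      assume "x \<noteq> Re B"
      then have "complex_of_real x \<noteq> B" by auto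
      then obtain \<theta> where \<theta>: "cis \<theta> \<noteq> q" "moeb (cis \<theta>) = of_real x" by (rule moeb_surj_circle)
      have bv: "boundary_value circle_map \<theta> = x" using circle_map_regular(2)[OF \<theta>(1)] \<theta>(2) by simp
      then have "\<theta> \<notin> N" using nb \<theta>(1) by blast
      then show False using N(3)[of \<theta>] boundary_limit_at_circle_point[OF \<theta>(1)] bad \<theta>(2) by auto
    qed
  qed
  ultimately show ?thesis using negligible_subset by blast
qed


section \<open>Expansion and regularity of \<open>h\<close> at infinity\<close>

definition g_ext :: "(complex \<Rightarrow> complex) \<Rightarrow> complex set \<Rightarrow> complex fps \<Rightarrow> bool" where
  "g_ext G U F \<longleftrightarrow> open U \<and> q \<in> U \<and> G holomorphic_on U \<and> (\<forall>z \<in> U \<inter> ball 0 1. G z = g z) \<and>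
     (\<lambda>w. G (q + w)) has_fps_expansion F \<and>
     fps_nth F 0 = q \<and> fps_nth F 1 = 1 \<and> fps_nth F 2 = 0 \<and> fps_nth F 3 \<noteq> 0"

lemma g_ext_exists: "\<exists>G U F. g_ext G U F"
  using dp unfolding doubly_parabolic_at_def g_ext_def by blast

lemma g_ext_remainder:
  assumes "g_ext G U F"
  shows "((\<lambda>w. (G (q + w) - q - w) / w ^ 3) \<longlongrightarrow> fps_nth F 3) (at 0)"
proof -
  define D where "D = F - fps_const q - fps_X"
  have D: "(\<lambda>w. G (q + w) - q - w) has_fps_expansion D"
    unfolding D_def using assms unfolding g_ext_def by (intro fps_expansion_intros) auto
  have nth: "fps_nth D 0 = 0" "fps_nth D 1 = 0" "fps_nth D 2 = 0" "fps_nth D 3 = fps_nth F 3" "fps_nth F 3 \<noteq> 0"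
    using assms by (auto simp: D_def g_ext_def fps_X_def)
  have "fps_nth D i = 0" if "i < 3" for i
  proof -
    from that consider "i = 0" | "i = 1" | "i = 2" by linarith
    then show ?thesis by cases (use nth in simp_all)
  qed
  then have "3 \<le> subdegree D" using nth by (intro subdegree_geI) auto
  from has_fps_expansion_imp_tendsto_0[OF has_fps_expansion_shift[OF D this refl]]
  have "((\<lambda>w. if w = 0 then fps_nth D 3 else (G (q + w) - q - w) / w ^ 3) \<longlongrightarrow> fps_nth F 3) (nhds 0)"
    using nth by simp
  then have "((\<lambda>w. if w = 0 then fps_nth D 3 else (G (q + w) - q - w) / w ^ 3) \<longlongrightarrow> fps_nth F 3) (at 0)"
    by (rule filterlim_mono) (auto simp: at_within_def)
  then show ?thesis
    by (rule Lim_transform_eventually) (auto simp: eventually_at_filter)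
qed

text \<open>With \<open>w = A / (\<zeta> - B)\<close> and
  \<open>g (q + w) - q = w * (1 + E * w\<^sup>2)\<close>, inversion turns the cubic term of
  \<open>g\<close> into a displacement asymptotic to a constant over \<zeta>. The missing quadratic
  term is what removes a constant displacement.\<close>

lemma h_expansion_at_infinity:
  obtains \<mu> where "\<mu> \<noteq> 0" "((\<lambda>\<zeta>. \<zeta> * (h \<zeta> - \<zeta>)) \<longlongrightarrow> \<mu>) half_plane_infinity"
proof -
  obtain G U F where GUF: "g_ext G U F" using g_ext_exists by blast
  define a where "a = fps_nth F 3"
  have a: "a \<noteq> 0" using GUF by (simp add: g_ext_def a_def)
  define w where "w \<zeta> = A / (\<zeta> - B)" for \<zeta>
  define e where "e w = (G (q + w) - q - w) / w ^ 3" for w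
  have inf: "filterlim (\<lambda>\<zeta>. \<zeta> - B) at_infinity half_plane_infinity"
    using tendsto_add_filterlim_at_infinity'[OF filterlim_ident tendsto_const[of "-B"]]
    by (auto simp: half_plane_infinity_def intro: filterlim_mono)
  have w0: "(w \<longlongrightarrow> 0) half_plane_infinity"
    unfolding w_def by (rule tendsto_divide_0[OF tendsto_const inf])
  have up: "\<forall>\<^sub>F \<zeta> in half_plane_infinity. Im \<zeta> > 0"
    by (auto simp: eventually_half_plane_infinity)
  have wlim: "filterlim w (at 0) half_plane_infinity"
    unfolding filterlim_at
  proof
    show "\<forall>\<^sub>F \<zeta> in half_plane_infinity. w \<zeta> \<in> UNIV \<and> w \<zeta> \<noteq> 0"
      using up by eventually_elim (use moeb_inv(3) A in \<open>auto simp: w_def\<close>)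
  qed (rule w0)
  have elim: "((\<lambda>\<zeta>. e (w \<zeta>)) \<longlongrightarrow> a) half_plane_infinity"
    using filterlim_compose[OF g_ext_remainder[OF GUF] wlim] by (simp add: e_def a_def)
  have "((\<lambda>\<zeta>. - A * e (w \<zeta>) * (A + B * w \<zeta>) / (1 + e (w \<zeta>) * (w \<zeta>)\<^sup>2)) \<longlongrightarrow>
      - A * a * (A + B * 0) / (1 + a * 0\<^sup>2)) half_plane_infinity"
    using elim w0 by (intro tendsto_intros) auto
  then have lim: "((\<lambda>\<zeta>. - A * e (w \<zeta>) * (A + B * w \<zeta>) / (1 + e (w \<zeta>) * (w \<zeta>)\<^sup>2)) \<longlongrightarrow> - (A\<^sup>2 * a)) half_plane_infinity"
    by (simp add: power2_eq_square mult_ac)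
  have "\<forall>\<^sub>F \<zeta> in half_plane_infinity. q + w \<zeta> \<in> U"
  proof -
    have "((\<lambda>\<zeta>. q + w \<zeta>) \<longlongrightarrow> q + 0) half_plane_infinity" using w0 by (intro tendsto_intros)
    then show ?thesis using GUF by (intro topological_tendstoD) (auto simp: g_ext_def)
  qed
  then have "\<forall>\<^sub>F \<zeta> in half_plane_infinity.
      - A * e (w \<zeta>) * (A + B * w \<zeta>) / (1 + e (w \<zeta>) * (w \<zeta>)\<^sup>2) = \<zeta> * (h \<zeta> - \<zeta>)"
    using up
  proof eventually_elim
    case (elim \<zeta>)
    define v where "v = w \<zeta>"
    have z: "q + v \<in> ball 0 1" using moeb_inv(1)[OF elim(2)] by (simp add: moeb_inv_def v_def w_def)
    have v0: "v \<noteq> 0" using moeb_inv(3)[OF elim(2)] A by (simp add: v_def w_def)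
    have \<zeta>: "\<zeta> = A / v + B" using moeb_inv(3)[OF elim(2)] A by (simp add: v_def w_def)
    have Gg: "G (q + v) = g (q + v)" using GUF elim(1) z by (auto simp: g_ext_def v_def)
    define E where "E = e v"
    have w': "g (q + v) - q = v * (1 + E * v\<^sup>2)"
      unfolding E_def e_def Gg using v0 by (simp add: power3_eq_cube power2_eq_square field_simps)
    have w'0: "1 + E * v\<^sup>2 \<noteq> 0" using w' g_ball[OF z] ball_neq_q by force
    have "h \<zeta> = A / (v * (1 + E * v\<^sup>2)) + B" using conj[OF z] \<zeta> w' by simp
    then have "h \<zeta> - \<zeta> = A / (v * (1 + E * v\<^sup>2)) - A / v" by (simp add: \<zeta>)
    also have "\<dots> = - A * E * v / (1 + E * v\<^sup>2)"
      using v0 w'0 by (simp add: divide_simps) (simp add: power2_eq_square algebra_simps)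
    finally have "\<zeta> * (h \<zeta> - \<zeta>) = (A / v + B) * (- A * E * v / (1 + E * v\<^sup>2))" by (simp only: \<zeta>)
    also have "\<dots> = - A * E * ((A / v + B) * v) / (1 + E * v\<^sup>2)" by simp
    also have "(A / v + B) * v = A + B * v" using v0 by (simp add: distrib_right)
    finally show ?case by (simp add: E_def v_def)
  qed
  with lim have "((\<lambda>\<zeta>. \<zeta> * (h \<zeta> - \<zeta>)) \<longlongrightarrow> - (A\<^sup>2 * a)) half_plane_infinity"
    by (rule Lim_transform_eventually)
  then show thesis using that[of "- (A\<^sup>2 * a)"] A a by simp
qed

text \<open>Near \<open>q\<close> the extension \<open>G\<close> takes the value \<open>q\<close>
  only at \<open>q\<close>, so \<open>moeb\<close> after \<open>G\<close> continues \<open>h\<close>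
  analytically across the axis far out. That this continuation is real on the axis comes from the
  boundary limits of \<open>g\<close>.\<close>

lemma h_regular_near_infinity: "\<exists>R. \<forall>x. R < \<bar>x\<bar> \<longrightarrow> regular_at h x"
proof -
  obtain G U F where GUF: "g_ext G U F" using g_ext_exists by blast
  have U: "open U" "q \<in> U" "G holomorphic_on U" "\<And>z. z \<in> U \<Longrightarrow> z \<in> ball 0 1 \<Longrightarrow> G z = g z"
    using GUF by (auto simp: g_ext_def)
  have "\<forall>\<^sub>F w in at 0. (G (q + w) - q - w) / w ^ 3 \<in> ball (fps_nth F 3) 1"
    by (rule topological_tendstoD[OF g_ext_remainder[OF GUF]]) auto
  moreover have "\<forall>\<^sub>F w in at 0. (cmod (fps_nth F 3) + 1) * (cmod w)\<^sup>2 < 1"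
  proof -
    have "((\<lambda>w::complex. (cmod (fps_nth F 3) + 1) * (cmod w)\<^sup>2) \<longlongrightarrow> (cmod (fps_nth F 3) + 1) * (cmod 0)\<^sup>2) (at 0)"
      by (intro tendsto_intros)
    then show ?thesis by (rule order_tendstoD) simp
  qed
  moreover have "\<forall>\<^sub>F w in at 0. q + w \<in> U"
  proof -
    have "((\<lambda>w. q + w) \<longlongrightarrow> q + 0) (at 0)" by (intro tendsto_intros)
    then show ?thesis using U by (intro topological_tendstoD) auto
  qed
  ultimately have "\<forall>\<^sub>F w in at 0. q + w \<in> U \<and> G (q + w) \<noteq> q"
    using eventually_neq_at_within[of 0]
  proof eventually_elim
    case (elim w)
    define E where "E = (G (q + w) - q - w) / w ^ 3"
    have eq: "G (q + w) - q = w * (1 + E * w\<^sup>2)"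
      unfolding E_def using elim(4) by (simp add: power3_eq_cube power2_eq_square field_simps)
    have "dist (fps_nth F 3) E < 1" using elim(1) by (simp add: E_def)
    then have "cmod E \<le> cmod (fps_nth F 3) + 1"
      using norm_triangle_ineq2[of E "fps_nth F 3"] by (simp add: dist_norm norm_minus_commute)
    then have "cmod (E * w\<^sup>2) \<le> (cmod (fps_nth F 3) + 1) * (cmod w)\<^sup>2"
      by (simp add: norm_mult norm_power mult_right_mono)
    then have "cmod (E * w\<^sup>2) < 1" using elim(2) by linarith
    then have "1 + E * w\<^sup>2 \<noteq> 0" by (metis add_eq_0_iff less_irrefl norm_minus_cancel norm_one)
    then show ?case using eq elim(3,4) by auto
  qed
  then obtain \<eta> where \<eta>: "\<eta> > 0" "\<And>w. w \<noteq> 0 \<Longrightarrow> cmod w < \<eta> \<Longrightarrow> q + w \<in> U \<and> G (q + w) \<noteq> q"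
    by (auto simp: eventually_at)
  define R where "R = cmod B + cmod A / \<eta>"
  define \<phi> where "\<phi> \<zeta> = moeb (G (q + A / (\<zeta> - B)))" for \<zeta>
  have good: "\<zeta> \<noteq> B \<and> q + A / (\<zeta> - B) \<in> U \<and> G (q + A / (\<zeta> - B)) \<noteq> q" if "cmod \<zeta> > R" for \<zeta>
  proof -
    have "cmod (\<zeta> - B) > cmod A / \<eta>" using that norm_triangle_ineq2[of \<zeta> B] by (simp add: R_def)
    moreover have "cmod A / \<eta> > 0" using A \<eta>(1) by simp
    ultimately have 1: "cmod (\<zeta> - B) > 0" "cmod A < \<eta> * cmod (\<zeta> - B)"
      using \<eta>(1) by (auto simp: divide_less_eq mult.commute)
    then have "cmod (A / (\<zeta> - B)) < \<eta>" by (simp add: norm_divide divide_less_eq)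
    then show ?thesis using \<eta>(2)[of "A / (\<zeta> - B)"] A 1 by auto
  qed
  have op: "open {\<zeta>. cmod \<zeta> > R}" by (intro open_Collect_less continuous_intros)
  have hol: "\<phi> holomorphic_on {\<zeta>. cmod \<zeta> > R}"
  proof -
    have "(G \<circ> (\<lambda>\<zeta>. q + A / (\<zeta> - B))) holomorphic_on {\<zeta>. cmod \<zeta> > R}"
      using good by (intro holomorphic_on_compose_gen[OF _ U(3)] holomorphic_intros) auto
    then show ?thesis unfolding \<phi>_def moeb_def o_def using good by (intro holomorphic_intros) auto
  qed
  have agree: "\<phi> \<zeta> = h \<zeta>" if "cmod \<zeta> > R" "Im \<zeta> > 0" for \<zeta>
    using good[OF that(1)] h_eq[OF that(2)] U(4) moeb_inv(1)[OF that(2)] by (simp add: \<phi>_def moeb_inv_def)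
  have real: "Im (\<phi> (of_real x)) = 0" if x: "\<bar>x\<bar> > R" for x
  proof -
    have good_x: "Im (\<phi> (of_real y)) = 0" if y: "\<bar>y\<bar> > R" "boundary_limit_exists h y" for y
    proof -
      obtain e where e: "e > 0" "ball (complex_of_real y) e \<subseteq> {\<zeta>. cmod \<zeta> > R}"
        using open_contains_ball_eq[OF op, of "complex_of_real y"] y(1) by auto
      have lim: "(h \<longlongrightarrow> \<phi> (of_real y)) (vertical_filter y)"
        using e agree by (intro tendsto_vertical_continuous(1)[OF e(1) holomorphic_on_subset[OF hol e(2)]]) auto
      have "\<not> filterlim h at_infinity (vertical_filter y)"
        by (rule notI) (rule not_tendsto_and_filterlim_at_infinity[OF vertical_filter_neq_bot lim])
      then obtain L where "(h \<longlongrightarrow> complex_of_real L) (vertical_filter y)"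
        using y(2) unfolding boundary_limit_exists_def by blast
      then have "\<phi> (of_real y) = of_real L" using tendsto_unique[OF _ lim] by simp
      then show ?thesis by simp
    qed
    \<comment> \<open>Continuity makes the set of nonreal values open, the boundary limits make it
      null, and an open null set is empty.\<close>
    define V where "V = {y::real. \<bar>y\<bar> > R \<and> Im (\<phi> (of_real y)) \<noteq> 0}"
    have "open V"
    proof -
      have opR: "open {y::real. \<bar>y\<bar> > R}" by (intro open_Collect_less continuous_intros)
      have "continuous_on {y::real. \<bar>y\<bar> > R} (\<lambda>y. Im (\<phi> (of_real y)))"
        by (intro continuous_intros continuous_on_compose2[OF holomorphic_on_imp_continuous_on[OF hol]]) auto
      then have "open ((\<lambda>y. Im (\<phi> (of_real y))) -` (- {0}) \<inter> {y::real. \<bar>y\<bar> > R})"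
        using opR by (subst (asm) continuous_on_open_vimage) auto
      then show ?thesis by (simp add: V_def vimage_def Int_def conj_commute)
    qed
    moreover have "V \<subseteq> {x. \<not> boundary_limit_exists h x}" using good_x by (auto simp: V_def)
    then have "negligible V" using negligible_no_boundary_limit negligible_subset by blast
    ultimately have "V = {}" using open_not_negligible by blast
    then show ?thesis using x by (auto simp: V_def)
  qed
  have "regular_at h x" if x: "\<bar>x\<bar> > R" for x
  proof -
    obtain e where e: "e > 0" "ball (complex_of_real x) e \<subseteq> {\<zeta>. cmod \<zeta> > R}"
      using open_contains_ball_eq[OF op, of "complex_of_real x"] x by auto
    show ?thesis
    proof (rule regular_atI[OF e(1) half_plane_self_mapD(1)[OF h_self_map]])
      show "continuous_on (ball (of_real x) e \<inter> {z. 0 \<le> Im z}) \<phi>"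
        using e(2) by (intro continuous_on_subset[OF holomorphic_on_imp_continuous_on[OF hol]]) auto
      show "\<phi> z = h z" if "z \<in> ball (complex_of_real x) e" "Im z > 0" for z
        using that e(2) by (intro agree) auto
      fix y assume "\<bar>y - x\<bar> < e"
      then have "complex_of_real y \<in> ball (of_real x) e"
        by (simp add: dist_norm abs_minus_commute flip: of_real_diff)
      then have "complex_of_real y \<in> {\<zeta>. cmod \<zeta> > R}" using e(2) by blast
      then show "Im (\<phi> (of_real y)) = 0" by (intro real) simp
    qed
  qed
  then show ?thesis by blast
qed

end

lemma doubly_parabolic_model_exists:
  assumes "one_component_doubly_parabolic_half_plane h"
  obtains g q A B where "doubly_parabolic_model g h q A B"
proof -
  obtain g q M where g: "inner_function g" "doubly_parabolic_at g q" "moebius_disc_to_half_plane M q"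
    and h: "\<And>w. Im w > 0 \<Longrightarrow> h w = M (g (inv_into (ball 0 1) M w))"
    using assms unfolding one_component_doubly_parabolic_half_plane_def by blast
  obtain \<alpha> \<beta> \<gamma> \<delta> where M: "\<alpha> * \<delta> - \<beta> * \<gamma> \<noteq> 0" "\<gamma> * q + \<delta> = 0"
      "M = (\<lambda>z. (\<alpha> * z + \<beta>) / (\<gamma> * z + \<delta>))" and img: "M ` ball 0 1 = upper_half_plane"
    using g(3) unfolding moebius_disc_to_half_plane_def by blast
  have \<delta>: "\<delta> = - (\<gamma> * q)" using M(2) by (simp add: eq_neg_iff_add_eq_0 add.commute)
  have \<gamma>: "\<gamma> \<noteq> 0" using M(1) \<delta> by auto
  define A where "A = (\<alpha> * q + \<beta>) / \<gamma>"
  define B where "B = \<alpha> / \<gamma>"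
  have det: "\<alpha> * \<delta> - \<beta> * \<gamma> = - ((\<alpha> * q + \<beta>) * \<gamma>)" by (simp add: \<delta> algebra_simps)
  have "\<alpha> * q + \<beta> \<noteq> 0"
  proof
    assume "\<alpha> * q + \<beta> = 0"
    then show False using M(1) unfolding det by simp
  qed
  then have A: "A \<noteq> 0" using \<gamma> by (simp add: A_def)
  have Meq: "M z = A / (z - q) + B" if "z \<noteq> q" for z
  proof -
    have "\<gamma> * z + \<delta> = \<gamma> * (z - q)" by (simp add: \<delta> algebra_simps)
    moreover have "z - q \<noteq> 0" using that by simp
    ultimately show ?thesis using \<gamma> by (simp add: M(3) A_def B_def field_simps)
  qed
  have q: "cmod q = 1" using g(2) by (simp add: doubly_parabolic_at_def)
  have nq: "z \<noteq> q" if "z \<in> ball 0 1" for z using that q by auto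
  have gb: "g z \<in> ball 0 1" if "z \<in> ball 0 1" for z using g(1) that unfolding inner_function_def by blast
  have inj: "inj_on M (ball 0 1)"
  proof (rule inj_onI)
    fix z w assume "z \<in> ball 0 1" "w \<in> ball 0 1" "M z = M w"
    then show "z = w" using A nq by (simp add: Meq frac_eq_eq)
  qed
  have "doubly_parabolic_model g h q A B"
  proof
    show "(\<lambda>z. A / (z - q) + B) ` ball 0 1 = upper_half_plane"
      unfolding img[symmetric] using Meq nq by (intro image_cong) auto
    fix z :: complex assume z: "z \<in> ball 0 1"
    have "Im (M z) > 0" using img z by blast
    moreover have "inv_into (ball 0 1) M (M z) = z" using inj z by (rule inv_into_f_f)
    ultimately have "h (M z) = M (g z)" using h by simp
    then show "h (A / (z - q) + B) = A / (g z - q) + B" using Meq nq z gb[OF z] by simp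
  qed (use g A in auto)
  then show thesis by (rule that)
qed

section \<open>Inequalities with one point sent to infinity\<close>

lemma filterlim_ray_half_plane_infinity:
  assumes "Im u > 0"
  shows "filterlim (\<lambda>t. of_real t * u) half_plane_infinity at_top"
  unfolding filterlim_iff
proof safe
  fix P assume "eventually P half_plane_infinity"
  then obtain R where R: "\<And>z. R \<le> cmod z \<Longrightarrow> Im z > 0 \<Longrightarrow> P z"
    by (auto simp: eventually_half_plane_infinity)
  have u: "cmod u > 0" using assms by auto
  have "\<forall>\<^sub>F t in at_top. t \<ge> max 1 (R / cmod u)" by (rule eventually_ge_at_top)
  then show "\<forall>\<^sub>F t in at_top. P (of_real t * u)"
  proof eventually_elim
    case (elim t)
    then have "R \<le> t * cmod u" using u by (simp add: pos_divide_le_eq)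
    then show ?case using elim assms by (intro R) (auto simp: norm_mult)
  qed
qed

locale parabolic_at_infinity =
  fixes h :: "complex \<Rightarrow> complex" and \<mu> :: complex
  assumes self: "half_plane_self_map h" and \<mu>: "\<mu> \<noteq> 0"
    and expansion: "((\<lambda>\<zeta>. \<zeta> * (h \<zeta> - \<zeta>)) \<longlongrightarrow> \<mu>) half_plane_infinity"
begin

lemma ray_limit:
  assumes "Im u > 0"
  shows "((\<lambda>t. of_real t * (h (of_real t * u) - of_real t * u)) \<longlongrightarrow> \<mu> / u) at_top"
proof -
  have u: "u \<noteq> 0" using assms by auto
  have "((\<lambda>t. of_real t * u * (h (of_real t * u) - of_real t * u) / u) \<longlongrightarrow> \<mu> / u) at_top"
    using filterlim_compose[OF expansion filterlim_ray_half_plane_infinity[OF assms]] u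
    by (intro tendsto_intros) auto
  then show ?thesis using u by simp
qed

lemma ray_diff:
  assumes "Im u > 0"
  shows "((\<lambda>t. h (of_real t * u) - of_real t * u) \<longlongrightarrow> 0) at_top"
proof -
  have inv: "((\<lambda>t::real. complex_of_real (inverse t)) \<longlongrightarrow> of_real 0) at_top"
    by (intro tendsto_of_real tendsto_inverse_0_at_top filterlim_ident)
  have "((\<lambda>t. of_real (inverse t) * (of_real t * (h (of_real t * u) - of_real t * u))) \<longlongrightarrow> of_real 0 * (\<mu> / u)) at_top"
    by (intro tendsto_mult inv ray_limit assms)
  then have "((\<lambda>t. of_real (inverse t) * (of_real t * (h (of_real t * u) - of_real t * u))) \<longlongrightarrow> 0) at_top" by simp
  then show ?thesis
    by (rule Lim_transform_eventually)
      (use eventually_gt_at_top[of 0] in eventually_elim, simp)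
qed

lemma imaginary_axis_quotient:
  "((\<lambda>t. (cmod (z + of_real t * \<i>))\<^sup>2 / t\<^sup>2) \<longlongrightarrow> 1) at_top"
proof -
  have inv: "((\<lambda>t::real. complex_of_real (inverse t)) \<longlongrightarrow> of_real 0) at_top"
    by (intro tendsto_of_real tendsto_inverse_0_at_top filterlim_ident)
  have "((\<lambda>t. (cmod (z * of_real (inverse t) + \<i>))\<^sup>2) \<longlongrightarrow> (cmod (z * of_real 0 + \<i>))\<^sup>2) at_top"
    by (intro tendsto_intros inv)
  then have "((\<lambda>t. (cmod (z * of_real (inverse t) + \<i>))\<^sup>2) \<longlongrightarrow> 1) at_top" by simp
  moreover have "\<forall>\<^sub>F t in at_top. (cmod (z * of_real (inverse t) + \<i>))\<^sup>2 = (cmod (z + of_real t * \<i>))\<^sup>2 / t\<^sup>2"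
    using eventually_gt_at_top[of "0::real"]
  proof eventually_elim
    case (elim t)
    have "z * of_real (inverse t) + \<i> = (z + of_real t * \<i>) / of_real t"
      using elim by (simp add: field_simps)
    then show ?case using elim by (simp add: norm_divide power_divide)
  qed
  ultimately show ?thesis by (rule Lim_transform_eventually)
qed

text \<open>Julia's lemma at infinity: in Schwarz-Pick for \<open>z\<close> and
  \<open>t * \<i>\<close> both sides grow like the cube of \<open>t\<close>, and since
  \<open>h (t * \<i>)\<close> differs from \<open>t * \<i>\<close> by o(1), comparison of the
  leading coefficients gives the claim.\<close>

lemma Im_le_Im_h:
  assumes z: "Im z > 0"
  shows "Im z \<le> Im (h z)"
proof -
  let ?w = "\<lambda>t::real. of_real t * \<i>"
  define d where "d t = h (?w t) - ?w t" for t :: real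
  have d: "(d \<longlongrightarrow> 0) at_top" using ray_diff[of \<i>] by (simp add: d_def[abs_def])
  have inv: "((\<lambda>t::real. inverse t) \<longlongrightarrow> 0) at_top"
    by (intro tendsto_inverse_0_at_top filterlim_ident)
  have cinv: "((\<lambda>t::real. complex_of_real (inverse t)) \<longlongrightarrow> of_real 0) at_top"
    by (intro tendsto_of_real inv)
  have 1: "((\<lambda>t. (cmod ((h z - cnj (d t)) * of_real (inverse t) + \<i>))\<^sup>2 * Im z) \<longlongrightarrow>
      (cmod ((h z - cnj 0) * of_real 0 + \<i>))\<^sup>2 * Im z) at_top"
    by (intro tendsto_intros cinv d tendsto_cnj)
  have 2: "((\<lambda>t. (cmod (z + ?w t))\<^sup>2 / t\<^sup>2 * (Im (h z) * (1 + Im (d t) * inverse t))) \<longlongrightarrow>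
      1 * (Im (h z) * (1 + Im 0 * 0))) at_top"
    by (intro tendsto_intros imaginary_axis_quotient inv d)
  have "\<forall>\<^sub>F t in at_top. (cmod ((h z - cnj (d t)) * of_real (inverse t) + \<i>))\<^sup>2 * Im z
      \<le> (cmod (z + ?w t))\<^sup>2 / t\<^sup>2 * (Im (h z) * (1 + Im (d t) * inverse t))"
    using eventually_gt_at_top[of "0::real"]
  proof eventually_elim
    case (elim t)
    have hw: "h (?w t) = d t + ?w t" by (simp add: d_def)
    have sp: "(cmod (h z - cnj (d t + ?w t)))\<^sup>2 * (Im z * t) \<le> (cmod (z + ?w t))\<^sup>2 * (Im (h z) * (Im (d t) + t))"
      using schwarz_pick(2)[OF self z, of "?w t"] elim by (simp add: hw)
    have "(h z - cnj (d t)) * of_real (inverse t) + \<i> = (h z - cnj (d t + ?w t)) / of_real t"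
      using elim by (simp add: field_simps)
    then have "(cmod ((h z - cnj (d t)) * of_real (inverse t) + \<i>))\<^sup>2 * Im z
        = ((cmod (h z - cnj (d t + ?w t)))\<^sup>2 * (Im z * t)) / t ^ 3"
      using elim by (simp add: norm_divide power_divide power3_eq_cube power2_eq_square)
    also have "\<dots> \<le> ((cmod (z + ?w t))\<^sup>2 * (Im (h z) * (Im (d t) + t))) / t ^ 3"
      using sp elim by (intro divide_right_mono) auto
    also have "\<dots> = (cmod (z + ?w t))\<^sup>2 / t\<^sup>2 * (Im (h z) * (1 + Im (d t) * inverse t))"
      using elim by (simp add: power3_eq_cube power2_eq_square field_simps)
    finally show ?case .
  qed
  from tendsto_le[OF trivial_limit_at_top_linorder 2 1 this] show ?thesis by simp
qed

definition N :: "complex \<Rightarrow> complex" where "N z = h z - z"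

lemma N_holomorphic: "N holomorphic_on upper_half_plane"
  unfolding N_def using half_plane_self_mapD(1)[OF self] by (intro holomorphic_intros)

text \<open>The open mapping theorem improves \<open>Im (N z) \<ge> 0\<close> to a strict
  inequality. \<open>N\<close> is not constant: it tends to 0 along the imaginary axis, while
  \<open>z * N z\<close> has the nonzero limit \<mu>.\<close>

lemma N_self_map: "half_plane_self_map N"
proof -
  have open_H: "open upper_half_plane" by (simp add: open_halfspace_Im_gt)
  have conn: "connected upper_half_plane" by (simp add: convex_connected convex_halfspace_Im_gt)
  have nonneg: "Im (N z) \<ge> 0" if "Im z > 0" for z using Im_le_Im_h[OF that] by (simp add: N_def)
  have nc: "\<not> N constant_on upper_half_plane"
  proof
    assume "N constant_on upper_half_plane"
    then obtain c where c: "\<And>z. Im z > 0 \<Longrightarrow> N z = c" by (auto simp: constant_on_def)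
    have "\<forall>\<^sub>F t in at_top. h (of_real t * \<i>) - of_real t * \<i> = c"
      using eventually_gt_at_top[of "0::real"] by eventually_elim (use c in \<open>simp add: N_def\<close>)
    from Lim_transform_eventually[OF ray_diff[of \<i>] this]
    have c0: "c = 0" using tendsto_unique[OF trivial_limit_at_top_linorder _ tendsto_const] by force
    have "\<forall>\<^sub>F t in at_top. of_real t * (h (of_real t * \<i>) - of_real t * \<i>) = 0"
      using eventually_gt_at_top[of "0::real"] by eventually_elim (use c c0 in \<open>simp add: N_def\<close>)
    from Lim_transform_eventually[OF ray_limit[of \<i>] this]
    have "\<mu> / \<i> = 0" using tendsto_unique[OF trivial_limit_at_top_linorder _ tendsto_const] by force
    then show False using \<mu> by simp
  qed
  have "open (N ` upper_half_plane)"
    by (rule open_mapping_thm[OF N_holomorphic open_H conn open_H order.refl nc])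
  moreover have "N ` upper_half_plane \<subseteq> {z. \<i> \<bullet> z \<ge> 0}" using nonneg by auto
  ultimately have "N ` upper_half_plane \<subseteq> interior {z. \<i> \<bullet> z \<ge> 0}" by (rule interior_maximal[rotated])
  also have "interior {z. \<i> \<bullet> z \<ge> 0} = {z. \<i> \<bullet> z > 0}" by (rule interior_halfspace_ge) simp
  finally show ?thesis using N_holomorphic by (simp add: half_plane_self_map_def)
qed

definition m :: real where "m = - Re \<mu>"

lemma \<mu>_eq: "\<mu> = - of_real m" and m_pos: "m > 0"
proof -
  \<comment> \<open>The limit \<mu> / u along the ray through \<open>u = Complex x 1\<close> has
    nonnegative imaginary part. An affine function of \<open>x\<close> that is nonnegative on all of
    the line has slope zero, so \<mu> is real.\<close>
  have *: "0 \<le> Im \<mu> * x - Re \<mu>" for x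
  proof -
    define u where "u = Complex x 1"
    have u: "Im u > 0" "u \<noteq> 0" by (auto simp: u_def complex_eq_iff)
    have lim: "((\<lambda>t. Im (of_real t * (h (of_real t * u) - of_real t * u))) \<longlongrightarrow> Im (\<mu> / u)) at_top"
      by (intro tendsto_Im ray_limit u)
    have "\<forall>\<^sub>F t in at_top. 0 \<le> Im (of_real t * (h (of_real t * u) - of_real t * u))"
      using eventually_gt_at_top[of "0::real"]
    proof eventually_elim
      case (elim t)
      then show ?case using Im_le_Im_h[of "of_real t * u"] u by simp
    qed
    then have "0 \<le> Im (\<mu> / u)" using tendsto_lowerbound[OF lim] by simp
    also have "Im (\<mu> / u) = (Im \<mu> * x - Re \<mu>) / (x\<^sup>2 + 1)" by (simp add: u_def Im_divide)
    finally show ?thesis by (simp add: zero_le_divide_iff) (smt (verit) zero_le_power2)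
  qed
  have "Im \<mu> = 0"
  proof (rule ccontr)
    assume "Im \<mu> \<noteq> 0"
    then show False using *[of "(Re \<mu> - 1) / Im \<mu>"] by simp
  qed
  then show "\<mu> = - of_real m" by (simp add: m_def complex_eq_iff)
  have "Re \<mu> \<noteq> 0" using \<mu> \<open>Im \<mu> = 0\<close> by (auto simp: complex_eq_iff)
  then show "m > 0" using *[of 0] by (simp add: m_def)
qed

text \<open>The case \<open>w = \<infinity>\<close> of the Schwarz-Pick inequality for \<open>N\<close>.\<close>

lemma N_boundary_schwarz_pick:
  assumes z: "Im z > 0"
  shows "Im z * (cmod (N z))\<^sup>2 / m \<le> Im (N z)"
proof -
  let ?w = "\<lambda>t::real. of_real t * \<i>"
  have 1: "((\<lambda>t. (cmod (N z - cnj (N (?w t))))\<^sup>2 * Im z) \<longlongrightarrow> (cmod (N z - cnj 0))\<^sup>2 * Im z) at_top"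
    using ray_diff[of \<i>] by (intro tendsto_intros tendsto_cnj) (simp add: N_def)
  have 2: "((\<lambda>t. (cmod (z + ?w t))\<^sup>2 / t\<^sup>2 * (Im (N z) * Im (of_real t * N (?w t)))) \<longlongrightarrow>
      1 * (Im (N z) * Im (\<mu> / \<i>))) at_top"
    using ray_limit[of \<i>] by (intro tendsto_intros imaginary_axis_quotient) (simp add: N_def)
  have "\<forall>\<^sub>F t in at_top. (cmod (N z - cnj (N (?w t))))\<^sup>2 * Im z
      \<le> (cmod (z + ?w t))\<^sup>2 / t\<^sup>2 * (Im (N z) * Im (of_real t * N (?w t)))"
    using eventually_gt_at_top[of "0::real"]
  proof eventually_elim
    case (elim t)
    have sp: "(cmod (N z - cnj (N (?w t))))\<^sup>2 * (Im z * t) \<le> (cmod (z + ?w t))\<^sup>2 * (Im (N z) * Im (N (?w t)))"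
      using schwarz_pick(2)[OF N_self_map z, of "?w t"] elim by simp
    have "(cmod (N z - cnj (N (?w t))))\<^sup>2 * Im z = (cmod (N z - cnj (N (?w t))))\<^sup>2 * (Im z * t) / t"
      using elim by simp
    also have "\<dots> \<le> (cmod (z + ?w t))\<^sup>2 * (Im (N z) * Im (N (?w t))) / t"
      using sp elim by (intro divide_right_mono) auto
    also have "\<dots> = (cmod (z + ?w t))\<^sup>2 / t\<^sup>2 * (Im (N z) * Im (of_real t * N (?w t)))"
      using elim by (simp add: power2_eq_square)
    finally show ?case .
  qed
  from tendsto_le[OF trivial_limit_at_top_linorder 2 1 this]
  have "(cmod (N z))\<^sup>2 * Im z \<le> Im (N z) * m" by (simp add: m_def Im_divide)
  then show ?thesis using m_pos by (simp add: pos_divide_le_eq mult.commute)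
qed

definition T :: "real \<Rightarrow> real" where "T = boundary_value h"
definition c :: real where "c = Im (N \<i>)"

lemma c_pos: "c > 0"
  using half_plane_self_mapD(2)[OF N_self_map, of \<i>] by (simp add: c_def)

text \<open>Both bounds are limits of interior inequalities for \<open>N\<close> divided by the
  height: the first from Schwarz-Pick with one point at infinity, the second from Harnack's
  inequality.\<close>

lemma T_derivative:
  assumes reg: "regular_at h x"
  obtains d where "(T has_real_derivative d) (at x)" "1 + (T x - x)\<^sup>2 / m \<le> d" "1 + c / (1 + x\<^sup>2) \<le> d"
proof -
  obtain d where d: "(boundary_value h has_real_derivative d) (at x)"
    "((\<lambda>t. Im (h (Complex x t)) / t) \<longlongrightarrow> d) (at_right 0)"
    by (rule regular_has_real_derivative[OF self reg])
  have lim: "((\<lambda>t. h (Complex x t)) \<longlongrightarrow> of_real (T x)) (at_right 0)"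
    using filterlim_compose[OF tendsto_boundary_value[OF reg] filterlim_vertical_line] by (simp add: T_def)
  have line: "((\<lambda>t. Complex x t) \<longlongrightarrow> of_real x) (at_right 0)"
    using filterlim_compose[OF tendsto_vertical_filter filterlim_vertical_line] .
  have dN: "((\<lambda>t. Im (h (Complex x t)) / t - 1) \<longlongrightarrow> d - 1) (at_right 0)"
    by (intro tendsto_intros d)
  have Im_N: "Im (N (Complex x t)) / t = Im (h (Complex x t)) / t - 1" if "t > 0" for t
    using that by (simp add: N_def diff_divide_distrib)
  have "((\<lambda>t. (cmod (h (Complex x t) - Complex x t))\<^sup>2 / m) \<longlongrightarrow> (cmod (of_real (T x) - of_real x))\<^sup>2 / m) (at_right 0)"
    using m_pos by (intro tendsto_intros lim line) auto
  moreover have "\<forall>\<^sub>F t in at_right 0. (cmod (h (Complex x t) - Complex x t))\<^sup>2 / m \<le> Im (h (Complex x t)) / t - 1"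
    using eventually_at_right_less[of 0]
  proof eventually_elim
    case (elim t)
    then have "t * (cmod (N (Complex x t)))\<^sup>2 / m / t \<le> Im (N (Complex x t)) / t"
      using N_boundary_schwarz_pick[of "Complex x t"] by (intro divide_right_mono) auto
    then show ?case using elim Im_N[OF elim] by (simp add: N_def)
  qed
  ultimately have 1: "(cmod (of_real (T x) - of_real x))\<^sup>2 / m \<le> d - 1"
    by (intro tendsto_le[OF trivial_limit_at_right_real dN])
  have "((\<lambda>t. c / ((x\<^sup>2 + (t + 1)\<^sup>2))) \<longlongrightarrow> c / (x\<^sup>2 + (0 + 1)\<^sup>2)) (at_right 0)"
    by (intro tendsto_intros) (simp add: add_nonneg_eq_0_iff)
  moreover have "\<forall>\<^sub>F t in at_right 0. c / ((x\<^sup>2 + (t + 1)\<^sup>2)) \<le> Im (h (Complex x t)) / t - 1"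
    using eventually_at_right_less[of 0]
  proof eventually_elim
    case (elim t)
    then have "t * c / (cmod (Complex x t + \<i>))\<^sup>2 / t \<le> Im (N (Complex x t)) / t"
      using harnack_half_plane[OF N_self_map, of "Complex x t"]
      by (intro divide_right_mono) (auto simp: c_def)
    then show ?case using elim Im_N[OF elim] by (simp add: cmod_power2)
  qed
  ultimately have "c / (x\<^sup>2 + (0 + 1)\<^sup>2) \<le> d - 1"
    by (intro tendsto_le[OF trivial_limit_at_right_real dN])
  then have 2: "1 + c / (1 + x\<^sup>2) \<le> d" by (simp add: add.commute)
  have "(cmod (of_real (T x) - of_real x))\<^sup>2 = (T x - x)\<^sup>2" by (simp flip: of_real_diff)
  then have "1 + (T x - x)\<^sup>2 / m \<le> d" using 1 by simp
  then show thesis using that[of d] d(1) 2 by (simp add: T_def)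
qed

lemma T_near_infinity: "\<exists>R. \<forall>x. R < \<bar>x\<bar> \<longrightarrow> regular_at h x \<longrightarrow> \<bar>x\<bar> * \<bar>T x - x\<bar> \<le> m + 1"
proof -
  have "\<forall>\<^sub>F \<zeta> in half_plane_infinity. cmod (\<zeta> * (h \<zeta> - \<zeta>)) < m + 1"
  proof -
    have "((\<lambda>\<zeta>. cmod (\<zeta> * (h \<zeta> - \<zeta>))) \<longlongrightarrow> cmod \<mu>) half_plane_infinity"
      by (intro tendsto_norm expansion)
    moreover have "cmod \<mu> = m" using m_pos by (subst \<mu>_eq) simp
    ultimately show ?thesis by (intro order_tendstoD(2)[where y = "cmod \<mu>"]) auto
  qed
  then obtain R where R: "\<And>\<zeta>. R \<le> cmod \<zeta> \<Longrightarrow> Im \<zeta> > 0 \<Longrightarrow> cmod (\<zeta> * (h \<zeta> - \<zeta>)) < m + 1"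
    by (auto simp: eventually_half_plane_infinity)
  have "\<bar>x\<bar> * \<bar>T x - x\<bar> \<le> m + 1" if x: "R < \<bar>x\<bar>" and reg: "regular_at h x" for x
  proof -
    have "((\<lambda>t. h (Complex x t)) \<longlongrightarrow> of_real (T x)) (at_right 0)"
      using filterlim_compose[OF tendsto_boundary_value[OF reg] filterlim_vertical_line] by (simp add: T_def)
    moreover have "((\<lambda>t. Complex x t) \<longlongrightarrow> of_real x) (at_right 0)"
      using filterlim_compose[OF tendsto_vertical_filter filterlim_vertical_line] .
    ultimately have lim: "((\<lambda>t. cmod (Complex x t * (h (Complex x t) - Complex x t))) \<longlongrightarrow>
        cmod (of_real x * (of_real (T x) - of_real x))) (at_right 0)"
      by (intro tendsto_intros)
    have "\<forall>\<^sub>F t in at_right 0. cmod (Complex x t * (h (Complex x t) - Complex x t)) \<le> m + 1"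
      using eventually_at_right_less[of 0]
    proof eventually_elim
      case (elim t)
      have "R \<le> cmod (Complex x t)" using x abs_Re_le_cmod[of "Complex x t"] by simp
      then show ?case using R[of "Complex x t"] elim by simp
    qed
    from tendsto_upperbound[OF lim this]
    have "cmod (of_real x * (of_real (T x) - of_real x)) \<le> m + 1" by simp
    then show ?thesis by (simp add: norm_mult flip: of_real_diff)
  qed
  then show ?thesis by blast
qed

end

section \<open>Fixed points and poles of iterates\<close>

lemma radial_extension_eqI:
  assumes "(h \<longlongrightarrow> complex_of_real y) (vertical_filter x)"
  shows "radial_extension h x = Some y"
proof -
  have y: "radial_limit h x y"
    unfolding radial_limit_def using filterlim_compose[OF assms filterlim_vertical_line] .
  have "z = y" if "radial_limit h x z" for z
    using tendsto_unique[OF trivial_limit_at_right_real that[unfolded radial_limit_def] y[unfolded radial_limit_def]]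
    by simp
  then have "(THE y. radial_limit h x y) = y" using y by blast
  then show ?thesis using y by (auto simp: radial_extension_def)
qed

lemma regular_at_ident: "regular_at (\<lambda>z. z) x"
  unfolding regular_at_def by (intro exI[of _ 1] conjI exI[of _ "\<lambda>z. z"]) auto

lemma regular_at_cong:
  assumes "regular_at f x" "\<And>z. Im z > 0 \<Longrightarrow> f z = g z"
  shows "regular_at g x"
  using assms unfolding regular_at_def by metis

lemma boundary_value_ident: "boundary_value (\<lambda>z. z) x = x"
  by (rule boundary_value_eqI) (rule tendsto_vertical_filter)

locale parabolic_boundary = parabolic_at_infinity +
  assumes negligible_bad: "negligible {x. \<not> boundary_limit_exists h x}"
begin

definition A :: "real set" where "A = {x. regular_at h x}"

lemma regular_funpow:
  assumes "\<And>j. j < n \<Longrightarrow> (T ^^ j) y \<in> A"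
  shows "regular_at (h ^^ n) y \<and> boundary_value (h ^^ n) y = (T ^^ n) y"
  using assms
proof (induction n)
  case 0
  show ?case using regular_at_ident boundary_value_ident by (simp add: id_def)
next
  case (Suc n)
  then have IH: "regular_at (h ^^ n) y" "boundary_value (h ^^ n) y = (T ^^ n) y" by auto
  have "(T ^^ n) y \<in> A" using Suc.prems by simp
  then have "regular_at h (boundary_value (h ^^ n) y)" using IH(2) by (simp add: A_def)
  then show ?case
    using regular_at_compose[OF half_plane_self_map_funpow[OF self] IH(1)]
      boundary_value_compose[OF half_plane_self_map_funpow[OF self] IH(1)] IH(2)
    by (simp add: o_def T_def)
qed

lemma funpow_derivative:
  assumes "\<And>j. j < n \<Longrightarrow> (T ^^ j) y \<in> A"
  shows "\<exists>d\<ge>1. ((T ^^ n) has_real_derivative d) (at y)"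
  using assms
proof (induction n)
  case 0
  show ?case by (auto intro!: exI[of _ 1] simp: id_def)
next
  case (Suc n)
  then obtain d where d: "d \<ge> 1" "((T ^^ n) has_real_derivative d) (at y)" by auto
  have "regular_at h ((T ^^ n) y)" using Suc.prems[of n] by (simp add: A_def)
  then obtain d' where d': "(T has_real_derivative d') (at ((T ^^ n) y))" "1 + c / (1 + ((T ^^ n) y)\<^sup>2) \<le> d'"
    by (rule T_derivative)
  have "c / (1 + ((T ^^ n) y)\<^sup>2) \<ge> 0" using c_pos by (simp add: add_nonneg_nonneg)
  then have "d' \<ge> 1" using d'(2) by linarith
  then have "1 * 1 \<le> d' * d" using d(1) by (intro mult_mono) auto
  then have "1 \<le> d' * d" by simp
  moreover have "((T ^^ Suc n) has_real_derivative (d' * d)) (at y)"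
    using DERIV_chain[OF d'(1) d(2)] by simp
  ultimately show ?case by (intro exI[of _ "d' * d"] conjI)
qed

text \<open>Says that inverse branches are 1-Lipschitz, which is how exceptional null sets are
  pulled back along orbits.\<close>

lemma funpow_expanding:
  assumes "\<And>y j. a < y \<Longrightarrow> y < b \<Longrightarrow> j < n \<Longrightarrow> (T ^^ j) y \<in> A"
    and xy: "a < x" "x \<le> y" "y < b"
  shows "y - x \<le> (T ^^ n) y - (T ^^ n) x"
proof -
  have "(T ^^ n) x - x \<le> (T ^^ n) y - y"
  proof (rule DERIV_nonneg_imp_nondecreasing[OF xy(2)])
    fix z assume "x \<le> z" "z \<le> y"
    then obtain d where "d \<ge> 1" "((T ^^ n) has_real_derivative d) (at z)"
      using funpow_derivative[of n z] assms(1)[of z] xy by fastforce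
    then show "\<exists>d. ((\<lambda>z. (T ^^ n) z - z) has_real_derivative d) (at z) \<and> 0 \<le> d"
      by (intro exI[of _ "d - 1"]) (auto intro!: derivative_eq_intros)
  qed
  then show ?thesis by simp
qed

lemma radial_extension_funpow:
  assumes "\<And>j. j < n \<Longrightarrow> (T ^^ j) y \<in> A"
  shows "((\<lambda>y. Option.bind y (radial_extension h)) ^^ n) (Some y) = Some ((T ^^ n) y)"
  using assms
proof (induction n)
  case (Suc n)
  have "regular_at h ((T ^^ n) y)" using Suc.prems[of n] by (simp add: A_def)
  then have "radial_extension h ((T ^^ n) y) = Some (T ((T ^^ n) y))"
    unfolding T_def by (intro radial_extension_eqI tendsto_boundary_value)
  then show ?case using Suc by simp
qed simp

text \<open>At the last point of the orbit only a vertical limit is required, so periodic orbits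
  through a point outside \<open>A\<close> are detected as well.\<close>

lemma periodic_pointI:
  assumes "\<And>j. j < n \<Longrightarrow> (T ^^ j) y \<in> A" "(h \<longlongrightarrow> complex_of_real y) (vertical_filter ((T ^^ n) y))"
  shows "periodic_point (radial_extension h) (Suc n) y"
  unfolding periodic_point_def
  using radial_extension_funpow[OF assms(1)] radial_extension_eqI[OF assms(2)] by simp

lemma periodic_pointI':
  assumes "\<And>j. j \<le> n \<Longrightarrow> (T ^^ j) y \<in> A" "(T ^^ Suc n) y = y"
  shows "periodic_point (radial_extension h) (Suc n) y"
  unfolding periodic_point_def
  using radial_extension_funpow[of "Suc n" y] assms by (simp del: funpow.simps)

lemma Im_funpow_mono: "Im z > 0 \<Longrightarrow> Im z \<le> Im ((h ^^ n) z)"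
proof (induction n)
  case (Suc n)
  then have "Im ((h ^^ n) z) > 0" by simp
  from Im_le_Im_h[OF this] Suc show ?case by simp
qed simp

lemma Im_funpow_Suc: "Im z > 0 \<Longrightarrow> Im z < Im ((h ^^ Suc n) z)"
proof -
  assume z: "Im z > 0"
  have "Im ((h ^^ n) z) > 0" using Im_funpow_mono[OF z, of n] z by simp
  then have "Im (N ((h ^^ n) z)) > 0" using half_plane_self_mapD(2)[OF N_self_map] by blast
  then show ?thesis using Im_funpow_mono[OF z, of n] by (simp add: N_def)
qed

text \<open>The poles of \<open>-1 / (h\<^sup>n - z)\<close> on the boundary are the fixed points of \<open>T\<^sup>n\<close>.\<close>

definition fixed_point_map :: "nat \<Rightarrow> complex \<Rightarrow> complex" where
  "fixed_point_map n z = - 1 / ((h ^^ n) z - z)"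

text \<open>At least one iteration is needed: for exponent 0 the denominator vanishes
  identically.\<close>

lemma fixed_point_map_self_map: "half_plane_self_map (fixed_point_map (Suc n))"
proof -
  have pos: "Im ((h ^^ Suc n) z - z) > 0" if "Im z > 0" for z using Im_funpow_Suc[OF that, of n] by simp
  have nz: "(h ^^ Suc n) z - z \<noteq> 0" if "Im z > 0" for z
  proof
    assume "(h ^^ Suc n) z - z = 0"
    with pos[OF that] show False by simp
  qed
  have "fixed_point_map (Suc n) holomorphic_on upper_half_plane"
    unfolding fixed_point_map_def
    using nz half_plane_self_mapD(1)[OF half_plane_self_map_funpow[OF self, of "Suc n"]]
    by (intro holomorphic_intros) (auto simp del: funpow.simps)
  moreover have "Im (- 1 / w) > 0" if "Im w > 0" for w
    using that by (simp add: Im_divide) (metis divide_pos_pos less_irrefl sum_power2_gt_zero_iff)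
  ultimately show ?thesis using pos unfolding half_plane_self_map_def fixed_point_map_def by auto
qed

lemma funpow_Suc_eq: "Im z > 0 \<Longrightarrow> z - 1 / fixed_point_map (Suc n) z = (h ^^ Suc n) z"
  by (simp add: fixed_point_map_def)

text \<open>Both finite and infinite limits of \<open>h\<close> at the end of the orbit give
  \<open>Im f\<close> the limit 0, unless a finite limit equals the starting point. That exception,
  like a pole of \<open>f\<close>, would be a periodic point.\<close>

lemma fixed_point_map_regular:
  assumes orbit: "\<And>y j. a < y \<Longrightarrow> y < b \<Longrightarrow> j < n \<Longrightarrow> (T ^^ j) y \<in> A"
    and noper: "\<And>p. a < p \<Longrightarrow> p < b \<Longrightarrow> \<not> periodic_point (radial_extension h) (Suc n) p"
    and x: "a < x" "x < b"
  shows "regular_at (fixed_point_map (Suc n)) x"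
proof (rule regular_at_of_boundary_limits[OF fixed_point_map_self_map _ _ x])
  let ?k = "h ^^ Suc n" and ?f = "fixed_point_map (Suc n)"
  have reg: "regular_at (h ^^ n) y" "boundary_value (h ^^ n) y = (T ^^ n) y" if "a < y" "y < b" for y
    using regular_funpow[of n y] orbit that by auto
  have per: "\<not> (h \<longlongrightarrow> complex_of_real y) (vertical_filter ((T ^^ n) y))" if "a < y" "y < b" for y
    using periodic_pointI[of n y] orbit noper that by blast
  have line: "((\<lambda>t. Complex y t) \<longlongrightarrow> of_real y) (at_right 0)" for y
    using filterlim_compose[OF tendsto_vertical_filter filterlim_vertical_line] .
  define bad where "bad = {y. a < y \<and> y < b \<and> \<not> boundary_limit_exists h ((T ^^ n) y)}"
  have zero: "((\<lambda>t. Im (?f (Complex y t))) \<longlongrightarrow> 0) (at_right 0)" if y: "a < y" "y < b" "y \<notin> bad" for y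
  proof -
    have fl: "filterlim (\<lambda>t. (h ^^ n) (Complex y t)) (vertical_filter ((T ^^ n) y)) (at_right 0)"
      using filterlim_compose[OF filterlim_vertical_regular[OF half_plane_self_map_funpow[OF self] reg(1)] filterlim_vertical_line]
        reg(2) y by simp
    have "boundary_limit_exists h ((T ^^ n) y)" using y by (simp add: bad_def)
    then show ?thesis unfolding boundary_limit_exists_def
    proof (elim disjE exE)
      fix L assume L: "(h \<longlongrightarrow> complex_of_real L) (vertical_filter ((T ^^ n) y))"
      have Ly: "L \<noteq> y" using per L y by blast
      have "((\<lambda>t. ?k (Complex y t)) \<longlongrightarrow> complex_of_real L) (at_right 0)"
        using filterlim_compose[OF L fl] by simp
      then have "((\<lambda>t. ?f (Complex y t)) \<longlongrightarrow> - 1 / (complex_of_real L - of_real y)) (at_right 0)"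
        unfolding fixed_point_map_def using Ly by (intro tendsto_intros line) auto
      then have "((\<lambda>t. Im (?f (Complex y t))) \<longlongrightarrow> Im (- 1 / (complex_of_real L - of_real y))) (at_right 0)"
        by (rule tendsto_Im)
      also have "Im (- 1 / (complex_of_real L - of_real y)) = 0"
        by (simp flip: of_real_diff add: Im_divide)
      finally show ?thesis .
    next
      assume inf: "filterlim h at_infinity (vertical_filter ((T ^^ n) y))"
      have "filterlim (\<lambda>t. ?k (Complex y t)) at_infinity (at_right 0)"
        using filterlim_compose[OF inf fl] by simp
      from tendsto_add_filterlim_at_infinity'[OF this tendsto_minus[OF line[of y]]]
      have "filterlim (\<lambda>t. ?k (Complex y t) - Complex y t) at_infinity (at_right 0)" by simp
      from tendsto_divide_0[OF tendsto_const this, of "- 1"]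
      have "((\<lambda>t. ?f (Complex y t)) \<longlongrightarrow> 0) (at_right 0)" unfolding fixed_point_map_def .
      from tendsto_Im[OF this] show ?thesis by simp
    qed
  qed
  show "AE y in lborel. a < y \<and> y < b \<longrightarrow> ((\<lambda>t. Im (?f (Complex y t))) \<longlongrightarrow> 0) (at_right 0)"
  proof -
    define S where "S = (T ^^ n) ` bad"
    have S: "negligible S"
      using negligible_bad by (rule negligible_subset) (auto simp: S_def bad_def)
    have ex: "\<bar>y - z\<bar> \<le> \<bar>(T ^^ n) y - (T ^^ n) z\<bar>" if "y \<in> bad" "z \<in> bad" for y z
      using funpow_expanding[of a b n y z] funpow_expanding[of a b n z y] orbit that
      by (cases "y \<le> z") (force simp: bad_def)+
    have inj: "inj_on (T ^^ n) bad"
    proof (rule inj_onI)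
      fix y z assume "y \<in> bad" "z \<in> bad" "(T ^^ n) y = (T ^^ n) z"
      then show "y = z" using ex[of y z] by simp
    qed
    \<comment> \<open>\<open>S\<close> is null because \<open>h\<close> lacks a boundary limit on
      it, and by expansion the inverse of the iterate is 1-Lipschitz there, so the starting points
      \<open>bad\<close> form a null set too.\<close>
    have "negligible (inv_into bad (T ^^ n) ` S)"
    proof (rule negligible_locally_Lipschitz_image[OF order.refl S])
      fix s assume s: "s \<in> S"
      show "\<exists>U B. open U \<and> s \<in> U \<and> (\<forall>y\<in>S \<inter> U. norm (inv_into bad (T ^^ n) y - inv_into bad (T ^^ n) s) \<le> B * norm (y - s))"
      proof (intro exI[of _ UNIV] exI[of _ 1] conjI ballI)
        fix y assume "y \<in> S \<inter> UNIV"
        then have y: "y \<in> S" by simp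
        show "norm (inv_into bad (T ^^ n) y - inv_into bad (T ^^ n) s) \<le> 1 * norm (y - s)"
          using ex[of "inv_into bad (T ^^ n) y" "inv_into bad (T ^^ n) s"] s y
          by (simp add: S_def inv_into_into f_inv_into_f)
      qed auto
    qed
    moreover have "inv_into bad (T ^^ n) ` S = bad" unfolding S_def using inv_into_image_cancel[OF inj order.refl] .
    ultimately have "bad \<in> null_sets lebesgue" by (simp add: negligible_iff_null_sets)
    then have "AE y in lebesgue. y \<notin> bad" by (rule AE_not_in)
    then have "AE y in lborel. y \<notin> bad" by (simp add: AE_completion_iff)
    then show ?thesis by (rule AE_mp) (use zero in auto)
  qed
  \<comment> \<open>At a pole of \<open>f\<close> the iterate of order \<open>Suc n\<close> tends to
    \<open>p\<close>. The local inverse of \<open>h ^^ n\<close> converts this into a vertical limit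
    \<open>p\<close> of \<open>h\<close> at the end of the orbit.\<close>
  show "\<not> filterlim (\<lambda>t. ?f (Complex p t)) at_infinity (at_right 0)" if p: "a < p" "p < b" for p
  proof
    assume inf: "filterlim (\<lambda>t. ?f (Complex p t)) at_infinity (at_right 0)"
    have "((\<lambda>t. Complex p t - 1 / ?f (Complex p t)) \<longlongrightarrow> of_real p - 0) (at_right 0)"
      by (intro tendsto_diff line tendsto_divide_0[OF tendsto_const inf])
    moreover have "\<forall>\<^sub>F t in at_right 0. Complex p t - 1 / ?f (Complex p t) = ?k (Complex p t)"
      using eventually_at_right_less[of 0] by eventually_elim (rule funpow_Suc_eq, simp)
    ultimately have "((\<lambda>t. ?k (Complex p t)) \<longlongrightarrow> of_real p - 0) (at_right 0)"
      by (rule Lim_transform_eventually)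
    from tendsto_vertical_of_radial[OF half_plane_self_map_funpow[OF self] this]
    have k: "(?k \<longlongrightarrow> of_real p) (vertical_filter p)" by (simp only: diff_zero)
    show False
    proof (rule regular_at_local_inverse[OF half_plane_self_map_funpow[OF self] reg(1)[OF p]])
      fix e \<psi>
      assume \<psi>: "e > 0" "\<And>w. w \<in> ball (of_real (boundary_value (h ^^ n) p)) e \<Longrightarrow> Im w > 0 \<Longrightarrow>
          Im (\<psi> w) > 0 \<and> (h ^^ n) (\<psi> w) = w"
        and fl: "filterlim \<psi> (vertical_filter p) (vertical_filter (boundary_value (h ^^ n) p))"
      have bv: "boundary_value (h ^^ n) p = (T ^^ n) p" using reg(2) p by simp
      have "\<forall>\<^sub>F w in vertical_filter ((T ^^ n) p). w \<in> ball (of_real ((T ^^ n) p)) e"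
        using tendstoD[OF tendsto_vertical_filter \<psi>(1)] by (simp add: dist_commute)
      then have "\<forall>\<^sub>F w in vertical_filter ((T ^^ n) p). ?k (\<psi> w) = h w"
        using eventually_vertical_Im_pos
        by eventually_elim (use \<psi>(2) bv in simp)
      with filterlim_compose[OF k fl[unfolded bv]] have "(h \<longlongrightarrow> of_real p) (vertical_filter ((T ^^ n) p))"
        by (rule Lim_transform_eventually)
      then show False using per p by blast
    qed
  qed
qed

text \<open>Where \<open>F \<noteq> 0\<close>, regularity of \<open>f\<close> passes to the iterate
  and, after cancelling the first \<open>n\<close> steps, to \<open>h\<close>; hence the orbit can
  leave \<open>A\<close> only at a zero of \<open>F\<close>. As \<open>F\<close> is strictly
  increasing there is just one zero, and \<open>y - 1 / F y\<close> has the stated one-sided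
  limits.\<close>

lemma pole_of_first_entrance:
  assumes orbit: "\<And>y j. a < y \<Longrightarrow> y < b \<Longrightarrow> j < n \<Longrightarrow> (T ^^ j) y \<in> A"
    and noper: "\<And>p. a < p \<Longrightarrow> p < b \<Longrightarrow> \<not> periodic_point (radial_extension h) (Suc n) p"
    and y0: "a < y0" "y0 < b" "(T ^^ n) y0 \<notin> A"
  shows "\<And>y. a < y \<Longrightarrow> y < b \<Longrightarrow> y \<noteq> y0 \<Longrightarrow> (T ^^ n) y \<in> A"
    and "filterlim (T ^^ Suc n) at_bot (at_right y0)" and "filterlim (T ^^ Suc n) at_top (at_left y0)"
proof -
  let ?k = "h ^^ Suc n" and ?f = "fixed_point_map (Suc n)"
  define F where "F = boundary_value ?f"
  have regf: "regular_at ?f y" if "a < y" "y < b" for y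
    using fixed_point_map_regular[OF orbit noper that] .
  have Fd: "\<exists>d>0. (F has_real_derivative d) (at y)" if "a < y" "y < b" for y
  proof -
    have r: "regular_at ?f y" using regf that by blast
    obtain d where d: "d \<ge> Im (?f \<i>) / (1 + y\<^sup>2)" "(F has_real_derivative d) (at y)"
      unfolding F_def by (rule regular_has_real_derivative[OF fixed_point_map_self_map r])
    have "0 < Im (?f \<i>) / (1 + y\<^sup>2)"
      using half_plane_self_mapD(2)[OF fixed_point_map_self_map, of \<i> n]
      by (intro divide_pos_pos) (auto simp: add_pos_nonneg)
    then show ?thesis using d(1) by (intro exI[of _ d] conjI d(2)) linarith
  qed
  have mono: "F x < F y" if "a < x" "x < y" "y < b" for x y
  proof (rule DERIV_pos_imp_increasing[OF that(2)])
    fix z assume "x \<le> z" "z \<le> y"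
    then have "a < z" "z < b" using that by auto
    from Fd[OF this] show "\<exists>d. (F has_real_derivative d) (at z) \<and> 0 < d" by metis
  qed
  have nonzero: "(T ^^ n) y \<in> A \<and> (T ^^ Suc n) y = y - 1 / F y" if y: "a < y" "y < b" "F y \<noteq> 0" for y
  proof -
    have rn: "regular_at (h ^^ n) y" "boundary_value (h ^^ n) y = (T ^^ n) y"
      using regular_funpow[of n y] orbit y by auto
    have "regular_at (\<lambda>z. z - 1 / ?f z) y"
      using regf y by (intro regular_at_diff_inverse) (auto simp: F_def)
    from regular_at_cong[OF this funpow_Suc_eq] have rk: "regular_at ?k y" .
    then have "regular_at (\<lambda>z. h ((h ^^ n) z)) y" by (simp add: o_def)
    from regular_at_factor[OF half_plane_self_map_funpow[OF self] rn(1) this]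
    have An: "(T ^^ n) y \<in> A" using rn(2) by (simp add: A_def)
    then have "boundary_value ?k y = (T ^^ Suc n) y"
      using regular_funpow[of "Suc n" y] orbit y by (auto simp: less_Suc_eq)
    moreover have "boundary_value ?k y = y - 1 / F y"
    proof (rule boundary_value_eqI)
      have "((\<lambda>z. z - 1 / ?f z) \<longlongrightarrow> of_real y - 1 / of_real (F y)) (vertical_filter y)"
        using y(3) tendsto_boundary_value[OF regf[OF y(1,2)]]
        by (intro tendsto_intros tendsto_vertical_filter) (auto simp: F_def)
      moreover have "\<forall>\<^sub>F z in vertical_filter y. z - 1 / ?f z = ?k z"
        using eventually_vertical_Im_pos by eventually_elim (rule funpow_Suc_eq)
      ultimately show "(?k \<longlongrightarrow> complex_of_real (y - 1 / F y)) (vertical_filter y)"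
        using Lim_transform_eventually by fastforce
    qed
    ultimately show ?thesis using An by simp
  qed
  have F0: "F y0 = 0" using nonzero[of y0] y0 by blast
  have pos: "F y > 0" if "y0 < y" "y < b" for y using mono[of y0 y] F0 y0 that by simp
  have neg: "F y < 0" if "a < y" "y < y0" for y using mono[of y y0] F0 y0 that by simp
  show "(T ^^ n) y \<in> A" if "a < y" "y < b" "y \<noteq> y0" for y
    using nonzero[of y] pos[of y] neg[of y] that by force
  have cont: "(F \<longlongrightarrow> 0) (at y0 within S)" for S
    using Fd[OF y0(1,2)] F0 DERIV_isCont by (metis continuous_within continuous_at_imp_continuous_within)
  have evR: "\<forall>\<^sub>F y in at_right y0. y0 < y \<and> y < b"
    using y0 by (auto simp: eventually_at_right_field)
  have evL: "\<forall>\<^sub>F y in at_left y0. a < y \<and> y < y0"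
    using y0 by (auto simp: eventually_at_left_field)
  show "filterlim (T ^^ Suc n) at_bot (at_right y0)"
  proof -
    have "\<forall>\<^sub>F y in at_right y0. F y > 0" using evR by eventually_elim (use pos in auto)
    then have "\<forall>\<^sub>F y in at_right y0. F y \<in> {0<..} \<and> F y \<noteq> 0" by eventually_elim auto
    then have "filterlim F (at_right 0) (at_right y0)"
      using cont by (simp add: filterlim_at)
    from filterlim_compose[OF filterlim_inverse_at_top_right this]
    have "filterlim (\<lambda>y. inverse (F y)) at_top (at_right y0)" .
    from filterlim_tendsto_add_at_top[OF tendsto_minus[OF tendsto_ident_at] this]
    have "filterlim (\<lambda>y. - (y + - inverse (F y))) at_top (at_right y0)" by simp
    then have "filterlim (\<lambda>y. y + - inverse (F y)) at_bot (at_right y0)"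
      by (subst filterlim_uminus_at_bot)
    moreover have "\<forall>\<^sub>F y in at_right y0. y + - inverse (F y) = (T ^^ Suc n) y"
      using evR
    proof eventually_elim
      case (elim y)
      then have y: "a < y" "y < b" "F y \<noteq> 0" using pos[of y] y0 by auto
      show ?case by (subst conjunct2[OF nonzero[OF y]]) (simp only: inverse_eq_divide diff_conv_add_uminus)
    qed
    ultimately show ?thesis by (rule iffD1[OF filterlim_cong[OF refl refl], rotated])
  qed
  show "filterlim (T ^^ Suc n) at_top (at_left y0)"
  proof -
    have "\<forall>\<^sub>F y in at_left y0. F y < 0" using evL by eventually_elim (use neg in auto)
    then have "\<forall>\<^sub>F y in at_left y0. F y \<in> {..<0} \<and> F y \<noteq> 0" by eventually_elim auto
    then have "filterlim F (at_left 0) (at_left y0)"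
      using cont by (simp add: filterlim_at)
    from filterlim_compose[OF filterlim_inverse_at_bot_neg this]
    have "filterlim (\<lambda>y. inverse (F y)) at_bot (at_left y0)" .
    then have "filterlim (\<lambda>y. - inverse (F y)) at_top (at_left y0)"
      by (simp add: filterlim_uminus_at_top)
    from filterlim_tendsto_add_at_top[OF tendsto_ident_at this]
    have "filterlim (\<lambda>y. y + - inverse (F y)) at_top (at_left y0)" .
    moreover have "\<forall>\<^sub>F y in at_left y0. y + - inverse (F y) = (T ^^ Suc n) y"
      using evL
    proof eventually_elim
      case (elim y)
      then have y: "a < y" "y < b" "F y \<noteq> 0" using neg[of y] y0 by auto
      show ?case by (subst conjunct2[OF nonzero[OF y]]) (simp only: inverse_eq_divide diff_conv_add_uminus)
    qed
    ultimately show ?thesis by (rule iffD1[OF filterlim_cong[OF refl refl], rotated])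
  qed
qed

end

section \<open>Expanding dynamics on the line\<close>

text \<open>The assumptions are invariant under reflection of the line. \<open>Per\<close> is a
  parameter because periodic orbits may pass through points outside \<open>A\<close>, where
  \<open>T\<close> need not be meaningful.\<close>

locale expanding_dynamics =
  fixes T :: "real \<Rightarrow> real" and A :: "real set" and m c C R :: real and Per :: "nat \<Rightarrow> real \<Rightarrow> bool"
  assumes open_A: "open A" and m: "m > 0" and c: "c > 0"
    and deriv: "\<And>x. x \<in> A \<Longrightarrow> \<exists>d. (T has_real_derivative d) (at x) \<and> 1 + (T x - x)\<^sup>2 / m \<le> d \<and> 1 + c / (1 + x\<^sup>2) \<le> d"
    and far: "\<And>x. R < \<bar>x\<bar> \<Longrightarrow> x \<in> A"
    and decay: "\<And>x. R < \<bar>x\<bar> \<Longrightarrow> \<bar>x\<bar> * \<bar>T x - x\<bar> \<le> C"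
    and periodic: "\<And>n y. (\<And>j. j \<le> n \<Longrightarrow> (T ^^ j) y \<in> A) \<Longrightarrow> (T ^^ Suc n) y = y \<Longrightarrow> Per (Suc n) y"
    and pole: "\<And>a b n y0. (\<And>y j. a < y \<Longrightarrow> y < b \<Longrightarrow> j < n \<Longrightarrow> (T ^^ j) y \<in> A) \<Longrightarrow>
        (\<And>p. a < p \<Longrightarrow> p < b \<Longrightarrow> \<not> Per (Suc n) p) \<Longrightarrow> a < y0 \<Longrightarrow> y0 < b \<Longrightarrow> (T ^^ n) y0 \<notin> A \<Longrightarrow>
        (\<forall>y. a < y \<and> y < b \<and> y \<noteq> y0 \<longrightarrow> (T ^^ n) y \<in> A) \<and>
        filterlim (T ^^ Suc n) at_bot (at_right y0) \<and> filterlim (T ^^ Suc n) at_top (at_left y0)"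
begin

section \<open>Displacement and drift on the line\<close>

lemma T_diff_deriv:
  assumes "x \<in> A"
  obtains d where "((\<lambda>x. T x - x) has_real_derivative d) (at x)" "(T x - x)\<^sup>2 / m \<le> d" "c / (1 + x\<^sup>2) \<le> d" "d > 0"
proof -
  obtain d where d: "(T has_real_derivative d) (at x)" "1 + (T x - x)\<^sup>2 / m \<le> d" "1 + c / (1 + x\<^sup>2) \<le> d"
    using deriv[OF assms] by blast
  have "c / (1 + x\<^sup>2) > 0" using c by (intro divide_pos_pos) (auto simp: add_pos_nonneg)
  then show thesis
    using d by (intro that[of "d - 1"]) (auto intro!: derivative_eq_intros)
qed

lemma T_diff_less:
  assumes "x < y" "{x..y} \<subseteq> A"
  shows "T x - x < T y - y"
proof (rule DERIV_pos_imp_increasing[OF assms(1), of "\<lambda>x. T x - x"])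
  fix z assume "x \<le> z" "z \<le> y"
  then have "z \<in> A" using assms by auto
  from T_diff_deriv[OF this] show "\<exists>d. ((\<lambda>x. T x - x) has_real_derivative d) (at z) \<and> 0 < d" by metis
qed

lemma T_growth:
  assumes "x \<le> y" "{x..y} \<subseteq> A" and B: "\<And>z. x \<le> z \<Longrightarrow> z \<le> y \<Longrightarrow> \<bar>z\<bar> \<le> B"
  shows "(1 + c / (1 + B\<^sup>2)) * (y - x) \<le> T y - T x"
proof -
  define k where "k = c / (1 + B\<^sup>2)"
  have "(T x - x) - k * x \<le> (T y - y) - k * y"
  proof (rule DERIV_nonneg_imp_nondecreasing[OF assms(1), of "\<lambda>x. (T x - x) - k * x"])
    fix z assume z: "x \<le> z" "z \<le> y"
    then have "z \<in> A" using assms by auto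
    then obtain d where d: "((\<lambda>x. T x - x) has_real_derivative d) (at z)" "c / (1 + z\<^sup>2) \<le> d"
      by (rule T_diff_deriv)
    have "z\<^sup>2 \<le> B\<^sup>2" using power_mono[OF B[OF z], of 2] by simp
    then have "k \<le> c / (1 + z\<^sup>2)" unfolding k_def using c by (intro divide_left_mono) (auto simp: add_pos_nonneg)
    then have "0 \<le> d - k" using d(2) by linarith
    moreover have "((\<lambda>x. (T x - x) - k * x) has_real_derivative (d - k)) (at z)"
      by (rule DERIV_diff[OF d(1) DERIV_cmult_Id])
    ultimately show "\<exists>d. ((\<lambda>x. (T x - x) - k * x) has_real_derivative d) (at z) \<and> 0 \<le> d" by blast
  qed
  then show ?thesis by (simp add: k_def[symmetric] algebra_simps)
qed

lemma T_less: "x < y \<Longrightarrow> {x..y} \<subseteq> A \<Longrightarrow> y - x < T y - T x"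
  using T_diff_less[of x y] by simp

text \<open>The Riccati inequality \<open>N' \<ge> N\<^sup>2 / m\<close> for \<open>N x = T x - x\<close>.\<close>

lemma riccati_right:
  assumes xy: "x < y" "{x..y} \<subseteq> A"
  shows "y - m / (y - x) \<le> T y"
proof (cases "T y - y \<ge> 0")
  case True
  have "m / (y - x) > 0" using m xy by simp
  then show ?thesis using True by linarith
next
  case False
  \<comment> \<open>Integrates the Riccati inequality: as long as the displacement is nonzero, its
    negative reciprocal grows at least at rate \<open>1 / m\<close>, so \<open>g\<close> is
    nondecreasing.\<close>
  define g where "g z = - 1 / (T z - z) - z / m" for z
  have neg: "T z - z < 0" if "x \<le> z" "z \<le> y" for z
    using T_diff_less[of z y] that False xy(2) by (cases "z = y") force+
  have "g x \<le> g y"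
  proof (rule DERIV_nonneg_imp_nondecreasing[of x y g])
    fix z assume z: "x \<le> z" "z \<le> y"
    then have "z \<in> A" using xy by auto
    then obtain d where d: "((\<lambda>x. T x - x) has_real_derivative d) (at z)" "(T z - z)\<^sup>2 / m \<le> d"
      by (rule T_diff_deriv)
    have nz: "T z - z \<noteq> 0" using neg[OF z] by simp
    have "(g has_real_derivative (d / (T z - z)\<^sup>2 - 1 / m)) (at z)"
      unfolding g_def
      using DERIV_diff[OF DERIV_minus[OF DERIV_inverse_fun[OF d(1) nz]] DERIV_cdivide[OF DERIV_ident, of m]]
      by (simp add: divide_inverse power2_eq_square)
    moreover have "1 / m \<le> d / (T z - z)\<^sup>2"
      using d(2) nz m by (simp add: field_simps)
    ultimately show "\<exists>d. (g has_real_derivative d) (at z) \<and> 0 \<le> d"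
      by (intro exI[of _ "d / (T z - z)\<^sup>2 - 1 / m"]) simp
  qed (use xy in simp)
  define s where "s = y - T y"
  have s: "s > 0" using False by (simp add: s_def)
  have "0 < - 1 / (T x - x)" using neg[of x] xy by (simp add: divide_neg_neg)
  moreover have "T y - y = - s" by (simp add: s_def)
  then have "- 1 / (T y - y) = 1 / s" by simp
  ultimately have "(y - x) / m \<le> 1 / s"
    using \<open>g x \<le> g y\<close> unfolding g_def diff_divide_distrib by linarith
  then have "s \<le> m / (y - x)" using s m xy by (simp add: field_simps)
  then show ?thesis by (simp add: s_def)
qed

text \<open>Conjugation by y -> -y exchanges the two ends of the line, so that every one-sided
  statement has to be proved for one side only.\<close>

lemma mirror: "expanding_dynamics (\<lambda>y. - T (- y)) {y. - y \<in> A} m c C R (\<lambda>n y. Per n (- y))"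
proof -
  have fp: "((\<lambda>y. - T (- y)) ^^ n) y = - ((T ^^ n) (- y))" for n y by (induction n) auto
  show ?thesis
  proof
    have "{y. - y \<in> A} = uminus ` A" by force
    then show "open {y. - y \<in> A}" using open_A open_negations by simp
    fix x assume "x \<in> {y. - y \<in> A}"
    then obtain d where d: "(T has_real_derivative d) (at (- x))" "1 + (T (- x) - (- x))\<^sup>2 / m \<le> d" "1 + c / (1 + (- x)\<^sup>2) \<le> d"
      using deriv[of "- x"] by auto
    have "((\<lambda>y. - T (- y)) has_real_derivative d) (at x)"
      using DERIV_minus[OF DERIV_chain2[where f = T and g = uminus and x = x and s = UNIV, OF d(1) DERIV_minus[OF DERIV_ident]]]
      by simp
    moreover have "(- T (- x) - x)\<^sup>2 = (T (- x) - (- x))\<^sup>2" by (simp add: power2_eq_square algebra_simps)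
    ultimately show "\<exists>d. ((\<lambda>y. - T (- y)) has_real_derivative d) (at x) \<and> 1 + (- T (- x) - x)\<^sup>2 / m \<le> d \<and> 1 + c / (1 + x\<^sup>2) \<le> d"
      using d by (intro exI[of _ d]) simp
  next
    fix x assume "R < \<bar>x\<bar>"
    then show "x \<in> {y. - y \<in> A}" "\<bar>x\<bar> * \<bar>- T (- x) - x\<bar> \<le> C"
      using far[of "- x"] decay[of "- x"] by (auto simp: abs_minus_commute) (metis abs_minus_cancel minus_diff_eq uminus_add_conv_diff add.commute diff_minus_eq_add)
  next
    fix n y assume "\<And>j. j \<le> n \<Longrightarrow> ((\<lambda>y. - T (- y)) ^^ j) y \<in> {y. - y \<in> A}" "((\<lambda>y. - T (- y)) ^^ Suc n) y = y"
    then show "Per (Suc n) (- y)"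
      using periodic[of n "- y"] unfolding fp by simp
  next
    fix a b n y0
    assume 1: "\<And>y j. a < y \<Longrightarrow> y < b \<Longrightarrow> j < n \<Longrightarrow> ((\<lambda>y. - T (- y)) ^^ j) y \<in> {y. - y \<in> A}"
      and 2: "\<And>p. a < p \<Longrightarrow> p < b \<Longrightarrow> \<not> Per (Suc n) (- p)" and 3: "a < y0" "y0 < b"
      and 4: "((\<lambda>y. - T (- y)) ^^ n) y0 \<notin> {y. - y \<in> A}"
    have "(T ^^ j) y \<in> A" if "- b < y" "y < - a" "j < n" for y j
      using 1[of "- y" j] that unfolding fp by simp
    moreover have "\<not> Per (Suc n) p" if "- b < p" "p < - a" for p using 2[of "- p"] that by simp
    ultimately have *: "(\<forall>y. - b < y \<and> y < - a \<and> y \<noteq> - y0 \<longrightarrow> (T ^^ n) y \<in> A) \<and>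
        filterlim (T ^^ Suc n) at_bot (at_right (- y0)) \<and> filterlim (T ^^ Suc n) at_top (at_left (- y0))"
      using 3 4 unfolding fp by (intro pole) auto
    have "filterlim (\<lambda>y. (T ^^ Suc n) (- y)) at_top (at_right y0)"
      using * filterlim_at_left_to_right[of "T ^^ Suc n" at_top "- y0"] by (simp del: funpow.simps)
    then have f1: "filterlim (\<lambda>y. - (T ^^ Suc n) (- y)) at_bot (at_right y0)"
      by (subst filterlim_uminus_at_bot) (simp del: funpow.simps)
    have "filterlim (\<lambda>y. (T ^^ Suc n) (- y)) at_bot (at_left y0)"
      using * by (simp add: at_left_minus[of y0] filterlim_filtermap del: funpow.simps)
    then have f2: "filterlim (\<lambda>y. - (T ^^ Suc n) (- y)) at_top (at_left y0)"
      by (subst filterlim_uminus_at_top) (simp del: funpow.simps)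
    have "- ((T ^^ n) (- y)) \<in> {y. - y \<in> A}" if "a < y" "y < b" "y \<noteq> y0" for y
      using * that by simp
    then show "(\<forall>y. a < y \<and> y < b \<and> y \<noteq> y0 \<longrightarrow> ((\<lambda>y. - T (- y)) ^^ n) y \<in> {y. - y \<in> A}) \<and>
        filterlim ((\<lambda>y. - T (- y)) ^^ Suc n) at_bot (at_right y0) \<and>
        filterlim ((\<lambda>y. - T (- y)) ^^ Suc n) at_top (at_left y0)"
      using f1 f2 unfolding fp by (simp del: funpow.simps)
  qed (use m c in auto)
qed

lemma riccati_left:
  assumes xy: "x < y" "{x..y} \<subseteq> A"
  shows "T x \<le> x + m / (y - x)"
proof -
  have "{- y..- x} \<subseteq> {y. - y \<in> A}" using xy(2) by auto
  from expanding_dynamics.riccati_right[OF mirror _ this] xy(1) show ?thesis by simp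
qed

lemma T_diff_tendsto_0: "((\<lambda>x. T x - x) \<longlongrightarrow> 0) at_top" "((\<lambda>x. T x - x) \<longlongrightarrow> 0) at_bot"
proof -
  have ev: "\<bar>T x - x\<bar> \<le> \<bar>C\<bar> * \<bar>inverse x\<bar>" if "R < \<bar>x\<bar>" "x \<noteq> 0" for x
  proof -
    have "\<bar>x\<bar> * \<bar>T x - x\<bar> \<le> \<bar>C\<bar>" using decay[OF that(1)] by linarith
    then show ?thesis using that(2) by (simp add: field_simps abs_inverse)
  qed
  have lim: "((\<lambda>x::real. \<bar>C\<bar> * \<bar>inverse x\<bar>) \<longlongrightarrow> 0) at_infinity"
    by (intro tendsto_mult_right_zero tendsto_rabs_zero tendsto_inverse_0)
  note top = tendsto_mono[OF at_top_le_at_infinity lim] tendsto_mono[OF at_bot_le_at_infinity lim]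
  have e1: "\<forall>\<^sub>F x in at_top. norm (T x - x) \<le> \<bar>C\<bar> * \<bar>inverse x\<bar>"
    using eventually_gt_at_top[of "max 0 \<bar>R\<bar>"]
  proof eventually_elim
    case (elim x)
    then have "R < \<bar>x\<bar>" "x \<noteq> 0" by auto
    from ev[OF this] show ?case by (simp only: real_norm_def)
  qed
  have e2: "\<forall>\<^sub>F x in at_bot. norm (T x - x) \<le> \<bar>C\<bar> * \<bar>inverse x\<bar>"
    using eventually_gt_at_bot[of "- max 0 \<bar>R\<bar>"]
  proof eventually_elim
    case (elim x)
    then have "R < \<bar>x\<bar>" "x \<noteq> 0" by auto
    from ev[OF this] show ?case by (simp only: real_norm_def)
  qed
  show "((\<lambda>x. T x - x) \<longlongrightarrow> 0) at_top" by (rule Lim_null_comparison[OF e1 top(1)])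
  show "((\<lambda>x. T x - x) \<longlongrightarrow> 0) at_bot" by (rule Lim_null_comparison[OF e2 top(2)])
qed

text \<open>The displacement increases strictly and tends to 0 at plus infinity, so it is negative;
  the comparison with \<open>y + 1\<close> secures strictness.\<close>

lemma T_diff_neg_right:
  assumes "{y..} \<subseteq> A"
  shows "T y - y < 0"
proof -
  have "T y - y < T (y + 1) - (y + 1)" using assms by (intro T_diff_less) auto
  also have "\<dots> \<le> 0"
  proof (rule tendsto_lowerbound[OF T_diff_tendsto_0(1)])
    show "\<forall>\<^sub>F x in at_top. T (y + 1) - (y + 1) \<le> T x - x"
      using eventually_gt_at_top[of "y + 1"]
    proof eventually_elim
      case (elim x)
      then have "T (y + 1) - (y + 1) < T x - x" using assms by (intro T_diff_less) auto
      then show ?case by simp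
    qed
  qed simp
  finally show ?thesis .
qed

lemma T_diff_pos_left:
  assumes "{..y} \<subseteq> A"
  shows "T y - y > 0"
proof -
  have "{- y..} \<subseteq> {y. - y \<in> A}" using assms by auto
  from expanding_dynamics.T_diff_neg_right[OF mirror this] show ?thesis by simp
qed

text \<open>The displacement at \<open>2 * D\<close> is negative, and over \<open>{D..2 * D}\<close>
  it has risen by at least c * D / (1 + 4 * D^2), hence by \<open>c / (5 * D)\<close> when
  \<open>D \<ge> 1\<close>. It was therefore at least that far below 0 at \<open>D\<close>, and at
  \<open>y\<close> it is lower still.\<close>

lemma drift_right:
  assumes "{y..} \<subseteq> A" "y \<le> D" "D \<ge> 1"
  shows "T y \<le> y - c / (5 * D)"
proof -
  have "T y - y \<le> T D - D"
    using T_diff_less[of y D] assms by (cases "y = D") force+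
  moreover have "T (2 * D) - 2 * D < 0" using assms by (intro T_diff_neg_right) auto
  moreover have "(1 + c / (1 + (2 * D)\<^sup>2)) * (2 * D - D) \<le> T (2 * D) - T D"
    using assms by (intro T_growth) auto
  moreover have "c / (5 * D) \<le> c / (1 + (2 * D)\<^sup>2) * D"
  proof -
    have "1 \<le> D\<^sup>2" using assms by simp
    then have "1 + (2 * D)\<^sup>2 \<le> 5 * D\<^sup>2" by (simp add: power_mult_distrib)
    then have "c * D / (5 * D\<^sup>2) \<le> c * D / (1 + (2 * D)\<^sup>2)"
      using c assms by (intro divide_left_mono) (auto simp: add_pos_nonneg)
    then show ?thesis using assms by (simp add: power2_eq_square)
  qed
  ultimately show ?thesis by (simp add: algebra_simps)
qed

lemma complement_nonempty: "A \<noteq> UNIV"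
proof
  assume "A = UNIV"
  then show False using T_diff_neg_right[of 0] T_diff_pos_left[of 0] by simp
qed

definition p1 :: real where "p1 = Inf (- A)"
definition p2 :: real where "p2 = Sup (- A)"

lemma complement_bounds:
  shows "p1 \<notin> A" "p2 \<notin> A" "y \<notin> A \<Longrightarrow> p1 \<le> y" "y \<notin> A \<Longrightarrow> y \<le> p2" "\<bar>p1\<bar> \<le> \<bar>R\<bar>" "\<bar>p2\<bar> \<le> \<bar>R\<bar>" "p1 \<le> p2"
    "{..<p1} \<subseteq> A" "{p2<..} \<subseteq> A"
proof -
  have cl: "closed (- A)" using open_A by (simp add: closed_Compl)
  have ne: "- A \<noteq> {}" using complement_nonempty by auto
  have R: "\<bar>y\<bar> \<le> \<bar>R\<bar>" if "y \<in> - A" for y using far[of y] that by force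
  have bb: "bdd_below (- A)" using R by (intro bdd_belowI[of _ "- \<bar>R\<bar>"]) (force simp: abs_le_iff)
  have ba: "bdd_above (- A)" using R by (intro bdd_aboveI[of _ "\<bar>R\<bar>"]) (force simp: abs_le_iff)
  have 1: "p1 \<in> - A" unfolding p1_def using closed_contains_Inf[OF ne bb cl] .
  have 2: "p2 \<in> - A" unfolding p2_def using closed_contains_Sup[OF ne ba cl] .
  show "p1 \<notin> A" "p2 \<notin> A" using 1 2 by auto
  show lo: "p1 \<le> y" if "y \<notin> A" for y unfolding p1_def using that bb by (intro cInf_lower) auto
  show hi: "y \<le> p2" if "y \<notin> A" for y unfolding p2_def using that ba by (intro cSup_upper) auto
  show "\<bar>p1\<bar> \<le> \<bar>R\<bar>" "\<bar>p2\<bar> \<le> \<bar>R\<bar>" using R 1 2 by auto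
  show "p1 \<le> p2" using lo 2 by auto
  show "{..<p1} \<subseteq> A" "{p2<..} \<subseteq> A" using lo hi by force+
qed

lemma mirror_p: "expanding_dynamics.p1 {y. - y \<in> A} = - p2" "expanding_dynamics.p2 {y. - y \<in> A} = - p1"
proof -
  interpret M: expanding_dynamics "\<lambda>y. - T (- y)" "{y. - y \<in> A}" m c C R "\<lambda>n y. Per n (- y)" by (rule mirror)
  show "M.p1 = - p2" using M.complement_bounds(1) M.complement_bounds(3)[of "- p2"] complement_bounds(2) complement_bounds(4)[of "- M.p1"] by force
  show "M.p2 = - p1" using M.complement_bounds(2) M.complement_bounds(4)[of "- p1"] complement_bounds(1) complement_bounds(3)[of "- M.p2"] by force
qed

lemma funpow_continuous:
  assumes "\<And>j. j < n \<Longrightarrow> (T ^^ j) y \<in> A"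
  shows "isCont (T ^^ n) y"
  using assms
proof (induction n)
  case (Suc n)
  have "(T ^^ n) y \<in> A" using Suc.prems by simp
  then have "isCont T ((T ^^ n) y)" using deriv DERIV_isCont by blast
  then show ?case using continuous_at_compose[of y "T ^^ n" T] Suc by (simp add: o_def)
qed (simp add: id_def)

lemma funpow_continuous_on:
  assumes "\<And>y j. y \<in> S \<Longrightarrow> j < n \<Longrightarrow> (T ^^ j) y \<in> A"
  shows "continuous_on S (T ^^ n)"
  using funpow_continuous assms by (meson continuous_at_imp_continuous_on)

text \<open>By continuity the image interval consists of orbit points, so avoiding the complement
  pointwise means avoiding it as an interval. This keeps the iterate monotone and expanding at every
  stage.\<close>

lemma funpow_image_interval:
  assumes uv: "u \<le> v" and "\<And>y j. u \<le> y \<Longrightarrow> y \<le> v \<Longrightarrow> j \<le> n \<Longrightarrow> (T ^^ j) y \<in> A"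
  shows "{(T ^^ n) u..(T ^^ n) v} \<subseteq> A" "v - u \<le> (T ^^ n) v - (T ^^ n) u"
proof -
  have "{(T ^^ j) u..(T ^^ j) v} \<subseteq> A \<and> v - u \<le> (T ^^ j) v - (T ^^ j) u" if "j \<le> n" for j
    using that
  proof (induction j)
    case 0
    then show ?case using assms(2)[of _ 0] by auto
  next
    case (Suc j)
    then have IH: "{(T ^^ j) u..(T ^^ j) v} \<subseteq> A" "v - u \<le> (T ^^ j) v - (T ^^ j) u" by auto
    have "(T ^^ j) v - (T ^^ j) u \<le> T ((T ^^ j) v) - T ((T ^^ j) u)"
      using T_less[of "(T ^^ j) u" "(T ^^ j) v"] IH uv by (cases "(T ^^ j) u = (T ^^ j) v") force+
    moreover have "{(T ^^ Suc j) u..(T ^^ Suc j) v} \<subseteq> A"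
    proof
      fix w assume w: "w \<in> {(T ^^ Suc j) u..(T ^^ Suc j) v}"
      have "continuous_on {u..v} (T ^^ Suc j)"
        using assms(2) Suc.prems by (intro funpow_continuous_on) auto
      then obtain y where "u \<le> y" "y \<le> v" "(T ^^ Suc j) y = w"
        using IVT'[of "T ^^ Suc j" u w v] w uv by auto
      then show "w \<in> A" using assms(2)[of y "Suc j"] Suc.prems by auto
    qed
    ultimately show ?case using IH by simp
  qed
  then show "{(T ^^ n) u..(T ^^ n) v} \<subseteq> A" "v - u \<le> (T ^^ n) v - (T ^^ n) u" by auto
qed

end

section \<open>Orbits of intervals\<close>

context expanding_dynamics
begin

lemma drift_left:
  assumes "{..y} \<subseteq> A" "- D \<le> y" "D \<ge> 1"
  shows "y + c / (5 * D) \<le> T y"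
proof -
  have "{- y..} \<subseteq> {y. - y \<in> A}" using assms by auto
  from expanding_dynamics.drift_right[OF mirror this, of D] assms show ?thesis by simp
qed

text \<open>An end of the interval beyond the complement of \<open>A\<close> drifts inwards;
  otherwise it lies on the near side of \<open>\<bar>R\<bar>\<close> and the Riccati bound limits
  its outward jump to \<open>m / l\<close>. The left end is controlled only from above and the right
  end only from below, which is enough to keep the interval near the origin.\<close>

lemma orbit_bounds:
  assumes D: "D \<ge> \<bar>R\<bar> + m / l" and l: "l > 0" and uv: "u + l \<le> v" "{u..v} \<subseteq> A" "u \<le> D" "- D \<le> v"
  shows "T u \<le> D" "- D \<le> T v" "T u + l \<le> T v"
proof -
  have u_lt: "u < v" using uv l by simp
  have ml: "m / (v - u) \<le> m / l" using uv l m by (intro divide_left_mono) auto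
  show "T u \<le> D"
  proof (cases "u > p2")
    case True
    then have "{u..} \<subseteq> A" using complement_bounds(9) by auto
    from T_diff_neg_right[OF this] show ?thesis using uv by simp
  next
    case False
    then have "u \<le> \<bar>R\<bar>" using complement_bounds(6) by linarith
    then show ?thesis using riccati_left[OF u_lt uv(2)] ml D by linarith
  qed
  show "- D \<le> T v"
  proof (cases "v < p1")
    case True
    then have "{..v} \<subseteq> A" using complement_bounds(8) by auto
    from T_diff_pos_left[OF this] show ?thesis using uv by simp
  next
    case False
    then have "- \<bar>R\<bar> \<le> v" using complement_bounds(5) by linarith
    then show ?thesis using riccati_right[OF u_lt uv(2)] ml D by linarith
  qed
  show "T u + l \<le> T v" using T_less[OF u_lt uv(2)] uv by linarith
qed

lemma long_interval_side:
  assumes "{u..v} \<subseteq> A" "p2 - p1 < v - u" "u \<le> v"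
  shows "p2 < u \<or> v < p1"
proof (rule ccontr)
  assume "\<not> (p2 < u \<or> v < p1)"
  then have "u \<le> p2" "p1 \<le> v" by auto
  moreover have "\<not> (u \<le> p2 \<and> p2 \<le> v)" "\<not> (u \<le> p1 \<and> p1 \<le> v)"
    using assms(1) complement_bounds(1,2) by auto
  ultimately show False using assms(2) complement_bounds(7) by linarith
qed

text \<open>\<open>L \<ge> m\<close> limits a leftward jump of the right end to 1, so that end stays
  to the right of \<open>p2\<close>; an interval longer than \<open>p2 - p1\<close> cannot fit
  between \<open>p1\<close> and \<open>p2\<close>, so all of it stays there. The left end loses
  \<open>c / (5 * D)\<close> per step and would travel \<open>2 * D\<close>, past the
  complement.\<close>

lemma long_interval_drift_right:
  assumes L: "L \<ge> p2 - p1 + m + 1" and D: "D \<ge> 1" "D \<ge> \<bar>R\<bar>" and I: "10 * D\<^sup>2 \<le> real I * c"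
    and uv: "L < v - u" "p2 < u" "u \<le> D"
  shows "\<exists>i\<le>I. \<not> {(T ^^ i) u..(T ^^ i) v} \<subseteq> A"
proof (rule ccontr)
  assume "\<not> ?thesis"
  then have all: "{(T ^^ i) u..(T ^^ i) v} \<subseteq> A" if "i \<le> I" for i using that by blast
  have Lpos: "L \<ge> 1" "L \<ge> m" using L m complement_bounds(7) by linarith+
  have "L < (T ^^ i) v - (T ^^ i) u \<and> p2 < (T ^^ i) u \<and> (T ^^ i) u \<le> D - real i * (c / (5 * D))" if "i \<le> I" for i
    using that
  proof (induction i)
    case 0
    then show ?case using uv by simp
  next
    case (Suc i)
    define u' where "u' = (T ^^ i) u"
    define v' where "v' = (T ^^ i) v"
    have IH: "L < v' - u'" "p2 < u'" "u' \<le> D - real i * (c / (5 * D))" using Suc by (auto simp: u'_def v'_def)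
    have A': "{u'..v'} \<subseteq> A" using all[of i] Suc.prems by (simp add: u'_def v'_def)
    have A'': "{T u'..T v'} \<subseteq> A" using all[of "Suc i"] Suc.prems by (simp add: u'_def v'_def)
    have lt: "u' < v'" using IH Lpos by linarith
    have "m / (v' - u') \<le> 1" using IH Lpos m by (simp add: pos_divide_le_eq)
    then have "p2 < T v'" using riccati_right[OF lt A'] IH Lpos by linarith
    moreover have len: "L < T v' - T u'" using T_less[OF lt A'] IH by linarith
    ultimately have "p2 < T u'"
      using long_interval_side[OF A''] L m complement_bounds(7) by linarith
    moreover have "T u' \<le> u' - c / (5 * D)"
    proof (rule drift_right)
      show "{u'..} \<subseteq> A" using IH(2) complement_bounds(9) by auto
      have "0 \<le> real i * (c / (5 * D))" using c D by simp
      then show "u' \<le> D" using IH(3) by linarith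
    qed (rule D)
    moreover have "real (Suc i) * (c / (5 * D)) = real i * (c / (5 * D)) + c / (5 * D)"
      unfolding of_nat_Suc by (simp only: distrib_right mult_1_left add.commute)
    moreover have "(T ^^ Suc i) u = T u'" "(T ^^ Suc i) v = T v'" by (simp_all add: u'_def v'_def)
    ultimately show ?case using len IH(3) by (intro conjI; linarith)
  qed
  from this[OF order.refl] have "p2 < D - real I * (c / (5 * D))" by linarith
  moreover have "2 * D \<le> real I * (c / (5 * D))"
    using I D by (simp add: field_simps power2_eq_square)
  ultimately show False using complement_bounds(6) D by linarith
qed

lemma long_interval_drift:
  assumes L: "L \<ge> p2 - p1 + m + 1" and D: "D \<ge> 1" "D \<ge> \<bar>R\<bar>" and I: "10 * D\<^sup>2 \<le> real I * c"
    and uv: "L < v - u" "{u..v} \<subseteq> A" "u \<le> D" "- D \<le> v"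
  shows "\<exists>i\<le>I. \<not> {(T ^^ i) u..(T ^^ i) v} \<subseteq> A"
proof -
  have "p2 - p1 < v - u" "u \<le> v" using L uv m complement_bounds(7) by linarith+
  from long_interval_side[OF uv(2) this] show ?thesis
  proof
    assume "p2 < u"
    then show ?thesis using long_interval_drift_right[OF L D I uv(1)] uv by blast
  next
    assume v: "v < p1"
    interpret M: expanding_dynamics "\<lambda>y. - T (- y)" "{y. - y \<in> A}" m c C R "\<lambda>n y. Per n (- y)" by (rule mirror)
    have fp: "((\<lambda>y. - T (- y)) ^^ n) y = - ((T ^^ n) (- y))" for n y by (induction n) auto
    obtain i where i: "i \<le> I" "\<not> {- ((T ^^ i) v)..- ((T ^^ i) u)} \<subseteq> {y. - y \<in> A}"
      using M.long_interval_drift_right[of L D I "- u" "- v"] L D I uv v unfolding mirror_p fp by auto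
    then have "\<not> {(T ^^ i) u..(T ^^ i) v} \<subseteq> A" by (auto simp: subset_iff) (metis minus_le_iff le_minus_iff)
    then show ?thesis using i by blast
  qed
qed

text \<open>While its length is at most \<open>L\<close>, the interval lies within distance
  \<open>D + L\<close> of the origin, so each step multiplies the length by \<open>gr\<close>. After
  at most \<open>K\<close> such steps it is long, and \<open>I\<close> further steps of drift drive
  it into the complement.\<close>

lemma interval_entrance:
  assumes l: "l > 0" and D: "D \<ge> 1" "D \<ge> \<bar>R\<bar> + m / l" and L: "L \<ge> p2 - p1 + m + 1"
    and K: "L < (1 + c / (1 + (D + L)\<^sup>2)) ^ K * l" and I: "10 * D\<^sup>2 \<le> real I * c"
    and uv: "v = u + l" "u \<le> D" "- D \<le> v"
  shows "\<exists>k\<le>K + I. \<not> {(T ^^ k) u..(T ^^ k) v} \<subseteq> A"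
proof (rule ccontr)
  assume "\<not> ?thesis"
  then have all: "{(T ^^ k) u..(T ^^ k) v} \<subseteq> A" if "k \<le> K + I" for k using that by blast
  define gr where "gr = 1 + c / (1 + (D + L)\<^sup>2)"
  have DR: "D \<ge> \<bar>R\<bar>" using D m l by (smt (verit) divide_pos_pos)
  have inv: "(T ^^ k) u + l \<le> (T ^^ k) v \<and> (T ^^ k) u \<le> D \<and> - D \<le> (T ^^ k) v" if "k \<le> K + I" for k
    using that
  proof (induction k)
    case 0
    then show ?case using uv by simp
  next
    case (Suc k)
    then show ?case using orbit_bounds[OF D(2) l, of "(T ^^ k) u" "(T ^^ k) v"] all[of k] by simp
  qed
  have "\<exists>k\<le>K. L < (T ^^ k) v - (T ^^ k) u"
  proof (rule ccontr)
    assume "\<not> ?thesis"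
    then have short: "(T ^^ k) v - (T ^^ k) u \<le> L" if "k \<le> K" for k using that by (meson not_le)
    have "gr ^ k * l \<le> (T ^^ k) v - (T ^^ k) u" if "k \<le> K" for k
      using that
    proof (induction k)
      case 0
      then show ?case using uv by simp
    next
      case (Suc k)
      define u' where "u' = (T ^^ k) u"
      define v' where "v' = (T ^^ k) v"
      have b: "u' + l \<le> v'" "u' \<le> D" "- D \<le> v'" "v' - u' \<le> L" "{u'..v'} \<subseteq> A"
        using inv[of k] short[of k] all[of k] Suc.prems by (auto simp: u'_def v'_def)
      have "gr ^ Suc k * l = gr * (gr ^ k * l)" by simp
      also have "\<dots> \<le> gr * (v' - u')"
        using Suc c unfolding u'_def v'_def by (intro mult_left_mono) (auto simp: gr_def add_nonneg_nonneg)
      also have "\<dots> \<le> T v' - T u'"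
        unfolding gr_def using b l by (intro T_growth) auto
      finally show ?case by (simp add: u'_def v'_def)
    qed
    from this[of K] show False using short[of K] K by (simp add: gr_def)
  qed
  then obtain k where k: "k \<le> K" "L < (T ^^ k) v - (T ^^ k) u" by blast
  have "\<exists>i\<le>I. \<not> {(T ^^ i) ((T ^^ k) u)..(T ^^ i) ((T ^^ k) v)} \<subseteq> A"
    using inv[of k] all[of k] k by (intro long_interval_drift[OF L D(1) DR I]) auto
  then obtain i where "i \<le> I" "\<not> {(T ^^ (i + k)) u..(T ^^ (i + k)) v} \<subseteq> A" by (auto simp: funpow_add)
  then show False using all[of "i + k"] k by simp
qed

section \<open>From a first pole to a periodic point\<close>

lemma first_entrance:
  assumes "\<exists>k\<le>K. \<exists>y. a < y \<and> y < b \<and> (T ^^ k) y \<notin> A"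
  shows "\<exists>n y. n \<le> K \<and> a < y \<and> y < b \<and> (T ^^ n) y \<notin> A \<and>
    (\<forall>j y. j < n \<longrightarrow> a < y \<longrightarrow> y < b \<longrightarrow> (T ^^ j) y \<in> A)"
proof -
  define n where "n = (LEAST k. \<exists>y. a < y \<and> y < b \<and> (T ^^ k) y \<notin> A)"
  obtain k where k: "k \<le> K" "\<exists>y. a < y \<and> y < b \<and> (T ^^ k) y \<notin> A" using assms by blast
  have "\<exists>y. a < y \<and> y < b \<and> (T ^^ n) y \<notin> A" unfolding n_def using k(2) by (rule LeastI)
  then obtain y where y: "a < y" "y < b" "(T ^^ n) y \<notin> A" by blast
  have "n \<le> k" unfolding n_def using k(2) by (rule Least_le)
  moreover have "(T ^^ j) y \<in> A" if "j < n" "a < y" "y < b" for j y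
    using not_less_Least[of j] that unfolding n_def by blast
  ultimately show ?thesis using y k(1) by (intro exI[of _ n] exI[of _ y]) auto
qed

lemma filterlim_T_at_bot: "filterlim T at_bot at_bot"
proof -
  have "filterlim (\<lambda>x. - ((T x - x) + x)) at_top at_bot"
    using filterlim_tendsto_add_at_top[OF tendsto_minus[OF T_diff_tendsto_0(2)] filterlim_uminus_at_top_at_bot]
    by simp
  then show ?thesis by (subst filterlim_uminus_at_bot) simp
qed

text \<open>Immediately to the right of a pole \<open>y0\<close> of \<open>T\<^sup>n\<^sup>+\<^sup>1\<close> the iterates sweep out a half-line
  \<open>(-\<infinity>, t]\<close>, whose end point \<open>t\<close> drifts to the right until the complement of \<open>A\<close> is met
  once more. At the pole that arises there, one further iterate covers the whole line.\<close>

lemma periodic_right_of_pole: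
  assumes D: "D \<ge> 1" "D \<ge> \<bar>R\<bar>" and I: "10 * D\<^sup>2 \<le> real I * c"
    and y: "y0 < y1" and orbit: "\<And>y j. y0 < y \<Longrightarrow> y < y1 \<Longrightarrow> j \<le> n \<Longrightarrow> (T ^^ j) y \<in> A"
    and lim: "filterlim (T ^^ Suc n) at_bot (at_right y0)"
    and y': "y0 < y'" "y' < y1" "- D \<le> (T ^^ Suc n) y'"
  shows "\<exists>p k. y0 < p \<and> p < y1 \<and> 0 < k \<and> k \<le> n + I + 2 \<and> Per k p"
proof (rule ccontr)
  assume contra: "\<not> ?thesis"
  have lims: "filterlim (T ^^ j) at_bot (at_right y0)" if "Suc n \<le> j" for j
    using that
  proof (induction j rule: dec_induct)
    case base
    show ?case by (rule lim)
  next
    case (step j)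
    show ?case using filterlim_compose[OF filterlim_T_at_bot step.IH] by (simp add: o_def)
  qed
  have "\<exists>k\<le>n + 1 + I. \<exists>y. y0 < y \<and> y < y1 \<and> (T ^^ k) y \<notin> A"
  proof (rule ccontr)
    assume "\<not> ?thesis"
    then have all: "(T ^^ k) y \<in> A" if "k \<le> n + 1 + I" "y0 < y" "y < y1" for k y using that by blast
    \<comment> \<open>The image of \<open>{y0<..y'}\<close> is connected and unbounded below; with
      an end point not below \<open>p1\<close> it would contain \<open>p1\<close>, which lies
      outside \<open>A\<close>.\<close>
    have below: "(T ^^ (Suc n + i)) y' < p1" if "i \<le> I" for i
    proof (rule ccontr)
      assume "\<not> ?thesis"
      then have ge: "p1 \<le> (T ^^ (Suc n + i)) y'" by simp
      have "\<forall>\<^sub>F y in at_right y0. (T ^^ (Suc n + i)) y \<le> p1"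
        using lims[of "Suc n + i"] unfolding filterlim_at_bot by simp
      moreover have "\<forall>\<^sub>F y in at_right y0. y0 < y \<and> y < y'"
        using y'(1) by (auto simp: eventually_at_right_field)
      ultimately have "\<forall>\<^sub>F y in at_right y0. (T ^^ (Suc n + i)) y \<le> p1 \<and> y0 < y \<and> y < y'"
        by eventually_elim auto
      then obtain z where z: "(T ^^ (Suc n + i)) z \<le> p1" "y0 < z" "z < y'"
        using eventually_happens trivial_limit_at_right_real by blast
      have "continuous_on {z..y'} (T ^^ (Suc n + i))"
        using all that z y' by (intro funpow_continuous_on) auto
      then obtain w where w: "z \<le> w" "w \<le> y'" "(T ^^ (Suc n + i)) w = p1"
        using IVT'[of "T ^^ (Suc n + i)" z p1 y'] z ge by auto
      then have "p1 \<in> A" using all[of "Suc n + i" w] that z y' by auto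
      then show False using complement_bounds(1) by blast
    qed
    have "- D + real i * (c / (5 * D)) \<le> (T ^^ (Suc n + i)) y'" if "i \<le> I" for i
      using that
    proof (induction i)
      case 0
      then show ?case using y'(3) by simp
    next
      case (Suc i)
      define t where "t = (T ^^ (Suc n + i)) y'"
      have t: "- D + real i * (c / (5 * D)) \<le> t" "t < p1" using Suc below[of i] by (auto simp: t_def)
      have "t + c / (5 * D) \<le> T t"
      proof (rule drift_left)
        show "{..t} \<subseteq> A" using t(2) complement_bounds(8) by auto
        have "0 \<le> real i * (c / (5 * D))" using c D by simp
        then show "- D \<le> t" using t(1) by linarith
      qed (rule D)
      moreover have "real (Suc i) * (c / (5 * D)) = real i * (c / (5 * D)) + c / (5 * D)"
        unfolding of_nat_Suc by (simp only: distrib_right mult_1_left add.commute)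
      moreover have "(T ^^ (Suc n + Suc i)) y' = T t" by (simp add: t_def)
      ultimately show ?case using t(1) by linarith
    qed
    from this[OF order.refl] below[OF order.refl] have "- D + real I * (c / (5 * D)) < p1" by linarith
    moreover have "2 * D \<le> real I * (c / (5 * D))"
      using I D by (simp add: field_simps power2_eq_square)
    ultimately show False using complement_bounds(5) D by linarith
  qed
  from first_entrance[OF this] obtain k y2
    where k: "k \<le> n + 1 + I" "y0 < y2" "y2 < y1" "(T ^^ k) y2 \<notin> A"
      and k': "\<forall>j y. j < k \<longrightarrow> y0 < y \<longrightarrow> y < y1 \<longrightarrow> (T ^^ j) y \<in> A" by blast
  note k = k k'[rule_format]
  have kn: "Suc n \<le> k" using k(2-4) orbit by (meson not_less_eq_eq)
  have noper: "\<not> Per (Suc k) p" if "y0 < p" "p < y1" for p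
  proof
    assume P: "Per (Suc k) p"
    have "Suc k \<le> n + I + 2" using k(1) by simp
    then show False using contra that P zero_less_Suc[of k] by blast
  qed
  have P: "(\<forall>y. y0 < y \<and> y < y1 \<and> y \<noteq> y2 \<longrightarrow> (T ^^ k) y \<in> A) \<and>
        filterlim (T ^^ Suc k) at_bot (at_right y2) \<and> filterlim (T ^^ Suc k) at_top (at_left y2)"
    by (rule pole) (use k noper in auto)
  \<comment> \<open>Just right of \<open>y0\<close> the iterate lies below the interval and just
    left of \<open>y2\<close> above it, so it crosses the diagonal in between.\<close>
  have "\<forall>\<^sub>F y in at_right y0. (T ^^ Suc k) y \<le> y0"
    using lims[of "Suc k"] kn unfolding filterlim_at_bot by (simp del: funpow.simps)
  moreover have "\<forall>\<^sub>F y in at_right y0. y0 < y \<and> y < y2"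
    using k(2) by (auto simp: eventually_at_right_field)
  ultimately have "\<forall>\<^sub>F y in at_right y0. (T ^^ Suc k) y \<le> y0 \<and> y0 < y \<and> y < y2"
    by eventually_elim auto
  then obtain z where z: "(T ^^ Suc k) z \<le> y0" "y0 < z" "z < y2"
    using eventually_happens trivial_limit_at_right_real by blast
  have "\<forall>\<^sub>F y in at_left y2. y2 \<le> (T ^^ Suc k) y"
    using P unfolding filterlim_at_top by (simp del: funpow.simps)
  moreover have "\<forall>\<^sub>F y in at_left y2. z < y \<and> y < y2"
    using z(3) by (auto simp: eventually_at_left_field)
  ultimately have "\<forall>\<^sub>F y in at_left y2. y2 \<le> (T ^^ Suc k) y \<and> z < y \<and> y < y2"
    by eventually_elim auto
  then obtain w where w: "y2 \<le> (T ^^ Suc k) w" "z < w" "w < y2"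
    using eventually_happens trivial_limit_at_left_real by blast
  have A: "(T ^^ j) y \<in> A" if "z \<le> y" "y \<le> w" "j \<le> k" for y j
    using P k(5)[of j y] that z w k(2,3) by (cases "j = k") auto
  have "continuous_on {z..w} (\<lambda>y. (T ^^ Suc k) y - y)"
    using A by (intro continuous_intros funpow_continuous_on) (auto simp: less_Suc_eq_le simp del: funpow.simps)
  then obtain p where p: "z \<le> p" "p \<le> w" "(T ^^ Suc k) p - p = 0"
    using IVT'[of "\<lambda>y. (T ^^ Suc k) y - y" z 0 w] z w by (auto simp del: funpow.simps)
  then have "Per (Suc k) p" using A by (intro periodic) (auto simp del: funpow.simps)
  then show False using noper[of p] p z w k by auto
qed

text \<open>Supplies the end point \<open>y0 + \<rho>\<close> whose image after the pole is at least
  \<open>- D\<close>. The piece \<open>{y0 + \<rho> / 2..y0 + \<rho>}\<close> keeps length at least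
  \<open>\<rho> / 2\<close> under the first \<open>n\<close> steps, so the Riccati bound allows a
  leftward jump of at most \<open>2 * m / \<rho>\<close>.\<close>

lemma pole_to_periodic_right:
  assumes \<rho>: "\<rho> > 0" and D: "D \<ge> 1" "D \<ge> \<bar>R\<bar> + 2 * m / \<rho>" and I: "10 * D\<^sup>2 \<le> real I * c"
    and orbit: "\<And>y j. a < y \<Longrightarrow> y < b \<Longrightarrow> j < n \<Longrightarrow> (T ^^ j) y \<in> A"
    and y0: "a < y0" "y0 + \<rho> < b" "(T ^^ n) y0 \<notin> A"
  shows "\<exists>p k. a < p \<and> p < b \<and> 0 < k \<and> k \<le> n + I + 2 \<and> Per k p"
proof (rule ccontr)
  assume contra: "\<not> ?thesis"
  have y0b: "y0 < b" using y0 \<rho> by simp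
  have DR: "D \<ge> \<bar>R\<bar>" using D m \<rho> by (smt (verit) divide_pos_pos)
  have noper: "\<not> Per (Suc n) p" if "a < p" "p < b" for p
  proof
    assume P: "Per (Suc n) p"
    have "Suc n \<le> n + I + 2" by simp
    then show False using contra that P zero_less_Suc[of n] by blast
  qed
  have P: "(\<forall>y. a < y \<and> y < b \<and> y \<noteq> y0 \<longrightarrow> (T ^^ n) y \<in> A) \<and>
        filterlim (T ^^ Suc n) at_bot (at_right y0) \<and> filterlim (T ^^ Suc n) at_top (at_left y0)"
    by (rule pole) (use orbit noper y0 y0b in auto)
  have A: "(T ^^ j) y \<in> A" if "y0 < y" "y < b" "j \<le> n" for y j
    using P orbit[of y j] that y0 by (cases "j = n") auto
  define w where "w = (T ^^ n) (y0 + \<rho> / 2)"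
  define w1 where "w1 = (T ^^ n) (y0 + \<rho>)"
  have "{(T ^^ n) (y0 + \<rho> / 2)..(T ^^ n) (y0 + \<rho>)} \<subseteq> A \<and> (y0 + \<rho>) - (y0 + \<rho> / 2) \<le> (T ^^ n) (y0 + \<rho>) - (T ^^ n) (y0 + \<rho> / 2)"
    using A \<rho> y0 by (intro conjI funpow_image_interval) auto
  then have w: "{w..w1} \<subseteq> A" "\<rho> / 2 \<le> w1 - w" by (auto simp: w_def w1_def)
  have ww: "w < w1" using w \<rho> by linarith
  \<comment> \<open>The orbit of \<open>y0\<close> arrives outside \<open>A\<close>, hence not left
    of \<open>p1\<close>, and the iterate of order \<open>n\<close> increases to the right of
    \<open>y0\<close> and is continuous at \<open>y0\<close>.\<close>
  have "p1 \<le> w1"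
  proof (rule ccontr)
    assume "\<not> p1 \<le> w1"
    moreover have "p1 \<le> (T ^^ n) y0" using y0(3) complement_bounds(3) by blast
    ultimately have lt: "w1 < (T ^^ n) y0" by simp
    have c0: "isCont (T ^^ n) y0" using orbit y0 y0b by (intro funpow_continuous) auto
    have "((\<lambda>y. (T ^^ n) y) \<longlongrightarrow> (T ^^ n) y0) (at_right y0)"
      using c0 by (simp add: isCont_def filterlim_at_split)
    then have "\<forall>\<^sub>F y in at_right y0. w1 < (T ^^ n) y" using lt by (rule order_tendstoD)
    moreover have "\<forall>\<^sub>F y in at_right y0. y0 < y \<and> y < y0 + \<rho>"
      using \<rho> by (auto simp: eventually_at_right_field intro: exI[of _ "y0 + \<rho>"])
    ultimately have "\<forall>\<^sub>F y in at_right y0. w1 < (T ^^ n) y \<and> y0 < y \<and> y < y0 + \<rho>"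
      by eventually_elim auto
    then obtain y where y: "w1 < (T ^^ n) y" "y0 < y" "y < y0 + \<rho>"
      using eventually_happens trivial_limit_at_right_real by blast
    have "(y0 + \<rho>) - y \<le> (T ^^ n) (y0 + \<rho>) - (T ^^ n) y"
      using A y y0 by (intro funpow_image_interval(2)) auto
    then show False using y by (simp add: w1_def)
  qed
  then have "- \<bar>R\<bar> \<le> w1" using complement_bounds(5) by linarith
  moreover have "m / (w1 - w) \<le> m / (\<rho> / 2)" using w m \<rho> by (intro divide_left_mono) auto
  moreover have "w1 - m / (w1 - w) \<le> T w1" using riccati_right[OF ww w(1)] .
  moreover have "\<bar>R\<bar> + m / (\<rho> / 2) \<le> D" using D(2) by (simp add: mult.commute)
  moreover have "(T ^^ Suc n) (y0 + \<rho>) = T w1" by (simp add: w1_def)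
  ultimately have "- D \<le> (T ^^ Suc n) (y0 + \<rho>)" by linarith
  then have "\<exists>p k. y0 < p \<and> p < b \<and> 0 < k \<and> k \<le> n + I + 2 \<and> Per k p"
    using A P \<rho> y0 by (intro periodic_right_of_pole[OF D(1) DR I y0b, of n "y0 + \<rho>"]) auto
  then show False using contra y0 by (meson less_trans)
qed

text \<open>The entrance argument runs on the closed interval of radius \<rho>, the pole argument on
  the open one of radius \<open>2 * \<rho>\<close>. A pole in the left half has room \<rho> on its
  right; for the other half the line is reflected. The count is at most \<open>K + I\<close> steps
  to the first pole and \<open>I + 2\<close> more to the periodic point.\<close>

theorem periodic_point_in_interval:
  assumes \<rho>: "\<rho> > 0" and D: "D \<ge> 1" "D \<ge> \<bar>R\<bar> + 2 * m / \<rho>" "D \<ge> \<bar>x\<bar> + \<rho>" and L: "L \<ge> p2 - p1 + m + 1"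
    and K: "L < (1 + c / (1 + (D + L)\<^sup>2)) ^ K * (2 * \<rho>)" and I: "10 * D\<^sup>2 \<le> real I * c"
  shows "\<exists>p k. x - 2 * \<rho> < p \<and> p < x + 2 * \<rho> \<and> 0 < k \<and> k \<le> K + 2 * I + 2 \<and> Per k p"
proof -
  let ?a = "x - 2 * \<rho>" and ?b = "x + 2 * \<rho>"
  have "m / (2 * \<rho>) \<le> 2 * m / \<rho>" using m \<rho> by (simp add: field_simps)
  then have D': "D \<ge> \<bar>R\<bar> + m / (2 * \<rho>)" using D by linarith
  have "\<exists>k\<le>K + I. \<not> {(T ^^ k) (x - \<rho>)..(T ^^ k) (x + \<rho>)} \<subseteq> A"
    by (rule interval_entrance[OF _ D(1) D' L K I]) (use \<rho> D(3) in auto)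
  then obtain k where k: "k \<le> K + I" "\<not> {(T ^^ k) (x - \<rho>)..(T ^^ k) (x + \<rho>)} \<subseteq> A" by blast
  have "\<exists>k\<le>K + I. \<exists>y. ?a < y \<and> y < ?b \<and> (T ^^ k) y \<notin> A"
  proof (rule ccontr)
    assume "\<not> ?thesis"
    then have "(T ^^ j) y \<in> A" if "j \<le> k" "?a < y" "y < ?b" for j y using that k(1) by force
    then have "{(T ^^ k) (x - \<rho>)..(T ^^ k) (x + \<rho>)} \<subseteq> A" using \<rho> by (intro funpow_image_interval) auto
    then show False using k by blast
  qed
  from first_entrance[OF this] obtain n y0
    where n: "n \<le> K + I" "?a < y0" "y0 < ?b" "(T ^^ n) y0 \<notin> A"
      and n': "\<forall>j y. j < n \<longrightarrow> ?a < y \<longrightarrow> y < ?b \<longrightarrow> (T ^^ j) y \<in> A" by blast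
  note n = n n'[rule_format]
  have "\<exists>p k. ?a < p \<and> p < ?b \<and> 0 < k \<and> k \<le> n + I + 2 \<and> Per k p"
  proof (cases "y0 \<le> x")
    case True
    then show ?thesis using n \<rho> by (intro pole_to_periodic_right[OF \<rho> D(1,2) I]) auto
  next
    case False
    interpret M: expanding_dynamics "\<lambda>y. - T (- y)" "{y. - y \<in> A}" m c C R "\<lambda>n y. Per n (- y)" by (rule mirror)
    have fp: "((\<lambda>y. - T (- y)) ^^ n) y = - ((T ^^ n) (- y))" for n y by (induction n) auto
    have "\<exists>p k. - ?b < p \<and> p < - ?a \<and> 0 < k \<and> k \<le> n + I + 2 \<and> Per k (- p)"
    proof (rule M.pole_to_periodic_right[OF \<rho> D(1,2) I, of _ _ n "- y0"])
      fix y j assume "- ?b < y" "y < - ?a" "j < n"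
      then show "((\<lambda>y. - T (- y)) ^^ j) y \<in> {y. - y \<in> A}" using n(5)[of j "- y"] unfolding fp by auto
    qed (use n \<rho> False in \<open>auto simp: fp\<close>)
    then obtain p k where "- ?b < p" "p < - ?a" "0 < k" "k \<le> n + I + 2" "Per k (- p)" by blast
    then show ?thesis by (intro exI[of _ "- p"] exI[of _ k]) auto
  qed
  then obtain p k where "?a < p" "p < ?b" "0 < k" "k \<le> n + I + 2" "Per k p" by blast
  then show ?thesis using n(1) by (intro exI[of _ p] exI[of _ k]) auto
qed

end

text \<open>With excursions bounded by \<open>D = D0 / r\<close>, growth at rate at least
  \<open>\<kappa> * r\<^sup>2\<close> takes of order -ln r / r^2 steps and the drift of order 1 /
  r^2 steps, with constants that do not involve \<open>x\<close>.\<close>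

theorem (in expanding_dynamics) short_period_near_point:
  "\<exists>W>1. \<forall>x. \<exists>r0>0. \<forall>r. 0 < r \<and> r < r0 \<longrightarrow>
     (\<exists>p k. x - r < p \<and> p < x + r \<and> real k < (1 - ln r) * (W / r\<^sup>2) \<and> Per k p)"
proof -
  define L where "L = p2 - p1 + m + 1"
  define D0 where "D0 = \<bar>R\<bar> + 4 * m + 2"
  define \<kappa> where "\<kappa> = min (1/2) (c / (1 + (D0 + L)\<^sup>2))"
  \<comment> \<open>The first term pays for \<open>K\<close>, the second for two copies of
    \<open>I\<close>. The constant 10 absorbs the roundings and the final 2, which together amount
    to at most 6.\<close>
  define W where "W = 2 * (ln L + 1) / \<kappa> + 20 * D0\<^sup>2 / c + 10"
  have L: "L \<ge> 1" using m complement_bounds(7) by (simp add: L_def)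
  have D0: "D0 \<ge> 2" using m by (simp add: D0_def)
  have "c / (1 + (D0 + L)\<^sup>2) > 0" using c by (intro divide_pos_pos) (auto simp: add_pos_nonneg)
  then have \<kappa>: "\<kappa> > 0" "\<kappa> \<le> 1/2" "\<kappa> \<le> c / (1 + (D0 + L)\<^sup>2)"
    unfolding \<kappa>_def by (simp_all only: min.cobounded1 min.cobounded2)
  have W1: "2 * (ln L + 1) / \<kappa> \<ge> 0" "20 * D0\<^sup>2 / c \<ge> 0" using L \<kappa> c by auto
  have "\<exists>p k. x - r < p \<and> p < x + r \<and> real k < (1 - ln r) * (W / r\<^sup>2) \<and> Per k p"
    if r: "0 < r" "r < 1 / (\<bar>x\<bar> + 1)" for x r
  proof -
    have rx: "r * (\<bar>x\<bar> + 1) < 1" using r by (simp add: pos_less_divide_eq add_nonneg_pos)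
    have "r * 1 \<le> r * (\<bar>x\<bar> + 1)" using r by (intro mult_left_mono) auto
    then have r1: "r < 1" using rx by simp
    define D where "D = D0 / r"
    define K where "K = nat \<lceil>2 * (ln L - ln r) / (\<kappa> * r\<^sup>2)\<rceil> + 1"
    define I where "I = nat \<lceil>10 * D\<^sup>2 / c\<rceil>"
    have r2: "0 < r\<^sup>2" "r\<^sup>2 \<le> 1" using r r1 by (auto simp: power_le_one)
    have inv_r: "1 \<le> 1 / r" using r r1 by simp
    have D1: "D \<ge> 1" using D0 r r1 by (simp add: D_def pos_le_divide_eq)
    have D2: "D \<ge> \<bar>R\<bar> + 2 * m / (r / 2)"
    proof -
      have "\<bar>R\<bar> * r \<le> \<bar>R\<bar> * 1" using r r1 by (intro mult_left_mono) auto
      then have "\<bar>R\<bar> * r + 4 * m \<le> D0" by (simp add: D0_def)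
      then have "(\<bar>R\<bar> * r + 4 * m) / r \<le> D" unfolding D_def using r by (intro divide_right_mono) auto
      moreover have "(\<bar>R\<bar> * r + 4 * m) / r = \<bar>R\<bar> + 2 * m / (r / 2)" using r by (simp add: add_divide_distrib)
      ultimately show ?thesis by simp
    qed
    have D3: "D \<ge> \<bar>x\<bar> + r / 2"
    proof -
      have "\<bar>x\<bar> * r \<le> 1" "r * r \<le> 1" using rx r r1 by (auto simp: algebra_simps mult_le_one)
      then have "(\<bar>x\<bar> + r / 2) * r \<le> D0" using D0 by (simp add: algebra_simps)
      then show ?thesis using r by (simp add: D_def pos_le_divide_eq)
    qed
    have q: "\<kappa> * r\<^sup>2 \<le> c / (1 + (D + L)\<^sup>2)"
    proof -
      have "L * r \<le> L * 1" using L r r1 by (intro mult_left_mono) auto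
      then have "L \<le> L / r" using r by (simp add: pos_le_divide_eq)
      then have "D + L \<le> (D0 + L) / r" by (simp add: D_def add_divide_distrib)
      then have "(D + L)\<^sup>2 \<le> ((D0 + L) / r)\<^sup>2" using D1 L by (intro power_mono) auto
      then have "(D + L)\<^sup>2 * r\<^sup>2 \<le> (D0 + L)\<^sup>2" using r2 by (simp add: power_divide pos_le_divide_eq)
      then have le: "(1 + (D + L)\<^sup>2) * r\<^sup>2 \<le> 1 + (D0 + L)\<^sup>2" using r2 by (simp add: distrib_right)
      have "\<kappa> * r\<^sup>2 * (1 + (D + L)\<^sup>2) = \<kappa> * ((1 + (D + L)\<^sup>2) * r\<^sup>2)" by simp
      also have "\<dots> \<le> \<kappa> * (1 + (D0 + L)\<^sup>2)" using le \<kappa> by (intro mult_left_mono) auto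
      also have "\<dots> \<le> c" using \<kappa>(3) by (simp add: pos_le_divide_eq add_pos_nonneg)
      finally show ?thesis by (simp add: pos_le_divide_eq add_pos_nonneg)
    qed
    define e where "e = \<kappa> * r\<^sup>2"
    have e: "e > 0" "e \<le> 1/2" using \<kappa> r2 mult_mono[of \<kappa> "1/2" "r\<^sup>2" 1] by (auto simp: e_def)
    have lnr: "ln r \<le> 0" using r r1 by simp
    have lnL: "ln L \<ge> 0" using L by simp
    have K: "L < (1 + c / (1 + (D + L)\<^sup>2)) ^ K * (2 * (r / 2))"
    proof -
      \<comment> \<open>\<open>\<kappa> \<le> 1/2\<close> ensures \<open>e \<le> 1/2\<close>, where
        ln (1 + e) is at least e / 2; this loss of a factor 2 is the 2 in the definition of
        \<open>K\<close>.\<close>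
      have "e * e \<le> e * (1/2)" using e by (intro mult_left_mono) auto
      then have "e / 2 \<le> e - e\<^sup>2" by (simp add: power2_eq_square)
      also have "\<dots> \<le> ln (1 + e)" using e by (intro ln_one_plus_pos_lower_bound) auto
      finally have ln: "e / 2 \<le> ln (1 + e)" .
      have "2 * (ln L - ln r) / e < real K"
        unfolding K_def e_def by linarith
      then have "ln L - ln r < real K * (e / 2)" using e by (simp add: pos_divide_less_eq)
      also have "\<dots> \<le> real K * ln (1 + e)" using ln by (intro mult_left_mono) auto
      also have "\<dots> = ln ((1 + e) ^ K)" using e by (simp add: ln_realpow)
      finally have "ln (L / r) < ln ((1 + e) ^ K)" using L r by (simp add: ln_div)
      then have "L / r < (1 + e) ^ K" using L r e by (subst (asm) ln_less_cancel_iff) auto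
      also have "\<dots> \<le> (1 + c / (1 + (D + L)\<^sup>2)) ^ K" using q e by (intro power_mono) (auto simp: e_def)
      finally show ?thesis using r by (simp add: pos_divide_less_eq)
    qed
    have "10 * D\<^sup>2 / c \<le> real I" unfolding I_def by linarith
    then have I: "10 * D\<^sup>2 \<le> real I * c" using c by (simp add: pos_divide_le_eq)
    obtain p k where pk: "x - 2 * (r / 2) < p" "p < x + 2 * (r / 2)" "k \<le> K + 2 * I + 2" "Per k p"
      using periodic_point_in_interval[of "r / 2" D x L K I] r D1 D2 D3 K I by (auto simp: L_def)
    define s where "s = 1 / r\<^sup>2"
    define t where "t = 1 - ln r"
    have st: "s \<ge> 1" "t \<ge> 1" using r2 lnr by (auto simp: s_def t_def)
    then have ts: "1 \<le> t * s" "s \<le> t * s" using mult_mono[of 1 t 1 s] mult_right_mono[of 1 t s] by auto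
    have "2 * (ln L - ln r) / e \<ge> 0" using lnL lnr e by simp
    then have "real K \<le> 2 * (ln L - ln r) / e + 2"
      unfolding K_def e_def by linarith
    moreover have "2 * (ln L - ln r) / e \<le> 2 * (ln L + 1) / \<kappa> * (t * s)"
    proof -
      have "ln L * 1 \<le> ln L * t" using lnL st by (intro mult_left_mono) auto
      then have "ln L - ln r \<le> (ln L + 1) * t" by (simp add: t_def algebra_simps)
      then have "2 * (ln L - ln r) / e \<le> 2 * ((ln L + 1) * t) / e" using e by (intro divide_right_mono) auto
      also have "\<dots> = 2 * (ln L + 1) / \<kappa> * (t * s)" by (simp add: e_def s_def)
      finally show ?thesis .
    qed
    moreover have "real I \<le> 10 * D\<^sup>2 / c + 1"
    proof -
      have "10 * D\<^sup>2 / c \<ge> 0" using c by simp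
      then show ?thesis unfolding I_def by linarith
    qed
    moreover have "2 * (10 * D\<^sup>2 / c) \<le> 20 * D0\<^sup>2 / c * (t * s)"
    proof -
      have "2 * (10 * D\<^sup>2 / c) = 20 * D0\<^sup>2 / c * s" by (simp add: D_def s_def power_divide)
      also have "\<dots> \<le> 20 * D0\<^sup>2 / c * (t * s)" using ts W1 by (intro mult_left_mono) auto
      finally show ?thesis .
    qed
    moreover have "real k \<le> real K + 2 * real I + 2" using pk(3) by linarith
    ultimately have "real k \<le> 2 * (ln L + 1) / \<kappa> * (t * s) + 20 * D0\<^sup>2 / c * (t * s) + 6" by linarith
    also have "\<dots> < W * (t * s)" unfolding W_def distrib_right using ts by linarith
    also have "\<dots> = (1 - ln r) * (W / r\<^sup>2)" by (simp add: s_def t_def)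
    finally show ?thesis using pk by (intro exI[of _ p] exI[of _ k]) auto
  qed
  note near = this
  show ?thesis
  proof (rule exI[of _ W], intro conjI allI)
    show "W > 1" using W1 by (simp add: W_def)
    fix x :: real
    \<comment> \<open>The choice of \<open>r0\<close> gives \<open>r * \<bar>x\<bar> < 1\<close>, so
      \<open>D0 / r\<close> also dominates the starting point; the dependence on \<open>x\<close> is
      confined to \<open>r0\<close>.\<close>
    show "\<exists>r0>0. \<forall>r. 0 < r \<and> r < r0 \<longrightarrow>
      (\<exists>p k. x - r < p \<and> p < x + r \<and> real k < (1 - ln r) * (W / r\<^sup>2) \<and> Per k p)"
      using near by (intro exI[of _ "1 / (\<bar>x\<bar> + 1)"]) (simp add: add_nonneg_pos)
  qed
qed

theorem proposition4p6:
  fixes h :: "complex \<Rightarrow> complex"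
  assumes "one_component_doubly_parabolic_half_plane h"
  shows "\<exists>c W K :: real. c > 0 \<and> W > 1 \<and> K > 1 \<and>
    (\<forall>x::real. \<exists>r0>0. \<forall>r::real. 0 < r \<and> r < r0 \<longrightarrow>
      (\<exists>p n. p \<in> {x - r<..<x + r} \<and> periodic_point (radial_extension h) n p \<and>
        real n < (- ln r / ln K + 1) * (W / (c * r^2)) + x^2 / c))"
proof -
  obtain g q A B where "doubly_parabolic_model g h q A B"
    using doubly_parabolic_model_exists[OF assms] by blast
  then interpret model: doubly_parabolic_model g h q A B .
  obtain \<mu> where \<mu>: "\<mu> \<noteq> 0" "((\<lambda>\<zeta>. \<zeta> * (h \<zeta> - \<zeta>)) \<longlongrightarrow> \<mu>) half_plane_infinity"
    by (rule model.h_expansion_at_infinity)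
  interpret bd: parabolic_boundary h \<mu>
    by unfold_locales (use model.h_self_map \<mu> model.negligible_no_boundary_limit in auto)
  obtain R1 where R1: "\<And>x. R1 < \<bar>x\<bar> \<Longrightarrow> regular_at h x"
    using model.h_regular_near_infinity by blast
  obtain R2 where R2: "\<And>x. R2 < \<bar>x\<bar> \<Longrightarrow> regular_at h x \<Longrightarrow> \<bar>x\<bar> * \<bar>bd.T x - x\<bar> \<le> bd.m + 1"
    using bd.T_near_infinity by blast
  interpret dyn: expanding_dynamics bd.T bd.A bd.m bd.c "bd.m + 1" "max R1 R2"
    "\<lambda>n p. periodic_point (radial_extension h) n p"
  proof
    show "open bd.A" unfolding bd.A_def by (rule open_regular_at)
    show "\<exists>d. (bd.T has_real_derivative d) (at x) \<and> 1 + (bd.T x - x)\<^sup>2 / bd.m \<le> d \<and> 1 + bd.c / (1 + x\<^sup>2) \<le> d"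
      if "x \<in> bd.A" for x
    proof -
      from that have "regular_at h x" by (simp add: bd.A_def)
      then obtain d where "(bd.T has_real_derivative d) (at x)" "1 + (bd.T x - x)\<^sup>2 / bd.m \<le> d" "1 + bd.c / (1 + x\<^sup>2) \<le> d"
        by (rule bd.T_derivative)
      then show ?thesis by (intro exI[of _ d] conjI)
    qed
    show "periodic_point (radial_extension h) (Suc n) y"
      if "\<And>j. j \<le> n \<Longrightarrow> (bd.T ^^ j) y \<in> bd.A" "(bd.T ^^ Suc n) y = y" for n y
      using that by (rule bd.periodic_pointI')
    show "(\<forall>y. a < y \<and> y < b \<and> y \<noteq> y0 \<longrightarrow> (bd.T ^^ n) y \<in> bd.A) \<and>
        filterlim (bd.T ^^ Suc n) at_bot (at_right y0) \<and> filterlim (bd.T ^^ Suc n) at_top (at_left y0)"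
      if "\<And>y j. a < y \<Longrightarrow> y < b \<Longrightarrow> j < n \<Longrightarrow> (bd.T ^^ j) y \<in> bd.A"
        "\<And>p. a < p \<Longrightarrow> p < b \<Longrightarrow> \<not> periodic_point (radial_extension h) (Suc n) p"
        "a < y0" "y0 < b" "(bd.T ^^ n) y0 \<notin> bd.A" for a b n y0
      using bd.pole_of_first_entrance[OF that] by blast
  qed (use bd.m_pos bd.c_pos R1 R2 in \<open>auto simp: bd.A_def\<close>)
  obtain W where W: "W > 1" "\<And>x. \<exists>r0>0. \<forall>r. 0 < r \<and> r < r0 \<longrightarrow>
     (\<exists>p k. x - r < p \<and> p < x + r \<and> real k < (1 - ln r) * (W / r\<^sup>2) \<and> periodic_point (radial_extension h) k p)"
    using dyn.short_period_near_point by blast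
  \<comment> \<open>With \<open>c = 1\<close> and \<open>K = exp 1\<close> the first summand is
    exactly the bound already obtained, and the square of \<open>x\<close> only adds slack.\<close>
  show ?thesis
  proof (rule exI[of _ 1], rule exI[of _ W], rule exI[of _ "exp 1"], intro conjI allI)
    fix x :: real
    obtain r0 where r0: "r0 > 0" "\<And>r. 0 < r \<Longrightarrow> r < r0 \<Longrightarrow>
      \<exists>p k. x - r < p \<and> p < x + r \<and> real k < (1 - ln r) * (W / r\<^sup>2) \<and> periodic_point (radial_extension h) k p"
      using W(2)[of x] by blast
    show "\<exists>r0::real>0. \<forall>r::real. 0 < r \<and> r < r0 \<longrightarrow>
      (\<exists>p n. p \<in> {x - r<..<x + r} \<and> periodic_point (radial_extension h) n p \<and>
        real n < (- ln r / ln (exp 1) + 1) * (W / (1 * r^2)) + x^2 / 1)"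
    proof (rule exI[of _ r0], intro conjI allI impI)
      fix r assume "0 < r \<and> r < r0"
      then obtain p k where pk: "x - r < p" "p < x + r" "real k < (1 - ln r) * (W / r\<^sup>2)"
          "periodic_point (radial_extension h) k p"
        using r0(2)[of r] by blast
      have "(1 - ln r) * (W / r\<^sup>2) \<le> (- ln r / ln (exp 1) + 1) * (W / (1 * r^2)) + x^2 / 1" by simp
      then have "real k < (- ln r / ln (exp 1) + 1) * (W / (1 * r^2)) + x^2 / 1" using pk(3) by linarith
      then show "\<exists>p n. p \<in> {x - r<..<x + r} \<and> periodic_point (radial_extension h) n p \<and>
        real n < (- ln r / ln (exp 1) + 1) * (W / (1 * r^2)) + x^2 / 1"
        using pk by (intro exI[of _ p] exI[of _ k]) auto
    qed (rule r0)
  qed (use W in auto)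
qed

end
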